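(* Let $p$ be a prime and let $S/R$ be a finite extension of discrete valuation rings of characteristic $p$ (not necessarily complete), with corresponding extension of fields of fractions $L/K$. Let $n=[L:K]$, let $v_L$ be the normalised valuation on $L$ associated to $S$, and let $w=v_L(\mathcal{D}_{S/R})$. Suppose $L/K$ is separable and is $H$-Galois for some $K$-Hopf algebra $H$, and let $b\in\mathbb{Z}$. If (i) $n$ is not a power of $p$, or (ii) $S/R$ is not totally ramified, or (iii) $b\not\equiv -w-1\pmod n$, then there exists $\rho\in L$ with $v_L(\rho)=b$ such that $\rho$ is not a normal basis generator for $L/K$ with respect to $H$.
   Context: Valuations are normalised so that $v_L(L)=\mathbb{Z}\cup\{\infty\}$. The different $\mathcal{D}_{S/R}$ is the fractional $S$-ideal with $\mathcal{D}_{S/R}^{-1}=\{x\in L : \mathrm{Tr}_{L/K}(xS)\subseteq R\}$. A finite separable extension $L/K$ is $H$-Galois, for a $K$-Hopf algebra $H$, if $L$ is an $H$-module algebra and the map $H\to\mathrm{End}_K(L)$ giving the action extends to an $L$-linear isomorphism $L\otimes_K H\to \mathrm{End}_K(L)$. In that case $L$ is a free $H$-module of rank $1$, and a normal basis generator for $L/K$ with respect to $H$ means a free generator of the $H$-module $L$. *)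

theory Defs
  imports "HOL-Computational_Algebra.Polynomial" "HOL-Number_Theory.Cong"
begin

text \<open>The field L is the ambient type 'a; K is a subfield given as a subset of L.\<close>

definition subfield :: "'a::field set \<Rightarrow> bool" where
  "subfield K \<longleftrightarrow> 0 \<in> K \<and> 1 \<in> K \<and>
     (\<forall>x\<in>K. \<forall>y\<in>K. x + y \<in> K \<and> x * y \<in> K) \<and>
     (\<forall>x\<in>K. - x \<in> K \<and> inverse x \<in> K)"

definition k_lin_indep :: "'a::field set \<Rightarrow> (nat \<Rightarrow> 'a) \<Rightarrow> nat \<Rightarrow> bool" where
  "k_lin_indep K b n \<longleftrightarrow>
     (\<forall>c. (\<forall>i<n. c i \<in> K) \<longrightarrow> (\<Sum>i<n. c i * b i) = 0 \<longrightarrow> (\<forall>i<n. c i = 0))"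

definition k_spans :: "'a::field set \<Rightarrow> (nat \<Rightarrow> 'a) \<Rightarrow> nat \<Rightarrow> bool" where
  "k_spans K b n \<longleftrightarrow> (\<forall>y. \<exists>c. (\<forall>i<n. c i \<in> K) \<and> y = (\<Sum>i<n. c i * b i))"

definition k_basis :: "'a::field set \<Rightarrow> (nat \<Rightarrow> 'a) \<Rightarrow> nat \<Rightarrow> bool" where
  "k_basis K b n \<longleftrightarrow> k_lin_indep K b n \<and> k_spans K b n"

definition ext_degree_is :: "'a::field set \<Rightarrow> nat \<Rightarrow> bool" where
  "ext_degree_is K n \<longleftrightarrow> (\<exists>b. k_basis K b n)"

definition k_coord :: "'a::field set \<Rightarrow> (nat \<Rightarrow> 'a) \<Rightarrow> nat \<Rightarrow> 'a \<Rightarrow> nat \<Rightarrow> 'a" where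
  "k_coord K b n y = (SOME c. (\<forall>i<n. c i \<in> K) \<and> y = (\<Sum>i<n. c i * b i))"

definition field_trace :: "'a::field set \<Rightarrow> 'a \<Rightarrow> 'a" where
  "field_trace K x =
     (let n = (SOME n. ext_degree_is K n); b = (SOME b. k_basis K b n)
      in (\<Sum>i<n. k_coord K b n (x * b i) i))"

definition k_linear :: "'a::field set \<Rightarrow> ('a \<Rightarrow> 'a) \<Rightarrow> bool" where
  "k_linear K f \<longleftrightarrow> (\<forall>x y. f (x + y) = f x + f y) \<and> (\<forall>c\<in>K. \<forall>x. f (c * x) = c * f x)"

definition separable_ext :: "'a::field set \<Rightarrow> bool" where
  "separable_ext K \<longleftrightarrow>
     (\<forall>x. \<exists>q. (\<forall>i. coeff q i \<in> K) \<and> q \<noteq> 0 \<and> poly q x = 0 \<and> coprime q (pderiv q))"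

text \<open>Normalised discrete valuation on L (value at 0 is irrelevant; v(0) = \<infinity> is encoded
  by always treating 0 separately).\<close>
definition normalised_discrete_valuation :: "('a::field \<Rightarrow> int) \<Rightarrow> bool" where
  "normalised_discrete_valuation v \<longleftrightarrow>
     (\<forall>x y. x \<noteq> 0 \<longrightarrow> y \<noteq> 0 \<longrightarrow> v (x * y) = v x + v y) \<and>
     (\<forall>x y. x \<noteq> 0 \<longrightarrow> y \<noteq> 0 \<longrightarrow> x + y \<noteq> 0 \<longrightarrow> min (v x) (v y) \<le> v (x + y)) \<and>
     (\<forall>k. \<exists>x. x \<noteq> 0 \<and> v x = k)"

definition val_ring :: "('a::field \<Rightarrow> int) \<Rightarrow> 'a set" where
  "val_ring v = {x. x = 0 \<or> 0 \<le> v x}"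

text \<open>R = S \<inter> K is a DVR: the valuation is nontrivial on K.\<close>
definition nontrivial_on :: "('a::field \<Rightarrow> int) \<Rightarrow> 'a set \<Rightarrow> bool" where
  "nontrivial_on v K \<longleftrightarrow> (\<exists>x\<in>K. x \<noteq> 0 \<and> v x \<noteq> 0)"

definition finite_over :: "'a::field set \<Rightarrow> 'a set \<Rightarrow> bool" where
  "finite_over R S \<longleftrightarrow>
     (\<exists>r g. (\<forall>i<r. g i \<in> S) \<and>
            S = {y. \<exists>c. (\<forall>i<r. c i \<in> R) \<and> y = (\<Sum>i<(r::nat). c i * g i)})"

definition ram_index :: "('a::field \<Rightarrow> int) \<Rightarrow> 'a set \<Rightarrow> nat" where
  "ram_index v K = (LEAST e. 0 < e \<and> (\<exists>x\<in>K. x \<noteq> 0 \<and> v x = int e))"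

definition totally_ramified :: "('a::field \<Rightarrow> int) \<Rightarrow> 'a set \<Rightarrow> nat \<Rightarrow> bool" where
  "totally_ramified v K n \<longleftrightarrow> ram_index v K = n"

definition inv_different :: "('a::field \<Rightarrow> int) \<Rightarrow> 'a set \<Rightarrow> 'a set" where
  "inv_different v K =
     {x. \<forall>s\<in>val_ring v. field_trace K (x * s) \<in> val_ring v \<inter> K}"

definition different_val :: "('a::field \<Rightarrow> int) \<Rightarrow> 'a set \<Rightarrow> int" where
  "different_val v K = (THE w. inv_different v K = {x. x = 0 \<or> - w \<le> v x})"

text \<open>A K-Hopf algebra H with K-basis e_0,...,e_{m-1}, given by structure constants in K:
  e_i e_j = \<Sum>_k mu i j k e_k, 1_H = \<Sum>_k u k e_k, \<Delta>(e_k) = \<Sum>_{i,j} de k i j e_i \<otimes> e_j,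
  \<epsilon>(e_k) = ep k, S(e_k) = \<Sum>_l s k l e_l.\<close>
definition hopf_algebra ::
  "'a::field set \<Rightarrow> nat \<Rightarrow> (nat \<Rightarrow> nat \<Rightarrow> nat \<Rightarrow> 'a) \<Rightarrow> (nat \<Rightarrow> 'a) \<Rightarrow>
   (nat \<Rightarrow> nat \<Rightarrow> nat \<Rightarrow> 'a) \<Rightarrow> (nat \<Rightarrow> 'a) \<Rightarrow> (nat \<Rightarrow> nat \<Rightarrow> 'a) \<Rightarrow> bool" where
  "hopf_algebra K m mu u de ep s \<longleftrightarrow>
     (\<forall>i<m. \<forall>j<m. \<forall>k<m. mu i j k \<in> K \<and> de i j k \<in> K) \<and>
     (\<forall>i<m. u i \<in> K \<and> ep i \<in> K) \<and> (\<forall>i<m. \<forall>j<m. s i j \<in> K) \<and>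
     \<comment> \<open>associativity\<close>
     (\<forall>i<m. \<forall>j<m. \<forall>l<m. \<forall>r<m.
        (\<Sum>k<m. mu i j k * mu k l r) = (\<Sum>k<m. mu j l k * mu i k r)) \<and>
     \<comment> \<open>unit\<close>
     (\<forall>j<m. \<forall>r<m. (\<Sum>k<m. u k * mu k j r) = (if j = r then 1 else 0) \<and>
                    (\<Sum>k<m. u k * mu j k r) = (if j = r then 1 else 0)) \<and>
     \<comment> \<open>coassociativity\<close>
     (\<forall>k<m. \<forall>a<m. \<forall>b<m. \<forall>c<m.
        (\<Sum>i<m. de k i c * de i a b) = (\<Sum>i<m. de k a i * de i b c)) \<and>
     \<comment> \<open>counit\<close>
     (\<forall>k<m. \<forall>j<m. (\<Sum>i<m. ep i * de k i j) = (if k = j then 1 else 0) \<and>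
                    (\<Sum>i<m. ep i * de k j i) = (if k = j then 1 else 0)) \<and>
     \<comment> \<open>\<Delta> is an algebra homomorphism\<close>
     (\<forall>i<m. \<forall>j<m. \<forall>a<m. \<forall>b<m.
        (\<Sum>k<m. mu i j k * de k a b) =
        (\<Sum>a1<m. \<Sum>b1<m. \<Sum>a2<m. \<Sum>b2<m.
            de i a1 b1 * de j a2 b2 * mu a1 a2 a * mu b1 b2 b)) \<and>
     (\<forall>a<m. \<forall>b<m. (\<Sum>k<m. u k * de k a b) = u a * u b) \<and>
     \<comment> \<open>\<epsilon> is an algebra homomorphism\<close>
     (\<forall>i<m. \<forall>j<m. (\<Sum>k<m. mu i j k * ep k) = ep i * ep j) \<and>
     (\<Sum>k<m. u k * ep k) = 1 \<and>
     \<comment> \<open>antipode\<close>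
     (\<forall>k<m. \<forall>r<m.
        (\<Sum>a<m. \<Sum>b<m. \<Sum>l<m. de k a b * s a l * mu l b r) = ep k * u r \<and>
        (\<Sum>a<m. \<Sum>b<m. \<Sum>l<m. de k a b * s b l * mu a l r) = ep k * u r)"

definition module_algebra ::
  "'a::field set \<Rightarrow> nat \<Rightarrow> (nat \<Rightarrow> nat \<Rightarrow> nat \<Rightarrow> 'a) \<Rightarrow> (nat \<Rightarrow> 'a) \<Rightarrow>
   (nat \<Rightarrow> nat \<Rightarrow> nat \<Rightarrow> 'a) \<Rightarrow> (nat \<Rightarrow> 'a) \<Rightarrow> (nat \<Rightarrow> 'a \<Rightarrow> 'a) \<Rightarrow> bool" where
  "module_algebra K m mu u de ep act \<longleftrightarrow>
     (\<forall>k<m. k_linear K (act k)) \<and>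
     (\<forall>i<m. \<forall>j<m. \<forall>x. act i (act j x) = (\<Sum>k<m. mu i j k * act k x)) \<and>
     (\<forall>x. (\<Sum>k<m. u k * act k x) = x) \<and>
     (\<forall>k<m. \<forall>x y. act k (x * y) = (\<Sum>i<m. \<Sum>j<m. de k i j * act i x * act j y)) \<and>
     (\<forall>k<m. act k 1 = ep k)"

text \<open>L/K is H-Galois: L is an H-module algebra and L \<otimes>_K H \<rightarrow> End_K(L),
  x \<otimes> e_k \<mapsto> (y \<mapsto> x * act k y), is bijective.\<close>
definition hopf_galois ::
  "'a::field set \<Rightarrow> nat \<Rightarrow> (nat \<Rightarrow> nat \<Rightarrow> nat \<Rightarrow> 'a) \<Rightarrow> (nat \<Rightarrow> 'a) \<Rightarrow>
   (nat \<Rightarrow> nat \<Rightarrow> nat \<Rightarrow> 'a) \<Rightarrow> (nat \<Rightarrow> 'a) \<Rightarrow> (nat \<Rightarrow> nat \<Rightarrow> 'a) \<Rightarrow> (nat \<Rightarrow> 'a \<Rightarrow> 'a) \<Rightarrow> bool" where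
  "hopf_galois K m mu u de ep s act \<longleftrightarrow>
     hopf_algebra K m mu u de ep s \<and> module_algebra K m mu u de ep act \<and>
     (\<forall>x. (\<forall>y. (\<Sum>k<m. x k * act k y) = 0) \<longrightarrow> (\<forall>k<m. x k = 0)) \<and>
     (\<forall>f. k_linear K f \<longrightarrow> (\<exists>x. \<forall>y. f y = (\<Sum>k<m. x k * act k y)))"

text \<open>\<rho> is a normal basis generator: h \<mapsto> h \<cdot> \<rho> is an isomorphism H \<rightarrow> L.\<close>
definition normal_basis_gen :: "'a::field set \<Rightarrow> nat \<Rightarrow> (nat \<Rightarrow> 'a \<Rightarrow> 'a) \<Rightarrow> 'a \<Rightarrow> bool" where
  "normal_basis_gen K m act \<rho> \<longleftrightarrow> k_basis K (\<lambda>k. act k \<rho>) m"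

end

theory Submission
  imports "HOL-Algebra.Algebraic_Closure_Type" "HOL-Algebra.Sylow" Defs
begin

text \<open>
  An element \<open>\<rho>\<close> of a proper \<open>H\<close>-submodule of \<open>L\<close> is not a generator. The kernel of the trace is such
  a submodule, since \<open>Tr (h x) = \<epsilon>(h) Tr x\<close>. It contains elements of every valuation if the residue
  extension is nontrivial, and otherwise (then \<open>L/K\<close> is totally ramified) of every valuation not
  congruent to \<open>-w-1\<close> modulo \<open>n\<close>.

  In the remaining case \<open>n\<close> is not a power of \<open>p\<close> and \<open>b \<equiv> -w-1\<close>. Let \<open>V\<close> be the set of all \<open>x\<close> such
  that \<open>Hx\<close> is killed by some \<open>h\<close> with \<open>\<epsilon>(h) = 1\<close>. It is a submodule without nonzero elements of \<open>K\<close>,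
  and it is stable under \<open>x \<mapsto> x^p\<close>, because over an algebraic closure \<open>H\<close> is spanned by grouplike
  elements, which commute with Frobenius. If some element of \<open>V\<close> had valuation divisible by \<open>n\<close>, then
  after scaling \<open>V\<close> would contain some \<open>u \<equiv> 1\<close>, hence the limit 1 of \<open>u^(p^j)\<close>. So \<open>V\<close> has no such element,
  and linear algebra produces an element of valuation \<open>-w-1\<close> in the orthogonal complement of \<open>V\<close>
  under the trace form, which is a proper submodule as soon as \<open>V\<close> is nonzero. Finally, if \<open>V = 0\<close>
  then every nonzero submodule contains 1, dually every proper submodule lies in the kernel of the
  trace, so the augmentation ideal acts nilpotently, the group of grouplike elements (which has
  order \<open>n\<close>) contains no element of prime order other than \<open>p\<close>, and \<open>n\<close> is a power of \<open>p\<close>.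
\<close>

subsection \<open>Linear algebra over a subfield\<close>

text \<open>In general no group acts on L, because enough grouplike elements of H exist only over an
  algebraic closure. There they form a group that permutes the n embeddings of L simply
  transitively: separability makes every K-linear map from L to the closure a combination of
  embeddings, and bijectivity of L \<otimes> H \<rightarrow> End(L) allows any embedding to be moved
  to any other. An identity that is linear in the element of H can therefore be checked on
  grouplikes and then descends to K. The trace identities and the compatibility with Frobenius are
  obtained in this way.

  K is not assumed complete. In place of completeness stands the fact that every K-linear functional
  from L to K is bounded, because S is finitely generated over R; limits are taken under such a
  functional and not in L.

  The number -w-1 is the largest valuation of an element with nonintegral trace. Two elements whose
  valuations add up to this class cannot be orthogonal once the residue extension is trivial, and
  this is what controls the orthogonal complement of V.\<close>

lemma subfieldD:
  assumes "subfield K"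
  shows "0 \<in> K" "1 \<in> K" "\<And>x y. x \<in> K \<Longrightarrow> y \<in> K \<Longrightarrow> x + y \<in> K"
    "\<And>x y. x \<in> K \<Longrightarrow> y \<in> K \<Longrightarrow> x * y \<in> K" "\<And>x. x \<in> K \<Longrightarrow> - x \<in> K"
    "\<And>x. x \<in> K \<Longrightarrow> inverse x \<in> K" "\<And>x y. x \<in> K \<Longrightarrow> y \<in> K \<Longrightarrow> x - y \<in> K"
    "\<And>x y. x \<in> K \<Longrightarrow> y \<in> K \<Longrightarrow> x / y \<in> K"
proof -
  show *: "0 \<in> K" "1 \<in> K" "\<And>x y. x \<in> K \<Longrightarrow> y \<in> K \<Longrightarrow> x + y \<in> K"
    "\<And>x y. x \<in> K \<Longrightarrow> y \<in> K \<Longrightarrow> x * y \<in> K" "\<And>x. x \<in> K \<Longrightarrow> - x \<in> K"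
    "\<And>x. x \<in> K \<Longrightarrow> inverse x \<in> K"
    using assms by (auto simp: subfield_def)
  fix x y assume xy: "x \<in> K" "y \<in> K"
  have "x - y = x + (- y)" "x / y = x * inverse y"
    by (simp_all add: field_simps)
  with * xy show "x - y \<in> K" "x / y \<in> K" by metis+
qed

lemma subfield_UNIV: "subfield UNIV"
  by (simp add: subfield_def)

lemma subfield_sum:
  assumes "subfield K" "\<And>i. i \<in> A \<Longrightarrow> f i \<in> K"
  shows "sum f A \<in> K"
  using assms(2) by (induction A rule: infinite_finite_induct) (auto intro: subfieldD[OF assms(1)])

lemma subfield_power:
  assumes "subfield K" "x \<in> K"
  shows "x ^ j \<in> K"
  using assms by (induction j) (auto intro: subfieldD)

lemma subfield_power_int:
  assumes "subfield K" "x \<in> K"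
  shows "x powi j \<in> K"
  using assms by (auto simp: power_int_def intro: subfieldD subfield_power)

text \<open>Gaussian elimination, one equation at a time: a pivot \<open>a i j0\<close> clears
  column \<open>j0\<close> from the other rows, and \<open>t\<close> is the value that equation
  \<open>i\<close> then forces on the unknown \<open>j0\<close>. Keeping track of the subfield lets
  the same statement serve over K, over L and over the algebraic closure.\<close>

lemma homogeneous_system_nontrivial_solution:
  fixes a :: "'i \<Rightarrow> 'j \<Rightarrow> 'a::field"
  assumes K: "subfield K" and "finite I" "finite J" "card I < card J"
    and "\<And>i j. i \<in> I \<Longrightarrow> j \<in> J \<Longrightarrow> a i j \<in> K"
  shows "\<exists>c. (\<forall>j\<in>J. c j \<in> K) \<and> (\<exists>j\<in>J. c j \<noteq> 0) \<and> (\<forall>i\<in>I. (\<Sum>j\<in>J. a i j * c j) = 0)"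
  using assms(2-)
proof (induction I arbitrary: J a rule: finite_induct)
  case empty
  then have "J \<noteq> {}" by auto
  then show ?case by (intro exI[of _ "\<lambda>_. 1"]) (auto intro: subfieldD[OF K])
next
  case (insert i I)
  show ?case
  proof (cases "\<forall>j\<in>J. a i j = 0")
    case True
    obtain c where "\<forall>j\<in>J. c j \<in> K" "\<exists>j\<in>J. c j \<noteq> 0" "\<forall>i\<in>I. (\<Sum>j\<in>J. a i j * c j) = 0"
      using insert.IH[of J a] insert.prems insert.hyps by auto
    with True show ?thesis by (intro exI[of _ c]) auto
  next
    case False
    then obtain j0 where j0: "j0 \<in> J" "a i j0 \<noteq> 0" by auto
    define J' where "J' = J - {j0}"
    have J: "J = insert j0 J'" "j0 \<notin> J'" "finite J'" using j0 insert.prems by (auto simp: J'_def)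
    define a' where "a' r j = a r j - a r j0 * inverse (a i j0) * a i j" for r j
    have a'K: "a' r j \<in> K" if "r \<in> I" "j \<in> J'" for r j
      unfolding a'_def using that insert.prems j0 J by (intro subfieldD[OF K]) auto
    have "card I < card J'" using insert.prems insert.hyps J by auto
    then obtain c where c: "\<forall>j\<in>J'. c j \<in> K" "\<exists>j\<in>J'. c j \<noteq> 0"
        "\<forall>r\<in>I. (\<Sum>j\<in>J'. a' r j * c j) = 0"
      using insert.IH[of J' a'] J a'K by blast
    define t where "t = - inverse (a i j0) * (\<Sum>j\<in>J'. a i j * c j)"
    define c' where "c' = c(j0 := t)"
    have t: "t \<in> K" unfolding t_def using c insert.prems j0 J
      by (intro subfieldD[OF K] subfield_sum[OF K]) auto
    have sums: "(\<Sum>j\<in>J. a r j * c' j) = a r j0 * t + (\<Sum>j\<in>J'. a r j * c j)" for r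
    proof -
      have "(\<Sum>j\<in>J'. a r j * c' j) = (\<Sum>j\<in>J'. a r j * c j)"
        using J by (intro sum.cong) (auto simp: c'_def)
      then show ?thesis using J by (simp add: c'_def)
    qed
    have "(\<Sum>j\<in>J. a r j * c' j) = 0" if r: "r \<in> insert i I" for r
    proof (cases "r = i")
      case True
      then show ?thesis unfolding sums t_def using j0 by simp
    next
      case False
      with r c have "0 = (\<Sum>j\<in>J'. a' r j * c j)" by simp
      also have "\<dots> = (\<Sum>j\<in>J'. a r j * c j) + a r j0 * t"
        unfolding a'_def t_def
        by (simp add: left_diff_distrib sum_subtractf sum_distrib_left mult.assoc sum_negf)
      finally show ?thesis unfolding sums by (simp add: add.commute)
    qed
    moreover have "\<forall>j\<in>J. c' j \<in> K" using c t J by (auto simp: c'_def)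
    moreover have "\<exists>j\<in>J. c' j \<noteq> 0" using c J by (auto simp: c'_def)
    ultimately show ?thesis by (intro exI[of _ c']) auto
  qed
qed

definition k_subspace :: "'a::field set \<Rightarrow> 'a set \<Rightarrow> bool" where
  "k_subspace K U \<longleftrightarrow> 0 \<in> U \<and> (\<forall>x\<in>U. \<forall>y\<in>U. x + y \<in> U) \<and> (\<forall>c\<in>K. \<forall>x\<in>U. c * x \<in> U)"

lemma k_subspaceD:
  assumes "k_subspace K U"
  shows "0 \<in> U" "\<And>x y. x \<in> U \<Longrightarrow> y \<in> U \<Longrightarrow> x + y \<in> U" "\<And>c x. c \<in> K \<Longrightarrow> x \<in> U \<Longrightarrow> c * x \<in> U"
  using assms by (auto simp: k_subspace_def)

lemma k_subspace_diff:
  assumes "subfield K" "k_subspace K U" "x \<in> U" "y \<in> U"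
  shows "x - y \<in> U"
proof -
  have "- 1 \<in> K" using assms by (intro subfieldD)
  then have "x + (- 1) * y \<in> U" using assms by (intro k_subspaceD[OF assms(2)])
  then show ?thesis by simp
qed

lemma k_subspace_sum:
  assumes "k_subspace K U" "\<And>i. i \<in> A \<Longrightarrow> f i \<in> U"
  shows "sum f A \<in> U"
  using assms(2) by (induction A rule: infinite_finite_induct) (auto intro: k_subspaceD[OF assms(1)])

lemma k_subspace_UNIV: "k_subspace K UNIV"
  by (simp add: k_subspace_def)

lemma k_linearD:
  assumes "k_linear K f"
  shows "f (x + y) = f x + f y" "c \<in> K \<Longrightarrow> f (c * x) = c * f x"
  using assms by (auto simp: k_linear_def)

lemma additive_sum:
  fixes f :: "'a::ab_group_add \<Rightarrow> 'b::ab_group_add"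
  assumes "\<And>x y. f (x + y) = f x + f y"
  shows "f 0 = 0" "f (\<Sum>i\<in>A. g i) = (\<Sum>i\<in>A. f (g i))" "f (- x) = - f x" "f (x - y) = f x - f y"
proof -
  show 0: "f 0 = 0" using assms[of 0 0] by simp
  show "f (\<Sum>i\<in>A. g i) = (\<Sum>i\<in>A. f (g i))"
    by (induction A rule: infinite_finite_induct) (simp_all add: 0 assms)
  show m: "f (- x) = - f x" for x using assms[of x "- x"] by (simp add: 0 eq_neg_iff_add_eq_0 add.commute)
  show "f (x - y) = f x - f y" using assms[of x "- y"] by (simp add: m)
qed

lemma k_linear_sum:
  assumes "k_linear K f"
  shows "f 0 = 0" "f (\<Sum>i\<in>A. g i) = (\<Sum>i\<in>A. f (g i))" "f (- x) = - f x" "f (x - y) = f x - f y"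
  by (intro additive_sum k_linearD[OF assms])+

text \<open>A subspace that is maximal among those avoiding \<open>z\<close> is a hyperplane.\<close>
lemma separating_functional:
  assumes K: "subfield K" and U: "k_subspace K U" and z: "z \<notin> U"
  shows "\<exists>f. k_linear K f \<and> range f \<subseteq> K \<and> (\<forall>x\<in>U. f x = 0) \<and> f z = 1"
proof -
  define AA where "AA = {W. k_subspace K W \<and> U \<subseteq> W \<and> z \<notin> W}"
  \<comment> \<open>Zorn's lemma instead of a basis: the result is also applied to the algebraic
    closure as a vector space over a subfield, where no finite basis is at hand.\<close>
  have "\<exists>M\<in>AA. \<forall>W\<in>AA. M \<subseteq> W \<longrightarrow> W = M"
  proof (rule subset_Zorn_nonempty)
    show "AA \<noteq> {}" using U z by (auto simp: AA_def)
    fix C assume C: "C \<noteq> {}" "subset.chain AA C"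
    have sub: "C \<subseteq> AA" and ch: "\<And>A B. A \<in> C \<Longrightarrow> B \<in> C \<Longrightarrow> A \<subseteq> B \<or> B \<subseteq> A"
      using C(2) by (auto simp: subset_chain_def)
    have "x + y \<in> \<Union> C" if xy: "x \<in> \<Union> C" "y \<in> \<Union> C" for x y
    proof -
      obtain A B where AB: "A \<in> C" "x \<in> A" "B \<in> C" "y \<in> B" using xy by auto
      then have "A \<union> B \<in> C" using ch[of A B] by (auto simp: sup.absorb1 sup.absorb2)
      moreover from this have "k_subspace K (A \<union> B)" using sub by (auto simp: AA_def)
      then have "x + y \<in> A \<union> B" using AB by (intro k_subspaceD(2)) auto
      ultimately show ?thesis by blast
    qed
    moreover have "c * x \<in> \<Union> C" if cx: "c \<in> K" "x \<in> \<Union> C" for c x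
    proof -
      obtain A where A: "A \<in> C" "x \<in> A" using cx by auto
      then have "c * x \<in> A" using sub cx by (auto simp: AA_def intro: k_subspaceD)
      then show ?thesis using A by blast
    qed
    moreover obtain A where "A \<in> C" using C(1) by auto
    then have "0 \<in> \<Union> C" "U \<subseteq> \<Union> C" using sub by (auto simp: AA_def dest: k_subspaceD(1))
    moreover have "z \<notin> \<Union> C" using sub by (auto simp: AA_def)
    ultimately show "\<Union> C \<in> AA" unfolding AA_def k_subspace_def by blast
  qed
  then obtain M where M: "k_subspace K M" "U \<subseteq> M" "z \<notin> M"
    and max: "\<And>W. k_subspace K W \<Longrightarrow> U \<subseteq> W \<Longrightarrow> z \<notin> W \<Longrightarrow> M \<subseteq> W \<Longrightarrow> W = M"
    by (auto simp: AA_def)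
  note MD = k_subspaceD[OF M(1)]
  \<comment> \<open>If x is outside M, then M + Kx is strictly larger and so contains z by
    maximality; solving for x shows that the whole space is M + Kz. The functional sought is the
    coefficient of z.\<close>
  have ex: "\<exists>c\<in>K. x - c * z \<in> M" for x
  proof (cases "x \<in> M")
    case True
    then show ?thesis using subfieldD(1)[OF K] by (intro bexI[of _ 0]) auto
  next
    case False
    define W where "W = {u + c * x | u c. u \<in> M \<and> c \<in> K}"
    have W: "k_subspace K W"
      unfolding k_subspace_def
    proof (intro conjI ballI)
      show "0 \<in> W" unfolding W_def using MD(1) subfieldD(1)[OF K] by force
    next
      fix y w assume "y \<in> W" "w \<in> W"
      then obtain u c u' c' where *: "u \<in> M" "c \<in> K" "u' \<in> M" "c' \<in> K" "y = u + c * x" "w = u' + c' * x"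
        by (auto simp: W_def)
      then have "y + w = (u + u') + (c + c') * x" by (simp add: algebra_simps)
      then show "y + w \<in> W" unfolding W_def using * MD(2) subfieldD(3)[OF K] by blast
    next
      fix d y assume "d \<in> K" "y \<in> W"
      then obtain u c where *: "u \<in> M" "c \<in> K" "d \<in> K" "y = u + c * x" by (auto simp: W_def)
      then have "d * y = d * u + (d * c) * x" by (simp add: algebra_simps)
      then show "d * y \<in> W" unfolding W_def using * MD(3) subfieldD(4)[OF K] by blast
    qed
    have MW: "M \<subseteq> W" unfolding W_def using subfieldD(1)[OF K] by force
    have "x \<in> W" unfolding W_def using subfieldD(2)[OF K] MD(1) by force
    then have "W \<noteq> M" using False by auto
    then have "z \<in> W" using max[OF W] MW M(2) by blast
    then obtain u c where uc: "u \<in> M" "c \<in> K" "z = u + c * x" by (auto simp: W_def)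
    then have c0: "c \<noteq> 0" using M(3) by auto
    have cK: "inverse c \<in> K" "- inverse c \<in> K" using uc by (auto intro: subfieldD[OF K])
    have "x - inverse c * z = (- inverse c) * u" using uc c0 by (simp add: field_simps)
    then have "x - inverse c * z \<in> M" using cK(2) uc(1) by (simp only:) (rule MD(3))
    then show ?thesis using cK by blast
  qed
  have uniq: "c = c'" if "c \<in> K" "c' \<in> K" "x - c * z \<in> M" "x - c' * z \<in> M" for c c' x
  proof (rule ccontr)
    assume "c \<noteq> c'"
    have "(x - c' * z) - (x - c * z) \<in> M" using k_subspace_diff[OF K M(1)] that by blast
    then have "(c - c') * z \<in> M" by (simp add: algebra_simps)
    moreover have "inverse (c - c') \<in> K" using that by (intro subfieldD[OF K])
    ultimately have "inverse (c - c') * ((c - c') * z) \<in> M" by (rule MD(3)[rotated])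
    moreover have "inverse (c - c') * ((c - c') * z) = z" using \<open>c \<noteq> c'\<close> by simp
    ultimately show False using M(3) by simp
  qed
  define f where "f x = (THE c. c \<in> K \<and> x - c * z \<in> M)" for x
  have f: "f x \<in> K \<and> x - f x * z \<in> M" for x
    unfolding f_def by (rule theI') (use ex uniq in blast)
  have f_eq: "f x = c" if "c \<in> K" "x - c * z \<in> M" for x c
    using uniq f that by blast
  have "f (x + y) = f x + f y" for x y
  proof (rule f_eq)
    show "f x + f y \<in> K" using f by (intro subfieldD[OF K]) auto
    have "(x - f x * z) + (y - f y * z) \<in> M" using f by (intro MD(2)) auto
    then show "x + y - (f x + f y) * z \<in> M" by (simp add: algebra_simps)
  qed
  moreover have "f (c * x) = c * f x" if "c \<in> K" for c x
  proof (rule f_eq)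
    show "c * f x \<in> K" using f that by (intro subfieldD[OF K]) auto
    have "c * (x - f x * z) \<in> M" using f that by (intro MD(3)) auto
    then show "c * x - c * f x * z \<in> M" by (simp add: algebra_simps)
  qed
  moreover have "f x = 0" if "x \<in> U" for x using that M(2) by (intro f_eq) (auto intro: subfieldD[OF K])
  moreover have "f z = 1" using MD(1) by (intro f_eq) (auto intro: subfieldD[OF K])
  ultimately show ?thesis using f by (intro exI[of _ f]) (auto simp: k_linear_def)
qed

lemma lin_dependent_if_more_than_spanning:
  assumes K: "subfield K" and b: "\<And>i. i < N \<Longrightarrow> u i \<in> {y. \<exists>c. (\<forall>i<n. c i \<in> K) \<and> y = (\<Sum>i<n. c i * b i)}"
    and "n < N"
  shows "\<not> k_lin_indep K u N"
proof -
  obtain c where c: "\<And>i j. i < N \<Longrightarrow> j < n \<Longrightarrow> c i j \<in> K" "\<And>i. i < N \<Longrightarrow> u i = (\<Sum>j<n. c i j * b j)"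
    using b by simp metis
  obtain d where d: "\<forall>i\<in>{..<N}. d i \<in> K" "\<exists>i\<in>{..<N}. d i \<noteq> 0" "\<forall>j\<in>{..<n}. (\<Sum>i<N. c i j * d i) = 0"
    using homogeneous_system_nontrivial_solution[OF K, of "{..<n}" "{..<N}" "\<lambda>j i. c i j"] c \<open>n < N\<close>
    by auto
  have "(\<Sum>i<N. d i * u i) = (\<Sum>i<N. \<Sum>j<n. d i * (c i j * b j))"
    by (intro sum.cong) (simp_all add: c sum_distrib_left)
  also have "\<dots> = (\<Sum>j<n. \<Sum>i<N. d i * (c i j * b j))" by (rule sum.swap)
  also have "\<dots> = (\<Sum>j<n. (\<Sum>i<N. c i j * d i) * b j)"
    by (intro sum.cong) (simp_all add: sum_distrib_left sum_distrib_right mult_ac)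
  also have "\<dots> = 0" using d by simp
  finally show ?thesis using d unfolding k_lin_indep_def by auto
qed

lemma ext_degree_unique:
  assumes K: "subfield K" and "ext_degree_is K n" "ext_degree_is K n'"
  shows "n = n'"
proof -
  have "m \<le> m'" if deg: "ext_degree_is K m" "ext_degree_is K m'" for m m'
  proof -
    obtain b b' where "k_basis K b m" "k_basis K b' m'" using deg unfolding ext_degree_is_def by blast
    then have ind: "k_lin_indep K b m"
      and sp: "y \<in> {y. \<exists>c. (\<forall>i<m'. c i \<in> K) \<and> y = (\<Sum>i<m'. c i * b' i)}" for y
      by (simp_all add: k_basis_def k_spans_def)
    show ?thesis
    proof (rule ccontr)
      assume "\<not> m \<le> m'"
      then have "\<not> k_lin_indep K b m" using lin_dependent_if_more_than_spanning[OF K sp] by simp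
      with ind show False by simp
    qed
  qed
  with assms show ?thesis by (intro antisym) auto
qed

lemma lin_indep_extend:
  assumes K: "subfield K" and u: "k_lin_indep K u d"
    and y: "\<And>c. (\<forall>i<d. c i \<in> K) \<Longrightarrow> y \<noteq> (\<Sum>i<d. c i * u i)"
  shows "k_lin_indep K (u(d := y)) (Suc d)"
  unfolding k_lin_indep_def
proof (intro allI impI)
  fix c i assume c: "\<forall>i<Suc d. c i \<in> K" "(\<Sum>i<Suc d. c i * (u(d := y)) i) = 0" and i: "i < Suc d"
  have "(\<Sum>i<d. c i * (u(d := y)) i) = (\<Sum>i<d. c i * u i)" by (intro sum.cong) auto
  then have s: "c d * y + (\<Sum>i<d. c i * u i) = 0" using c(2) by (simp add: add.commute)
  have "c d = 0"
  proof (rule ccontr)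
    assume nz: "c d \<noteq> 0"
    have "y = (\<Sum>i<d. (- inverse (c d) * c i) * u i)"
    proof -
      have "y = - inverse (c d) * (\<Sum>i<d. c i * u i)"
        using s nz by (simp add: field_simps eq_neg_iff_add_eq_0)
      then show ?thesis by (simp add: sum_distrib_left mult.assoc)
    qed
    moreover have "- inverse (c d) * c i \<in> K" if "i < d" for i
      using c(1) that by (intro subfieldD(4)[OF K] subfieldD(5)[OF K] subfieldD(6)[OF K]) simp_all
    ultimately show False using y[of "\<lambda>i. - inverse (c d) * c i"] by simp
  qed
  then have "(\<Sum>i<d. c i * u i) = 0" using s by simp
  moreover have "\<forall>i<d. c i \<in> K" using c(1) by simp
  ultimately have "\<forall>i<d. c i = 0" using u unfolding k_lin_indep_def by blast
  with \<open>c d = 0\<close> i show "c i = 0" by (auto simp: less_Suc_eq)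
qed

section \<open>Dimension, coordinates and the trace\<close>

definition k_dim :: "'a::field set \<Rightarrow> 'a set \<Rightarrow> nat" where
  "k_dim K U = (GREATEST d. \<exists>u. (\<forall>i<d. u i \<in> U) \<and> k_lin_indep K u d)"

lemma k_dim_props:
  assumes K: "subfield K" and n: "ext_degree_is K n"
  shows "\<exists>u. (\<forall>i<k_dim K U. u i \<in> U) \<and> k_lin_indep K u (k_dim K U)"
    and "(\<forall>i<d. u i \<in> U) \<Longrightarrow> k_lin_indep K u d \<Longrightarrow> d \<le> k_dim K U"
    and "k_dim K U \<le> n"
proof -
  obtain b where b: "k_basis K b n" using n by (auto simp: ext_degree_is_def)
  let ?P = "\<lambda>d. \<exists>u. (\<forall>i<d. u i \<in> U) \<and> k_lin_indep K u d"
  have sp: "y \<in> {y. \<exists>c. (\<forall>i<n. c i \<in> K) \<and> y = (\<Sum>i<n. c i * b i)}" for y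
    using b by (simp add: k_basis_def k_spans_def)
  have bd: "\<forall>d. ?P d \<longrightarrow> d \<le> n"
    by (meson lin_dependent_if_more_than_spanning[OF K sp] not_le)
  have P0: "?P 0" by (auto simp: k_lin_indep_def)
  show *: "?P (k_dim K U)" unfolding k_dim_def by (rule GreatestI_nat[of ?P, OF P0]) (use bd in auto)
  show "(\<forall>i<d. u i \<in> U) \<Longrightarrow> k_lin_indep K u d \<Longrightarrow> d \<le> k_dim K U"
    unfolding k_dim_def by (rule Greatest_le_nat[of ?P]) (use bd in auto)
  show "k_dim K U \<le> n" using bd * by blast
qed

lemma k_dim_spanning:
  assumes K: "subfield K" and n: "ext_degree_is K n"
    and u: "\<forall>i<k_dim K U. u i \<in> U" "k_lin_indep K u (k_dim K U)" and y: "y \<in> U"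
  shows "\<exists>c. (\<forall>i<k_dim K U. c i \<in> K) \<and> y = (\<Sum>i<k_dim K U. c i * u i)"
proof (rule ccontr)
  assume "\<not> ?thesis"
  then have "k_lin_indep K (u(k_dim K U := y)) (Suc (k_dim K U))"
    by (intro lin_indep_extend[OF K u(2)]) auto
  then show False using k_dim_props(2)[OF K n, of "Suc (k_dim K U)" "u(k_dim K U := y)" U] u y
    by (auto simp: less_Suc_eq)
qed

lemma k_dim_strict_mono:
  assumes K: "subfield K" and n: "ext_degree_is K n" and U: "k_subspace K U" "U \<subset> U'"
  shows "k_dim K U < k_dim K U'"
proof -
  obtain y where y: "y \<in> U'" "y \<notin> U" using U by auto
  obtain u where u: "\<forall>i<k_dim K U. u i \<in> U" "k_lin_indep K u (k_dim K U)"
    using k_dim_props(1)[OF K n] by blast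
  have "k_lin_indep K (u(k_dim K U := y)) (Suc (k_dim K U))"
  proof (rule lin_indep_extend[OF K u(2)])
    fix c assume "\<forall>i<k_dim K U. c i \<in> K"
    then have "(\<Sum>i<k_dim K U. c i * u i) \<in> U" using u
      by (intro k_subspace_sum[OF U(1)] k_subspaceD[OF U(1)]) auto
    then show "y \<noteq> (\<Sum>i<k_dim K U. c i * u i)" using y by auto
  qed
  then have "Suc (k_dim K U) \<le> k_dim K U'" using U u y
    by (intro k_dim_props(2)[OF K n]) (auto simp: less_Suc_eq)
  then show ?thesis by simp
qed

lemma k_dim_UNIV:
  assumes K: "subfield K" and n: "ext_degree_is K n"
  shows "k_dim K UNIV = n"
proof -
  obtain b where "k_basis K b n" using n by (auto simp: ext_degree_is_def)
  then have "n \<le> k_dim K UNIV" by (intro k_dim_props(2)[OF K n]) (auto simp: k_basis_def)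
  then show ?thesis using k_dim_props(3)[OF K n, of UNIV] by simp
qed

lemma k_lin_indepD:
  assumes "k_lin_indep K b n" "\<And>i. i < n \<Longrightarrow> c i \<in> K" "(\<Sum>i<n. c i * b i) = 0" "i < n"
  shows "c i = 0"
proof -
  have "(\<forall>i<n. c i \<in> K) \<longrightarrow> (\<Sum>i<n. c i * b i) = 0 \<longrightarrow> (\<forall>i<n. c i = 0)"
    using assms(1) unfolding k_lin_indep_def by (rule spec)
  moreover have "\<forall>i<n. c i \<in> K" using assms(2) by blast
  ultimately show ?thesis using assms(3,4) by blast
qed

lemma k_coord:
  assumes K: "subfield K" and b: "k_basis K b n"
  shows "i < n \<Longrightarrow> k_coord K b n y i \<in> K" "(\<Sum>i<n. k_coord K b n y i * b i) = y"
    and "\<forall>i<n. c i \<in> K \<Longrightarrow> y = (\<Sum>i<n. c i * b i) \<Longrightarrow> i < n \<Longrightarrow> k_coord K b n y i = c i"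
proof -
  have "\<exists>c. (\<forall>i<n. c i \<in> K) \<and> y = (\<Sum>i<n. c i * b i)"
    using b by (simp add: k_basis_def k_spans_def)
  then have *: "(\<forall>i<n. k_coord K b n y i \<in> K) \<and> y = (\<Sum>i<n. k_coord K b n y i * b i)"
    unfolding k_coord_def by (rule someI_ex)
  then show "i < n \<Longrightarrow> k_coord K b n y i \<in> K" "(\<Sum>i<n. k_coord K b n y i * b i) = y" by simp_all
  show "k_coord K b n y i = c i" if c: "\<forall>i<n. c i \<in> K" "y = (\<Sum>i<n. c i * b i)" "i < n"
  proof -
    have "(\<Sum>i<n. (k_coord K b n y i - c i) * b i)
        = (\<Sum>i<n. k_coord K b n y i * b i) - (\<Sum>i<n. c i * b i)"
      by (simp add: left_diff_distrib sum_subtractf)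
    also have "\<dots> = 0" using * c(2) by simp
    finally have s: "(\<Sum>i<n. (k_coord K b n y i - c i) * b i) = 0" .
    have "k_coord K b n y i - c i = 0"
    proof (rule k_lin_indepD[OF _ _ s])
      show "k_lin_indep K b n" using b by (simp add: k_basis_def)
      show "k_coord K b n y i - c i \<in> K" if "i < n" for i
        using * c(1) that by (intro subfieldD(7)[OF K]) simp_all
    qed fact
    then show ?thesis by simp
  qed
qed

lemma k_linear_k_coord:
  assumes K: "subfield K" and b: "k_basis K b n" and "i < n"
  shows "k_linear K (\<lambda>y. k_coord K b n y i)"
  unfolding k_linear_def
proof (intro conjI allI ballI)
  note C = k_coord[OF K b]
  fix x y
  show "k_coord K b n (x + y) i = k_coord K b n x i + k_coord K b n y i"
  proof (rule C(3))
    show "\<forall>i<n. k_coord K b n x i + k_coord K b n y i \<in> K"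
      using C(1) by (intro allI impI subfieldD(3)[OF K])
    show "x + y = (\<Sum>i<n. (k_coord K b n x i + k_coord K b n y i) * b i)"
      using C(2)[of x] C(2)[of y] by (simp add: distrib_right sum.distrib)
  qed fact
next
  note C = k_coord[OF K b]
  fix c x assume c: "c \<in> K"
  show "k_coord K b n (c * x) i = c * k_coord K b n x i"
  proof (rule C(3))
    show "\<forall>i<n. c * k_coord K b n x i \<in> K"
      using C(1) c by (intro allI impI subfieldD(4)[OF K])
    show "c * x = (\<Sum>i<n. (c * k_coord K b n x i) * b i)"
      using C(2)[of x] by (simp add: mult.assoc sum_distrib_left[symmetric])
  qed fact
qed

text \<open>The trace is defined through a degree and a basis picked by \<open>SOME\<close>. The
  degree is unique, so only an unknown but fixed basis remains; independence of that basis results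
  from \<open>to_ac_field_trace\<close>.\<close>

lemma field_trace_eq:
  assumes K: "subfield K" and n: "ext_degree_is K n"
  obtains b where "k_basis K b n" "\<And>x. field_trace K x = (\<Sum>i<n. k_coord K b n (x * b i) i)"
proof -
  have n': "(SOME n. ext_degree_is K n) = n"
    using someI[of "ext_degree_is K", OF n] ext_degree_unique[OF K] n by blast
  have "k_basis K (SOME b. k_basis K b n) n"
    using n unfolding ext_degree_is_def by (rule someI_ex)
  then show ?thesis using that[of "SOME b. k_basis K b n"] by (simp add: field_trace_def Let_def n')
qed

lemma field_trace_linear:
  assumes K: "subfield K" and n: "ext_degree_is K n"
  shows "k_linear K (field_trace K)" "field_trace K x \<in> K"
proof -
  obtain b where b: "k_basis K b n" and tr: "\<And>x. field_trace K x = (\<Sum>i<n. k_coord K b n (x * b i) i)"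
    using field_trace_eq[OF K n] by blast
  show "field_trace K x \<in> K" unfolding tr by (intro subfield_sum[OF K] k_coord[OF K b]) auto
  show "k_linear K (field_trace K)"
    unfolding k_linear_def tr
    using k_linearD[OF k_linear_k_coord[OF K b]]
    by (auto simp: distrib_right mult.assoc sum_distrib_left sum.distrib[symmetric] intro!: sum.cong)
qed

subsection \<open>Embeddings into an algebraic closure\<close>

definition k_embeddings :: "'a::field set \<Rightarrow> ('a \<Rightarrow> 'a alg_closure) set" where
  "k_embeddings K = {t. (\<forall>x y. t (x + y) = t x + t y) \<and> (\<forall>x y. t (x * y) = t x * t y) \<and>
     t 1 = 1 \<and> (\<forall>c\<in>K. t c = to_ac c)}"

definition k_linear_ac :: "'a::field set \<Rightarrow> ('a \<Rightarrow> 'a alg_closure) \<Rightarrow> bool" where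
  "k_linear_ac K f \<longleftrightarrow> (\<forall>x y. f (x + y) = f x + f y) \<and> (\<forall>c\<in>K. \<forall>x. f (c * x) = to_ac c * f x)"

lemma k_embeddingsD:
  assumes "t \<in> k_embeddings K"
  shows "t (x + y) = t x + t y" "t (x * y) = t x * t y" "t 1 = 1" "c \<in> K \<Longrightarrow> t c = to_ac c"
    "t 0 = 0" "t (sum g A) = (\<Sum>i\<in>A. t (g i))" "t (x - y) = t x - t y"
proof -
  show *: "t (x + y) = t x + t y" "t (x * y) = t x * t y" "t 1 = 1" "c \<in> K \<Longrightarrow> t c = to_ac c" for x y c
    using assms by (auto simp: k_embeddings_def)
  show "t 0 = 0" "t (sum g A) = (\<Sum>i\<in>A. t (g i))" "t (x - y) = t x - t y"
    by (rule additive_sum[of t, OF *(1)])+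
qed

lemma k_embedding_linear: "t \<in> k_embeddings K \<Longrightarrow> k_linear_ac K t"
  unfolding k_linear_ac_def
proof (intro conjI allI ballI)
  assume t: "t \<in> k_embeddings K"
  show "t (x + y) = t x + t y" for x y by (rule k_embeddingsD(1)[OF t])
  show "t (c * x) = to_ac c * t x" if "c \<in> K" for c x
    unfolding k_embeddingsD(2)[OF t] k_embeddingsD(4)[OF t that] by (rule refl)
qed

lemma k_embedding_power:
  assumes "t \<in> k_embeddings K"
  shows "t (x ^ j) = t x ^ j"
  by (induction j) (simp_all add: k_embeddingsD(2,3)[OF assms])

lemma k_embedding_eq_0_iff: "t \<in> k_embeddings K \<Longrightarrow> t x = 0 \<longleftrightarrow> x = 0"
proof
  assume t: "t \<in> k_embeddings K" and 0: "t x = 0"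
  show "x = 0"
  proof (rule ccontr)
    assume "x \<noteq> 0"
    then have "t (x * inverse x) = 1" using k_embeddingsD(3)[OF t] by simp
    then show False using 0 unfolding k_embeddingsD(2)[OF t] by simp
  qed
qed (simp add: k_embeddingsD(5))

lemma k_linear_acD:
  assumes "k_linear_ac K f"
  shows "f (x + y) = f x + f y" "c \<in> K \<Longrightarrow> f (c * x) = to_ac c * f x"
    "f 0 = 0" "f (sum g A) = (\<Sum>i\<in>A. f (g i))" "f (x - y) = f x - f y"
proof -
  show *: "f (x + y) = f x + f y" "c \<in> K \<Longrightarrow> f (c * x) = to_ac c * f x" for x y c
    using assms by (auto simp: k_linear_ac_def)
  show "f 0 = 0" "f (sum g A) = (\<Sum>i\<in>A. f (g i))" "f (x - y) = f x - f y"
    by (rule additive_sum[of f, OF *(1)])+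
qed

lemma k_linear_ac_basis:
  assumes "subfield K" "k_linear_ac K f" "k_basis K b n"
  shows "f x = (\<Sum>i<n. to_ac (k_coord K b n x i) * f (b i))"
proof -
  have "f x = f (\<Sum>i<n. k_coord K b n x i * b i)" using k_coord(2)[OF assms(1,3)] by simp
  also have "\<dots> = (\<Sum>i<n. to_ac (k_coord K b n x i) * f (b i))"
    unfolding k_linear_acD(4)[OF assms(2)]
    by (intro sum.cong refl k_linear_acD(2)[OF assms(2)] k_coord(1)[OF assms(1,3)]) simp
  finally show ?thesis .
qed

text \<open>Dedekind's argument: the relation at \<open>y * x\<close> minus \<open>s y\<close> times
  the relation at \<open>x\<close> no longer involves \<open>s\<close>, so induction gives
  \<open>w t * (t y - s y) = 0\<close> for all y, and t differs from s somewhere.\<close>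

lemma embeddings_lin_independent:
  assumes "finite A" "A \<subseteq> k_embeddings K" "\<And>x. (\<Sum>t\<in>A. w t * t x) = 0" "t \<in> A"
  shows "w t = 0"
  using assms
proof (induction A arbitrary: w t rule: finite_induct)
  case empty
  then show ?case by simp
next
  case (insert s A)
  have s: "s \<in> k_embeddings K" and A: "A \<subseteq> k_embeddings K" using insert.prems by auto
  have sum0: "w s * s x + (\<Sum>t\<in>A. w t * t x) = 0" for x
    using insert.prems(2)[of x] insert.hyps by simp
  have "(\<Sum>t\<in>A. w t * (t y - s y) * t x) = 0" for x y
  proof -
    have "(\<Sum>t\<in>A. w t * (t y - s y) * t x) = (\<Sum>t\<in>A. w t * t (y * x)) - s y * (\<Sum>t\<in>A. w t * t x)"
      unfolding sum_distrib_left sum_subtractf[symmetric]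
    proof (intro sum.cong refl)
      fix t assume "t \<in> A"
      then have "t (y * x) = t y * t x" using A by (intro k_embeddingsD(2)[where K=K]) auto
      then show "w t * (t y - s y) * t x = w t * t (y * x) - s y * (w t * t x)" by (simp add: algebra_simps)
    qed
    also have "\<dots> = - w s * s (y * x) - s y * (- w s * s x)"
      using sum0[of "y * x"] sum0[of x] by (simp add: add_eq_0_iff)
    also have "\<dots> = 0" by (simp add: k_embeddingsD(2)[OF s])
    finally show ?thesis .
  qed
  then have *: "w t * (t y - s y) = 0" if "t \<in> A" for t y
    using insert.IH[OF A, of "\<lambda>t. w t * (t y - s y)" t] that by blast
  have wA: "w t = 0" if "t \<in> A" for t
  proof -
    have "t \<noteq> s" using that insert.hyps by auto
    then obtain y where "t y \<noteq> s y" by auto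
    with *[OF that, of y] show ?thesis by simp
  qed
  then have "w s = 0" using sum0[of 1] k_embeddingsD(3)[OF s] by simp
  with wA insert.prems show ?case by auto
qed

text \<open>A nonzero element of least degree in the ideal of p and q divides both. The resulting
  identity, unlike the bare statement of coprimality, can be carried over to a larger field.\<close>

lemma bezout_coprime_poly:
  fixes p q :: "'a::field poly"
  assumes "coprime p q"
  shows "\<exists>a b. a * p + b * q = 1"
proof -
  define S where "S = {a * p + b * q | a b. True}"
  have comb: "x - c * y \<in> S" if xy: "x \<in> S" "y \<in> S" for x y c
  proof -
    obtain a b a' b' where "x = a * p + b * q" "y = a' * p + b' * q" using xy by (auto simp: S_def)
    then have "x - c * y = (a - c * a') * p + (b - c * b') * q" by (simp add: algebra_simps)
    then show ?thesis by (auto simp: S_def)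
  qed
  have pS: "p \<in> S" unfolding S_def by (rule CollectI, rule exI[of _ 1], rule exI[of _ 0]) simp
  have qS: "q \<in> S" unfolding S_def by (rule CollectI, rule exI[of _ 0], rule exI[of _ 1]) simp
  have "p \<noteq> 0 \<or> q \<noteq> 0" using assms by auto
  with pS qS have "\<exists>d. d \<in> S \<and> d \<noteq> 0" by auto
  then obtain d where d: "d \<in> S" "d \<noteq> 0" and min: "\<And>y. y \<in> S \<Longrightarrow> y \<noteq> 0 \<Longrightarrow> degree d \<le> degree y"
    using ex_has_least_nat[of "\<lambda>d. d \<in> S \<and> d \<noteq> 0" _ degree] by blast
  have dvd: "d dvd y" if "y \<in> S" for y
  proof -
    have "y - (y div d) * d \<in> S" using comb[OF that d(1)] .
    then have "y mod d \<in> S" by (simp add: minus_div_mult_eq_mod)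
    then have "y mod d = 0" using min[of "y mod d"] degree_mod_less'[OF d(2), of y] by linarith
    then show ?thesis by (simp add: mod_eq_0_iff_dvd)
  qed
  have "is_unit d" using assms dvd pS qS by (auto simp: coprime_def)
  then obtain e where e: "1 = d * e" by (auto elim: dvdE)
  obtain a b where "d = a * p + b * q" using d by (auto simp: S_def)
  then have "(e * a) * p + (e * b) * q = 1" using e by (simp add: algebra_simps)
  then show ?thesis by blast
qed

lemma map_poly_to_ac_hom:
  "map_poly to_ac (p + q) = map_poly to_ac p + map_poly to_ac q"
  "map_poly to_ac (p * q) = map_poly to_ac p * map_poly to_ac q"
  "map_poly to_ac (pderiv p) = pderiv (map_poly to_ac p)"
  by (intro poly_eqI; simp add: coeff_map_poly coeff_mult to_ac_sum coeff_pderiv)+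

text \<open>A double root in the closure would be a common root of \<open>Q\<close> and its
  derivative, against the transported Bezout identity; hence the multiset of roots is a set.\<close>

lemma separable_poly_splits:
  fixes q :: "'a::field poly"
  assumes "coprime q (pderiv q)" "q \<noteq> 0"
  shows "\<exists>A c. finite A \<and> c \<noteq> 0 \<and> map_poly to_ac q = smult c (\<Prod>x\<in>A. [:-x, 1:])"
proof -
  define Q where "Q = map_poly to_ac q"
  have Q0: "Q \<noteq> 0" using assms(2) by (auto simp: Q_def map_poly_eq_0_iff)
  obtain a b where "a * q + b * pderiv q = 1" using bezout_coprime_poly[OF assms(1)] by blast
  then have "map_poly to_ac (a * q + b * pderiv q) = map_poly to_ac 1" by simp
  then have bez: "map_poly to_ac a * Q + map_poly to_ac b * pderiv Q = 1"
    by (simp add: map_poly_to_ac_hom Q_def map_poly_1')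
  obtain A where A: "Q = smult (lead_coeff Q) (\<Prod>x\<in>#A. [:-x, 1:])"
    using alg_closed_imp_factorization[OF Q0] by blast
  have "count A x \<le> 1" for x
  proof (rule ccontr)
    assume "\<not> count A x \<le> 1"
    then have "{#x, x#} \<subseteq># A" by (simp add: subseteq_mset_def)
    then obtain B where "A = {#x, x#} + B" by (metis subset_mset.add_diff_inverse)
    then obtain r where r: "Q = [:-x, 1:] * [:-x, 1:] * r"
      using A by (metis (no_types, lifting) add_mset_add_single image_mset_add_mset mult.assoc mult_smult_right
          prod_mset.add_mset union_mset_add_mset_left add_0)
    have "poly Q x = 0" "poly (pderiv Q) x = 0"
      unfolding r by (simp_all only: pderiv_mult poly_mult poly_add) simp_all
    then have "poly (map_poly to_ac a * Q + map_poly to_ac b * pderiv Q) x = 0" by simp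
    then show False unfolding bez by simp
  qed
  then have "A = mset_set (set_mset A)"
    by (intro multiset_eqI) (metis count_mset_set(1,3) finite_set_mset le_antisym less_one not_in_iff not_le)
  then have "(\<Prod>x\<in>#A. [:-x, 1:]) = (\<Prod>x\<in>set_mset A. [:-x, 1:])"
    by (metis prod_unfold_prod_mset)
  with A Q0 show ?thesis
    by (intro exI[of _ "set_mset A"] exI[of _ "lead_coeff Q"]) (auto simp: Q_def)
qed

text \<open>The action of a polynomial in the operator \<open>f \<mapsto> (\<lambda>x. f (b * x))\<close>.\<close>
definition poly_act :: "'b::comm_ring_1 poly \<Rightarrow> 'a::comm_ring_1 \<Rightarrow> ('a \<Rightarrow> 'b) \<Rightarrow> 'a \<Rightarrow> 'b" where
  "poly_act r b f = fold_coeffs (\<lambda>a g x. a * f x + g (b * x)) r (\<lambda>x. 0)"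


lemma poly_act_0 [simp]: "poly_act 0 b f = (\<lambda>x. 0)"
  by (simp add: poly_act_def)

lemma poly_act_pCons [simp]: "poly_act (pCons a r) b f x = a * f x + poly_act r b f (b * x)"
  by (cases "r = 0 \<and> a = 0") (auto simp: poly_act_def)

lemma poly_act_add: "poly_act (r + r') b f x = poly_act r b f x + poly_act r' b f x"
proof (induction r arbitrary: r' x)
  case (pCons a r)
  then show ?case by (cases r') (simp_all add: algebra_simps)
qed simp

lemma poly_act_smult: "poly_act (smult c r) b f x = c * poly_act r b f x"
  by (induction r arbitrary: x) (simp_all add: algebra_simps)

lemma poly_act_linear_factor:
  "poly_act ([:- \<alpha>, 1:] * r) b f x = poly_act r b (\<lambda>z. f (b * z) - \<alpha> * f z) x"
proof -
  have "poly_act r b (\<lambda>z. f (b * z) - \<alpha> * f z) x = poly_act r b f (b * x) - \<alpha> * poly_act r b f x"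
    by (induction r arbitrary: x) (simp_all add: algebra_simps)
  moreover have "[:- \<alpha>, 1:] * r = smult (- \<alpha>) r + pCons 0 r" by simp
  ultimately show ?thesis by (simp only: poly_act_add poly_act_smult poly_act_pCons) simp
qed

lemma poly_act_map_poly_to_ac:
  assumes "k_linear_ac K f" "\<And>i. coeff q i \<in> K"
  shows "poly_act (map_poly to_ac q) b f x = f (poly q b * x)"
  using assms(2)
proof (induction q arbitrary: x)
  case 0
  then show ?case using k_linear_acD(3)[OF assms(1)] by (simp only: poly_act_0 map_poly_0 poly_0 mult_zero_left)
next
  case (pCons a q)
  have "a \<in> K" "\<And>i. coeff q i \<in> K"
    using pCons.prems[of 0] pCons.prems[of "Suc i" for i] by simp_all
  then show ?case
    using pCons.IH[of "b * x"] pCons.hyps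
    by (simp add: map_poly_pCons k_linear_acD[OF assms(1)] algebra_simps)
qed

text \<open>Diagonalisation of the operator T that sends f to \<open>\<lambda>x. f (b * x)\<close>,
  when a polynomial with distinct roots annihilates f. By induction (T - a) f splits into
  eigenfunctions \<open>g \<alpha>\<close>; since (T - a) multiplies \<open>g \<alpha>\<close> by
  \<open>\<alpha> - a\<close>, subtracting \<open>g \<alpha> / (\<alpha> - a)\<close> from f leaves
  an eigenfunction for a. The property \<open>E\<close> is carried along so that the parts keep what
  was already known of f, namely linearity and earlier eigenvalue equations.\<close>

lemma eigenfunction_decomposition:
  fixes f :: "'a::comm_ring_1 \<Rightarrow> 'b::field"
  assumes "finite A" and "E f" and "\<And>x. poly_act (\<Prod>\<alpha>\<in>A. [:- \<alpha>, 1:]) b f x = 0"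
    and E_add: "\<And>f g. E f \<Longrightarrow> E g \<Longrightarrow> E (\<lambda>x. f x + g x)"
    and E_scale: "\<And>f c. E f \<Longrightarrow> E (\<lambda>x. c * f x)"
    and E_shift: "\<And>f. E f \<Longrightarrow> E (\<lambda>x. f (b * x))"
  shows "\<exists>g. (\<forall>x. f x = (\<Sum>\<alpha>\<in>A. g \<alpha> x)) \<and> (\<forall>\<alpha>\<in>A. E (g \<alpha>) \<and> (\<forall>x. g \<alpha> (b * x) = \<alpha> * g \<alpha> x))"
  using assms(1-3)
proof (induction A arbitrary: f rule: finite_induct)
  case empty
  then show ?case by (simp add: one_pCons)
next
  case (insert a A)
  define h where "h = (\<lambda>z. f (b * z) - a * f z)"
  have E_sum: "E (\<lambda>x. f x + (\<Sum>\<alpha>\<in>B. c \<alpha> * g \<alpha> x))"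
    if "E f" "finite B" "\<forall>\<alpha>\<in>B. E (g \<alpha>)" for f g B and c :: "'b \<Rightarrow> 'b"
    using that(2,3,1) 
  proof (induction B arbitrary: f rule: finite_induct)
    case (insert \<beta> B)
    have "E (\<lambda>x. (f x + c \<beta> * g \<beta> x) + (\<Sum>\<alpha>\<in>B. c \<alpha> * g \<alpha> x))"
      using insert by (intro insert.IH E_add E_scale) auto
    then show ?case using insert.hyps by (simp add: add.assoc)
  qed simp
  have "E (\<lambda>z. f (b * z) + (- a) * f z)" using insert.prems by (intro E_add E_scale E_shift)
  then have "E h" by (simp add: h_def)
  moreover have "poly_act (\<Prod>\<alpha>\<in>A. [:- \<alpha>, 1:]) b h x = 0" for x
    using insert.prems(2)[of x] insert.hyps
    by (simp only: prod.insert[OF insert.hyps] h_def poly_act_linear_factor not_False_eq_True)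
  ultimately obtain g where g: "\<And>x. h x = (\<Sum>\<alpha>\<in>A. g \<alpha> x)" "\<And>\<alpha>. \<alpha> \<in> A \<Longrightarrow> E (g \<alpha>)"
    "\<And>\<alpha> x. \<alpha> \<in> A \<Longrightarrow> g \<alpha> (b * x) = \<alpha> * g \<alpha> x"
    using insert.IH[of h] by blast
  define f0 where "f0 = (\<lambda>x. f x + (\<Sum>\<alpha>\<in>A. (- inverse (\<alpha> - a)) * g \<alpha> x))"
  define g' where "g' \<alpha> = (if \<alpha> = a then f0 else (\<lambda>x. inverse (\<alpha> - a) * g \<alpha> x))" for \<alpha>
  have "E f0" unfolding f0_def using insert.prems insert.hyps g by (intro E_sum) auto
  have ne: "\<alpha> \<noteq> a" if "\<alpha> \<in> A" for \<alpha> using that insert.hyps by auto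
  have "f0 (b * x) = a * f0 x" for x
  proof -
    have "f0 (b * x) - a * f0 x = h x + (\<Sum>\<alpha>\<in>A. (- inverse (\<alpha> - a)) * (g \<alpha> (b * x) - a * g \<alpha> x))"
      unfolding f0_def h_def by (simp add: algebra_simps sum_subtractf sum_distrib_left sum_negf)
    also have "(\<Sum>\<alpha>\<in>A. (- inverse (\<alpha> - a)) * (g \<alpha> (b * x) - a * g \<alpha> x)) = (\<Sum>\<alpha>\<in>A. - g \<alpha> x)"
    proof (intro sum.cong refl)
      fix \<alpha> assume \<alpha>: "\<alpha> \<in> A"
      have "g \<alpha> (b * x) - a * g \<alpha> x = (\<alpha> - a) * g \<alpha> x" unfolding g(3)[OF \<alpha>] by (simp add: algebra_simps)
      then show "(- inverse (\<alpha> - a)) * (g \<alpha> (b * x) - a * g \<alpha> x) = - g \<alpha> x" using ne[OF \<alpha>] by simp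
    qed
    finally show ?thesis using g(1)[of x] by (simp add: sum_negf)
  qed
  moreover have "E (\<lambda>x. inverse (\<alpha> - a) * g \<alpha> x)" if "\<alpha> \<in> A" for \<alpha> using g(2)[OF that] by (rule E_scale)
  ultimately have "\<forall>\<alpha>\<in>insert a A. E (g' \<alpha>) \<and> (\<forall>x. g' \<alpha> (b * x) = \<alpha> * g' \<alpha> x)"
    using \<open>E f0\<close> g(3) by (auto simp: g'_def)
  moreover have "f x = (\<Sum>\<alpha>\<in>insert a A. g' \<alpha> x)" for x
  proof -
    have "(\<Sum>\<alpha>\<in>A. g' \<alpha> x) = (\<Sum>\<alpha>\<in>A. inverse (\<alpha> - a) * g \<alpha> x)"
      using ne by (intro sum.cong) (auto simp: g'_def)
    then show ?thesis using insert.hyps by (simp add: g'_def f0_def sum_negf)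
  qed
  ultimately show ?case by blast
qed

section \<open>The n embeddings of a separable extension and the trace as their sum\<close>

locale separable_extension =
  fixes K :: "'a::field set" and n :: nat
  assumes K: "subfield K" and deg: "ext_degree_is K n" and sep: "separable_ext K"
begin

abbreviation "X_emb \<equiv> k_embeddings K"

text \<open>An embedding is determined by its n values on a basis, so more than n of them would
  satisfy a linear relation.\<close>

lemma card_embeddings_le: "finite A \<Longrightarrow> A \<subseteq> X_emb \<Longrightarrow> card A \<le> n"
proof (rule ccontr)
  assume A: "finite A" "A \<subseteq> X_emb" "\<not> card A \<le> n"
  obtain b where b: "k_basis K b n" using deg by (auto simp: ext_degree_is_def)
  obtain c where c: "\<exists>t\<in>A. c t \<noteq> 0" "\<forall>i\<in>{..<n}. (\<Sum>t\<in>A. t (b i) * c t) = 0"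
    using homogeneous_system_nontrivial_solution[OF subfield_UNIV, of "{..<n}" A "\<lambda>i t. t (b i)"] A by auto
  have "(\<Sum>t\<in>A. c t * t x) = 0" for x
  proof -
    have "(\<Sum>t\<in>A. c t * t x) = (\<Sum>t\<in>A. c t * (\<Sum>i<n. to_ac (k_coord K b n x i) * t (b i)))"
      using A k_linear_ac_basis[OF K k_embedding_linear b] by (intro sum.cong) (auto simp: subset_iff)
    also have "\<dots> = (\<Sum>i<n. to_ac (k_coord K b n x i) * (\<Sum>t\<in>A. t (b i) * c t))"
      unfolding sum_distrib_left by (subst sum.swap) (simp add: mult_ac)
    finally show ?thesis using c(2) by simp
  qed
  with c(1) A embeddings_lin_independent[of A K c] show False by auto
qed

lemma finite_embeddings: "finite X_emb"
proof (rule ccontr)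
  assume "infinite X_emb"
  then obtain A where "finite A" "card A = Suc n" "A \<subseteq> X_emb"
    using infinite_arbitrarily_large by blast
  then show False using card_embeddings_le[of A] by simp
qed

text \<open>The number i counts the basis elements for which f is not yet known to be an
  eigenfunction; each step splits f further by the separable polynomial of one basis element. At i =
  0 a simultaneous eigenfunction satisfies f (x * y) = t x * f y, and if it is nonzero this makes t
  an embedding and f a multiple of it. Neither a primitive element nor the extension of embeddings
  along a tower is involved.\<close>

lemma eigen_linear_ac_spanned:
  assumes b: "k_basis K b n" and "i \<le> n" and "k_linear_ac K f"
    and "\<And>j. i \<le> j \<Longrightarrow> j < n \<Longrightarrow> \<exists>\<alpha>. \<forall>x. f (b j * x) = \<alpha> * f x"
  shows "\<exists>w. \<forall>x. f x = (\<Sum>t\<in>X_emb. w t * t x)"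
  using assms(2-)
proof (induction i arbitrary: f)
  case 0
  then obtain \<alpha> where \<alpha>: "\<And>j x. j < n \<Longrightarrow> f (b j * x) = \<alpha> j * f x" by (metis le0)
  \<comment> \<open>The eigenvalue of multiplication by x, extended linearly from the basis.\<close>
  define t where "t x = (\<Sum>i<n. to_ac (k_coord K b n x i) * \<alpha> i)" for x
  have mult: "f (x * y) = t x * f y" for x y
  proof -
    have "f (x * y) = f (\<Sum>i<n. k_coord K b n x i * (b i * y))"
      using k_coord(2)[OF K b, of x] by (metis (no_types, lifting) mult.assoc sum.cong sum_distrib_right)
    also have "\<dots> = (\<Sum>i<n. to_ac (k_coord K b n x i) * (\<alpha> i * f y))"
      unfolding k_linear_acD(4)[OF 0(2)] using \<alpha>
      by (intro sum.cong refl) (simp add: k_linear_acD(2)[OF 0(2)] k_coord(1)[OF K b])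
    finally show ?thesis by (simp add: t_def sum_distrib_right mult.assoc)
  qed
  show ?case
  proof (cases "\<forall>x. f x = 0")
    case True
    then show ?thesis by (intro exI[of _ "\<lambda>_. 0"]) simp
  next
    case False
    have fx: "f x = t x * f 1" for x using mult[of x 1] by (simp only: mult_1_right)
    have f1: "f 1 \<noteq> 0"
    proof
      assume f1: "f 1 = 0"
      have "f x = 0" for x by (subst fx) (simp add: f1)
      with False show False by blast
    qed
    have t: "t x = f x / f 1" for x by (subst fx[of x]) (simp add: f1)
    have t_emb: "t \<in> X_emb"
      unfolding k_embeddings_def mem_Collect_eq
    proof (intro conjI allI ballI)
      fix x y
      show "t (x + y) = t x + t y" unfolding t k_linear_acD(1)[OF 0(2)] by (simp add: add_divide_distrib)
      have "f (x * y) = t x * t y * f 1" using mult[of x y] fx[of y] by (simp only: mult.assoc)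
      then show "t (x * y) = t x * t y" unfolding t[of "x * y"] using f1 by simp
      show "t 1 = 1" unfolding t using f1 by simp
    next
      fix c assume "c \<in> K"
      then show "t c = to_ac c" unfolding t using f1 k_linear_acD(2)[OF 0(2), of c 1] by simp
    qed
    have "f x = (\<Sum>s\<in>X_emb. (if s = t then f 1 else 0) * s x)" for x
    proof -
      have "(\<Sum>s\<in>X_emb. (if s = t then f 1 else 0) * s x) = (\<Sum>s\<in>X_emb. if s = t then f 1 * s x else 0)"
        by (intro sum.cong) auto
      then show ?thesis using finite_embeddings t_emb f1 by (simp add: t)
    qed
    then show ?thesis by (intro exI[of _ "\<lambda>s. if s = t then f 1 else 0"]) blast
  qed
next
  case (Suc i)
  then have i: "i < n" by simp
  obtain q where q: "\<And>j. coeff q j \<in> K" "q \<noteq> 0" "poly q (b i) = 0" "coprime q (pderiv q)"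
    using sep unfolding separable_ext_def by metis
  obtain A c where A: "finite A" "c \<noteq> 0" "map_poly to_ac q = smult c (\<Prod>x\<in>A. [:-x, 1:])"
    using separable_poly_splits[OF q(4,2)] by blast
  obtain \<alpha> where \<alpha>: "\<And>j x. Suc i \<le> j \<Longrightarrow> j < n \<Longrightarrow> f (b j * x) = \<alpha> j * f x"
    using Suc.prems(3) by metis
  define E where "E g \<longleftrightarrow> k_linear_ac K g \<and> (\<forall>j x. Suc i \<le> j \<longrightarrow> j < n \<longrightarrow> g (b j * x) = \<alpha> j * g x)" for g
  have "c * poly_act (\<Prod>x\<in>A. [:-x, 1:]) (b i) f x = 0" for x
    using poly_act_map_poly_to_ac[OF Suc.prems(2) q(1), of "b i" x]
    unfolding A(3) poly_act_smult q(3) by (simp add: k_linear_acD(3)[OF Suc.prems(2)])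
  then have ann: "poly_act (\<Prod>x\<in>A. [:-x, 1:]) (b i) f x = 0" for x using A(2) by simp
  have "\<exists>g. (\<forall>x. f x = (\<Sum>\<alpha>\<in>A. g \<alpha> x)) \<and> (\<forall>\<alpha>\<in>A. E (g \<alpha>) \<and> (\<forall>x. g \<alpha> (b i * x) = \<alpha> * g \<alpha> x))"
  proof (rule eigenfunction_decomposition[OF A(1) _ ann])
    show "E f" using Suc.prems(2) \<alpha> by (auto simp: E_def)
    show "E (\<lambda>x. g x + h x)" if "E g" "E h" for g h
      using that by (auto simp: E_def k_linear_ac_def distrib_left)
    show "E (\<lambda>x. c * g x)" if "E g" for g c
      using that by (auto simp: E_def k_linear_ac_def distrib_left mult.left_commute)
    show "E (\<lambda>x. g (b i * x))" if "E g" for g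
      using that by (auto simp: E_def k_linear_ac_def distrib_left mult.left_commute[of "b i"])
  qed
  then obtain g where g: "\<And>x. f x = (\<Sum>a\<in>A. g a x)" "\<And>a. a \<in> A \<Longrightarrow> E (g a)"
    "\<And>a x. a \<in> A \<Longrightarrow> g a (b i * x) = a * g a x" by blast
  have "\<exists>w. \<forall>x. g a x = (\<Sum>t\<in>X_emb. w t * t x)" if a: "a \<in> A" for a
  proof (rule Suc.IH)
    show "i \<le> n" using i by simp
    show "k_linear_ac K (g a)" using g(2)[OF a] by (simp add: E_def)
    show "\<exists>\<alpha>. \<forall>x. g a (b j * x) = \<alpha> * g a x" if "i \<le> j" "j < n" for j
    proof (cases "j = i")
      case True
      then show ?thesis using g(3)[OF a] by blast
    next
      case False
      then have "Suc i \<le> j" using that by simp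
      then show ?thesis using g(2)[OF a] that unfolding E_def by blast
    qed
  qed
  then obtain w where w: "\<And>a x. a \<in> A \<Longrightarrow> g a x = (\<Sum>t\<in>X_emb. w a t * t x)" by metis
  have "f x = (\<Sum>t\<in>X_emb. (\<Sum>a\<in>A. w a t) * t x)" for x
  proof -
    have "f x = (\<Sum>a\<in>A. \<Sum>t\<in>X_emb. w a t * t x)" using g(1) w by simp
    also have "\<dots> = (\<Sum>t\<in>X_emb. (\<Sum>a\<in>A. w a t) * t x)"
      unfolding sum_distrib_right by (rule sum.swap)
    finally show ?thesis .
  qed
  then show ?case by (intro exI[of _ "\<lambda>t. \<Sum>a\<in>A. w a t"]) blast
qed

lemma embeddings_span:
  assumes "k_linear_ac K f"
  obtains w where "\<And>x. f x = (\<Sum>t\<in>X_emb. w t * t x)"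
proof -
  obtain b where "k_basis K b n" using deg by (auto simp: ext_degree_is_def)
  from eigen_linear_ac_spanned[OF this le_refl assms] show ?thesis using that by force
qed

lemma k_linear_ac_k_coord:
  assumes "k_basis K b n" "i < n"
  shows "k_linear_ac K (\<lambda>y. to_ac (k_coord K b n y i))"
  using k_linearD[OF k_linear_k_coord[OF K assms]] by (simp add: k_linear_ac_def)

text \<open>With fewer than n embeddings some nonzero vector c would satisfy the n-term relation
  with coefficients \<open>t (b i)\<close> for every t. Each coordinate function is a combination of
  embeddings, hence would yield \<open>c i = 0\<close>.\<close>

lemma card_embeddings: "card X_emb = n"
proof (rule antisym)
  show "card X_emb \<le> n" using card_embeddings_le finite_embeddings by blast
  show "n \<le> card X_emb"
  proof (rule ccontr)
    assume "\<not> n \<le> card X_emb"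
    obtain b where b: "k_basis K b n" using deg by (auto simp: ext_degree_is_def)
    obtain c i where i: "i < n" "c i \<noteq> 0" and c: "\<And>t. t \<in> X_emb \<Longrightarrow> (\<Sum>i<n. t (b i) * c i) = 0"
      using homogeneous_system_nontrivial_solution[OF subfield_UNIV, of X_emb "{..<n}" "\<lambda>t i. t (b i)"]
        finite_embeddings \<open>\<not> n \<le> card X_emb\<close> by auto
    obtain w where w: "\<And>x. to_ac (k_coord K b n x i) = (\<Sum>t\<in>X_emb. w t * t x)"
      using embeddings_span[OF k_linear_ac_k_coord[OF b i(1)]] by blast
    have "(\<Sum>j<n. c j * to_ac (k_coord K b n (b j) i)) = (\<Sum>t\<in>X_emb. w t * (\<Sum>j<n. t (b j) * c j))"
      unfolding w sum_distrib_left by (subst sum.swap) (simp add: mult_ac)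
    also have "\<dots> = 0" using c by simp
    also have "k_coord K b n (b j) i = (if j = i then 1 else 0)" if "j < n" for j
      using that i(1) subfieldD(1,2)[OF K]
      by (intro k_coord(3)[OF K b]) (auto simp: if_distrib[of "\<lambda>x. x * _"] cong: if_cong)
    then have "(\<Sum>j<n. c j * to_ac (k_coord K b n (b j) i)) = (\<Sum>j<n. if j = i then c i else 0)"
      by (intro sum.cong) auto
    ultimately show False using i by simp
  qed
qed

text \<open>The coefficients \<open>w i t\<close> of the coordinate functions are the conjugates of
  a dual basis. Expanding t in coordinates and comparing coefficients of t by Dedekind independence
  gives \<open>w1\<close>; inserting this into the diagonal sum that defines the trace leaves each
  conjugate with coefficient 1.\<close>

lemma to_ac_field_trace: "to_ac (field_trace K x) = (\<Sum>t\<in>X_emb. t x)"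
proof -
  obtain b where b: "k_basis K b n" and tr: "\<And>x. field_trace K x = (\<Sum>i<n. k_coord K b n (x * b i) i)"
    using field_trace_eq[OF K deg] by blast
  have "\<forall>i. \<exists>w. i < n \<longrightarrow> (\<forall>x. to_ac (k_coord K b n x i) = (\<Sum>t\<in>X_emb. w t * t x))"
    using embeddings_span[OF k_linear_ac_k_coord[OF b]] by metis
  then obtain w where w: "\<And>i x. i < n \<Longrightarrow> to_ac (k_coord K b n x i) = (\<Sum>t\<in>X_emb. w i t * t x)"
    by metis
  have w1: "(\<Sum>i<n. w i t * t (b i)) = 1" if t: "t \<in> X_emb" for t
  proof -
    have "(\<Sum>s\<in>X_emb. ((\<Sum>i<n. w i s * t (b i)) - (if s = t then 1 else 0)) * s y) = 0" for y
    proof -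
      have "t y = (\<Sum>i<n. to_ac (k_coord K b n y i) * t (b i))"
        by (rule k_linear_ac_basis[OF K k_embedding_linear[OF t] b])
      also have "\<dots> = (\<Sum>i<n. (\<Sum>s\<in>X_emb. w i s * s y) * t (b i))" using w by simp
      also have "\<dots> = (\<Sum>s\<in>X_emb. (\<Sum>i<n. w i s * t (b i)) * s y)"
        unfolding sum_distrib_right by (subst sum.swap) (simp add: mult_ac)
      finally have "t y = \<dots>" .
      moreover have "(\<Sum>s\<in>X_emb. (if s = t then 1 else 0) * s y) = (\<Sum>s\<in>X_emb. if s = t then t y else 0)"
        by (intro sum.cong) auto
      ultimately show ?thesis
        using t finite_embeddings by (simp add: left_diff_distrib sum_subtractf)
    qed
    from embeddings_lin_independent[OF finite_embeddings subset_refl this t] show ?thesis by simp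
  qed
  have "to_ac (field_trace K x) = (\<Sum>i<n. \<Sum>t\<in>X_emb. w i t * (t x * t (b i)))"
    unfolding tr to_ac_sum
  proof (intro sum.cong refl)
    fix i assume "i \<in> {..<n}"
    then have "to_ac (k_coord K b n (x * b i) i) = (\<Sum>t\<in>X_emb. w i t * t (x * b i))" using w by simp
    also have "\<dots> = (\<Sum>t\<in>X_emb. w i t * (t x * t (b i)))"
      by (intro sum.cong refl arg_cong2[of _ _ _ _ "(*)"] k_embeddingsD(2)[where K=K])
    finally show "to_ac (k_coord K b n (x * b i) i) = \<dots>" .
  qed
  also have "\<dots> = (\<Sum>t\<in>X_emb. t x * (\<Sum>i<n. w i t * t (b i)))"
    unfolding sum_distrib_left by (subst sum.swap) (simp add: mult_ac)
  finally show ?thesis using w1 by simp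
qed

lemma degree_pos: "n > 0"
proof (rule ccontr)
  assume "\<not> n > 0"
  with deg obtain b where "k_basis K b 0" by (auto simp: ext_degree_is_def)
  then have "(1::'a) = 0" by (auto simp: k_basis_def k_spans_def)
  then show False by simp
qed

text \<open>A sum of distinct embeddings is not the zero map, by Dedekind independence.\<close>

lemma field_trace_nonzero: "\<exists>y. field_trace K y \<noteq> 0"
proof (rule ccontr)
  assume "\<not> ?thesis"
  then have "(\<Sum>t\<in>X_emb. 1 * t x) = 0" for x using to_ac_field_trace[of x] by simp
  moreover obtain t where "t \<in> X_emb" using card_embeddings degree_pos by fastforce
  ultimately show False
    using embeddings_lin_independent[OF finite_embeddings subset_refl, of "\<lambda>_. 1"] by simp
qed

end

section \<open>Hopf-Galois extensions: conjugates of the action\<close>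

locale hopf_galois_extension = separable_extension K n
  for K :: "'a::field set" and n :: nat +
  fixes m :: nat and mu de :: "nat \<Rightarrow> nat \<Rightarrow> nat \<Rightarrow> 'a" and u ep :: "nat \<Rightarrow> 'a"
    and s :: "nat \<Rightarrow> nat \<Rightarrow> 'a" and act :: "nat \<Rightarrow> 'a \<Rightarrow> 'a"
  assumes hg: "hopf_galois K m mu u de ep s act"
begin

lemma hopf: "hopf_algebra K m mu u de ep s" and module: "module_algebra K m mu u de ep act"
  using hg by (simp_all only: hopf_galois_def)

lemma structure_constants:
  "i < m \<Longrightarrow> j < m \<Longrightarrow> k < m \<Longrightarrow> mu i j k \<in> K"
  "i < m \<Longrightarrow> j < m \<Longrightarrow> k < m \<Longrightarrow> de i j k \<in> K"
  "i < m \<Longrightarrow> u i \<in> K" "i < m \<Longrightarrow> ep i \<in> K"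
proof -
  have "\<forall>i<m. \<forall>j<m. \<forall>k<m. mu i j k \<in> K \<and> de i j k \<in> K"
    using hopf unfolding hopf_algebra_def by (elim conjE)
  moreover have "\<forall>i<m. u i \<in> K \<and> ep i \<in> K"
    using hopf unfolding hopf_algebra_def by (elim conjE)
  ultimately show "i < m \<Longrightarrow> j < m \<Longrightarrow> k < m \<Longrightarrow> mu i j k \<in> K"
    "i < m \<Longrightarrow> j < m \<Longrightarrow> k < m \<Longrightarrow> de i j k \<in> K" "i < m \<Longrightarrow> u i \<in> K" "i < m \<Longrightarrow> ep i \<in> K"
    by simp_all
qed

lemma act_linear: "k < m \<Longrightarrow> k_linear K (act k)"
  and act_comp: "i < m \<Longrightarrow> j < m \<Longrightarrow> act i (act j x) = (\<Sum>k<m. mu i j k * act k x)"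
  and act_unit: "(\<Sum>k<m. u k * act k x) = x"
  and act_mult: "k < m \<Longrightarrow> act k (x * y) = (\<Sum>i<m. \<Sum>j<m. de k i j * act i x * act j y)"
  and act_one: "k < m \<Longrightarrow> act k 1 = ep k"
proof -
  have *: "\<forall>k<m. k_linear K (act k)"
    using module unfolding module_algebra_def by (elim conjE)
  show "k < m \<Longrightarrow> k_linear K (act k)" by (rule *[rule_format])
  have *: "\<forall>i<m. \<forall>j<m. \<forall>x. act i (act j x) = (\<Sum>k<m. mu i j k * act k x)"
    using module unfolding module_algebra_def by (elim conjE)
  show "i < m \<Longrightarrow> j < m \<Longrightarrow> act i (act j x) = (\<Sum>k<m. mu i j k * act k x)" by (rule *[rule_format])
  have *: "\<forall>x. (\<Sum>k<m. u k * act k x) = x"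
    using module unfolding module_algebra_def by (elim conjE)
  show "(\<Sum>k<m. u k * act k x) = x" by (rule *[rule_format])
  have *: "\<forall>k<m. \<forall>x y. act k (x * y) = (\<Sum>i<m. \<Sum>j<m. de k i j * act i x * act j y)"
    using module unfolding module_algebra_def by (elim conjE)
  show "k < m \<Longrightarrow> act k (x * y) = (\<Sum>i<m. \<Sum>j<m. de k i j * act i x * act j y)" by (rule *[rule_format])
  have *: "\<forall>k<m. act k 1 = ep k"
    using module unfolding module_algebra_def by (elim conjE)
  show "k < m \<Longrightarrow> act k 1 = ep k" by (rule *[rule_format])
qed

lemma galois_inj:
  assumes "\<And>y. (\<Sum>k<m. x k * act k y) = 0" "k < m"
  shows "x k = 0"
proof -
  have "\<forall>x. (\<forall>y. (\<Sum>k<m. x k * act k y) = 0) \<longrightarrow> (\<forall>k<m. x k = 0)"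
    using hg unfolding hopf_galois_def by (elim conjE)
  from spec[OF this, of x] assms show ?thesis by blast
qed

lemma galois_surj: "k_linear K f \<Longrightarrow> \<exists>x. \<forall>y. f y = (\<Sum>k<m. x k * act k y)"
proof -
  have "\<forall>f. k_linear K f \<longrightarrow> (\<exists>x. \<forall>y. f y = (\<Sum>k<m. x k * act k y))"
    using hg unfolding hopf_galois_def by (elim conjE)
  from spec[OF this, of f] show "k_linear K f \<Longrightarrow> ?thesis" by blast
qed

text \<open>Over L this is injectivity of L \<otimes> H \<rightarrow> End(L), but here the
  coefficients lie in the closure, which is larger than the field t(L). A t(L)-linear functional on
  the closure with value 1 at \<open>d k\<close> moves the relation into t(L), where it is the image
  under t of a relation over L.\<close>

lemma conjugate_act_independent:
  assumes t: "t \<in> X_emb" and d: "\<And>y. (\<Sum>k<m. d k * t (act k y)) = 0" and k: "k < m"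
  shows "d k = 0"
proof (rule ccontr)
  assume dk: "d k \<noteq> 0"
  note tD = k_embeddingsD[OF t]
  have inv: "t (inverse x) = inverse (t x)" for x
  proof (cases "x = 0")
    case False
    then have "t x * t (inverse x) = 1" by (simp add: tD(2)[symmetric] tD(3))
    then show ?thesis by (simp add: inverse_unique)
  qed (simp add: tD(5))
  have neg: "t (- x) = - t x" for x using tD(7)[of 0 x] by (simp add: tD(5))
  have "subfield (range t)"
    unfolding subfield_def by (auto simp: tD(1,2)[symmetric] inv[symmetric] neg[symmetric])
      (metis rangeI tD(5), metis rangeI tD(3))
  moreover have "k_subspace (range t) {0}" by (simp add: k_subspace_def)
  ultimately obtain f where f: "k_linear (range t) f" "range f \<subseteq> range t" "f (d k) = 1"
    using separating_functional[of "range t" "{0}" "d k"] dk by auto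
  have "\<forall>j. \<exists>x. f (d j) = t x" using f(2) by auto
  then obtain x where x: "\<And>j. f (d j) = t (x j)" by metis
  have "(\<Sum>k<m. x k * act k y) = 0" for y
  proof -
    have "t (\<Sum>k<m. x k * act k y) = (\<Sum>k<m. t (act k y) * f (d k))"
      unfolding tD(6) tD(2) x by (simp add: mult.commute)
    also have "\<dots> = (\<Sum>k<m. f (t (act k y) * d k))"
      by (intro sum.cong refl k_linearD(2)[OF f(1), symmetric]) simp
    also have "\<dots> = f (\<Sum>k<m. d k * t (act k y))"
      unfolding k_linear_sum(2)[OF f(1)] by (simp add: mult.commute)
    also have "\<dots> = 0" unfolding d k_linear_sum(1)[OF f(1)] ..
    finally show ?thesis using k_embedding_eq_0_iff[OF t] by blast
  qed
  then have "x k = 0" by (rule galois_inj[OF _ k])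
  then have "f (d k) = 0" using x[of k] tD(5) by (simp only:)
  then show False using f(3) by simp
qed

text \<open>Surjectivity onto End(L) expresses the coordinate functions through the action, and f is
  the combination of coordinates with coefficients \<open>f (b i)\<close>.\<close>

lemma conjugate_act_span:
  assumes t: "t \<in> X_emb" and f: "k_linear_ac K f"
  shows "\<exists>d. \<forall>y. f y = (\<Sum>k<m. d k * t (act k y))"
proof -
  note tD = k_embeddingsD[OF t]
  obtain b where b: "k_basis K b n" using deg by (auto simp: ext_degree_is_def)
  have "\<forall>i. \<exists>x. i < n \<longrightarrow> (\<forall>y. k_coord K b n y i = (\<Sum>k<m. x k * act k y))"
    using galois_surj[OF k_linear_k_coord[OF K b]] by metis
  then obtain x where x: "\<And>i y. i < n \<Longrightarrow> k_coord K b n y i = (\<Sum>k<m. x i k * act k y)" by metis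
  have "f y = (\<Sum>k<m. (\<Sum>i<n. t (x i k) * f (b i)) * t (act k y))" for y
  proof -
    have "f y = (\<Sum>i<n. to_ac (k_coord K b n y i) * f (b i))"
      by (rule k_linear_ac_basis[OF K f b])
    also have "\<dots> = (\<Sum>i<n. t (\<Sum>k<m. x i k * act k y) * f (b i))"
      using tD(4)[OF k_coord(1)[OF K b]] by (intro sum.cong) (simp_all add: x)
    also have "\<dots> = (\<Sum>i<n. \<Sum>k<m. t (x i k) * f (b i) * t (act k y))"
      unfolding tD(6) tD(2) sum_distrib_right by (simp add: mult_ac)
    also have "\<dots> = (\<Sum>k<m. (\<Sum>i<n. t (x i k) * f (b i)) * t (act k y))"
      unfolding sum_distrib_right by (rule sum.swap)
    finally show ?thesis .
  qed
  then show ?thesis by (intro exI[of _ "\<lambda>k. \<Sum>i<n. t (x i k) * f (b i)"]) blast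
qed

text \<open>A relation between the operators \<open>act k\<close> with coefficients in L need only
  be tested on a K-basis of L, which gives n equations for m unknowns.\<close>

lemma hopf_dim_le: "m \<le> n"
proof (rule ccontr)
  assume "\<not> m \<le> n"
  obtain b where b: "k_basis K b n" using deg by (auto simp: ext_degree_is_def)
  obtain c k where k: "k < m" "c k \<noteq> 0" and c: "\<And>i. i < n \<Longrightarrow> (\<Sum>k<m. act k (b i) * c k) = 0"
    using homogeneous_system_nontrivial_solution[OF subfield_UNIV, of "{..<n}" "{..<m}" "\<lambda>i k. act k (b i)"]
      \<open>\<not> m \<le> n\<close> by auto
  have "(\<Sum>k<m. c k * act k y) = 0" for y
  proof -
    have act_y: "act k y = (\<Sum>i<n. k_coord K b n y i * act k (b i))" if "k < m" for k
    proof -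
      have "act k y = act k (\<Sum>i<n. k_coord K b n y i * b i)" using k_coord(2)[OF K b] by simp
      also have "\<dots> = (\<Sum>i<n. k_coord K b n y i * act k (b i))"
        unfolding k_linear_sum(2)[OF act_linear[OF that]]
        by (intro sum.cong refl k_linearD(2)[OF act_linear[OF that]] k_coord(1)[OF K b]) simp
      finally show ?thesis .
    qed
    have "(\<Sum>k<m. c k * act k y) = (\<Sum>k<m. \<Sum>i<n. k_coord K b n y i * (act k (b i) * c k))"
      by (intro sum.cong refl) (simp add: act_y sum_distrib_left mult_ac)
    also have "\<dots> = (\<Sum>i<n. k_coord K b n y i * (\<Sum>k<m. act k (b i) * c k))"
      unfolding sum_distrib_left by (rule sum.swap)
    finally show ?thesis using c by simp
  qed
  then have "c k = 0" by (rule galois_inj[OF _ k(1)])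
  then show False using k by simp
qed

subsection \<open>Grouplike elements over the algebraic closure\<close>

text \<open>Coordinate vectors of the elements g of H over the closure with \<Delta>(g) = g
  \<otimes> g and \<epsilon>(g) = 1. Vanishing from index m on makes equality of functions the same
  as equality of elements.\<close>

definition grouplikes :: "(nat \<Rightarrow> 'a alg_closure) set" where
  "grouplikes = {g. (\<forall>k\<ge>m. g k = 0) \<and>
     (\<forall>i<m. \<forall>j<m. (\<Sum>k<m. g k * to_ac (de k i j)) = g i * g j) \<and> (\<Sum>k<m. g k * to_ac (ep k)) = 1}"

text \<open>The composite of t with the action of g. The coordinates of g are already in the
  closure, so they stay outside t. This is a right action, see \<open>twist_gmul\<close>.\<close>

definition twist :: "('a \<Rightarrow> 'a alg_closure) \<Rightarrow> (nat \<Rightarrow> 'a alg_closure) \<Rightarrow> 'a \<Rightarrow> 'a alg_closure" where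
  "twist t g = (\<lambda>x. \<Sum>k<m. g k * t (act k x))"

lemma grouplikesD:
  assumes "g \<in> grouplikes"
  shows "k \<ge> m \<Longrightarrow> g k = 0" "i < m \<Longrightarrow> j < m \<Longrightarrow> (\<Sum>k<m. g k * to_ac (de k i j)) = g i * g j"
    "(\<Sum>k<m. g k * to_ac (ep k)) = 1"
  using assms by (auto simp: grouplikes_def)

lemma twist_linear:
  assumes t: "k_linear_ac K t"
  shows "k_linear_ac K (twist t g)"
  unfolding k_linear_ac_def
proof (intro conjI allI ballI)
  fix x y
  show "twist t g (x + y) = twist t g x + twist t g y"
    unfolding twist_def sum.distrib[symmetric]
    by (intro sum.cong refl) (simp add: k_linearD(1)[OF act_linear] k_linear_acD(1)[OF t] distrib_left)
next
  fix c x assume c: "c \<in> K"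
  show "twist t g (c * x) = to_ac c * twist t g x"
    unfolding twist_def sum_distrib_left
    by (intro sum.cong refl) (simp add: k_linearD(2)[OF act_linear c] k_linear_acD(2)[OF t c] mult.left_commute)
qed

lemma twist_mult:
  assumes t: "t \<in> X_emb"
  shows "twist t g (x * y) = (\<Sum>i<m. \<Sum>j<m. (\<Sum>k<m. g k * to_ac (de k i j)) * (t (act i x) * t (act j y)))"
proof -
  note tD = k_embeddingsD[OF t]
  have "twist t g (x * y) = (\<Sum>k<m. g k * (\<Sum>i<m. \<Sum>j<m. to_ac (de k i j) * (t (act i x) * t (act j y))))"
    unfolding twist_def
  proof (intro sum.cong refl)
    fix k assume k: "k \<in> {..<m}"
    have "t (act k (x * y)) = (\<Sum>i<m. \<Sum>j<m. t (de k i j) * (t (act i x) * t (act j y)))"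
      using k by (simp add: act_mult tD(6) tD(2) mult.assoc)
    also have "\<dots> = (\<Sum>i<m. \<Sum>j<m. to_ac (de k i j) * (t (act i x) * t (act j y)))"
      using k tD(4)[OF structure_constants(2)] by (intro sum.cong refl) auto
    finally show "g k * t (act k (x * y)) = g k * \<dots>" by simp
  qed
  also have "\<dots> = (\<Sum>k<m. \<Sum>i<m. \<Sum>j<m. g k * to_ac (de k i j) * (t (act i x) * t (act j y)))"
    unfolding sum_distrib_left by (simp add: mult.assoc)
  also have "\<dots> = (\<Sum>i<m. \<Sum>k<m. \<Sum>j<m. g k * to_ac (de k i j) * (t (act i x) * t (act j y)))"
    by (rule sum.swap)
  also have "\<dots> = (\<Sum>i<m. \<Sum>j<m. \<Sum>k<m. g k * to_ac (de k i j) * (t (act i x) * t (act j y)))"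
    by (rule sum.cong[OF refl]) (rule sum.swap)
  finally show ?thesis unfolding sum_distrib_right .
qed

lemma twist_one:
  assumes t: "t \<in> X_emb"
  shows "twist t g 1 = (\<Sum>k<m. g k * to_ac (ep k))"
  unfolding twist_def using k_embeddingsD(4)[OF t structure_constants(4)]
  by (intro sum.cong refl) (simp add: act_one)

text \<open>The condition on \<Delta>(g) is exactly multiplicativity of the twisted map, the one on
  \<epsilon>(g) that it preserves 1.\<close>

lemma twist_embedding:
  assumes t: "t \<in> X_emb" and g: "g \<in> grouplikes"
  shows "twist t g \<in> X_emb"
proof -
  note lin = k_linear_acD[OF twist_linear[OF k_embedding_linear[OF t], of g]]
  have one: "twist t g 1 = 1" unfolding twist_one[OF t] by (rule grouplikesD(3)[OF g])
  show ?thesis unfolding k_embeddings_def mem_Collect_eq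
  proof (intro conjI allI ballI)
    fix x y
    show "twist t g (x + y) = twist t g x + twist t g y" by (rule lin(1))
    have "twist t g (x * y) = (\<Sum>i<m. \<Sum>j<m. (g i * g j) * (t (act i x) * t (act j y)))"
      unfolding twist_mult[OF t] by (intro sum.cong refl) (simp add: grouplikesD(2)[OF g])
    also have "\<dots> = twist t g x * twist t g y"
      unfolding twist_def sum_product by (simp add: mult_ac)
    finally show "twist t g (x * y) = twist t g x * twist t g y" .
    show "twist t g 1 = 1" by (rule one)
  next
    fix c assume "c \<in> K"
    then show "twist t g c = to_ac c" using lin(2)[of c 1] one by simp
  qed
qed

lemma twist_inj:
  assumes t: "t \<in> X_emb" and "\<And>k. k \<ge> m \<Longrightarrow> g k = 0" "\<And>k. k \<ge> m \<Longrightarrow> g' k = 0"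
    and "twist t g = twist t g'"
  shows "g = g'"
proof
  fix k
  have "(\<Sum>k<m. (g k - g' k) * t (act k y)) = twist t g y - twist t g' y" for y
    by (simp add: twist_def left_diff_distrib sum_subtractf)
  then have "(\<Sum>k<m. (g k - g' k) * t (act k y)) = 0" for y unfolding assms(4) by simp
  then have "k < m \<Longrightarrow> g k - g' k = 0" by (rule conjugate_act_independent[OF t])
  then show "g k = g' k" using assms(2,3) by (cases "k < m") auto
qed

text \<open>As a K-linear map t' is a twist of t by some vector g. Multiplicativity of t' says that
  the difference \<open>r\<close> of \<Delta>(g) and g \<otimes> g acts as zero in both arguments,
  and independence of the conjugated action, used once for each tensor factor, makes it
  vanish.\<close>

lemma twist_transitive:
  assumes t: "t \<in> X_emb" and t': "t' \<in> X_emb"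
  shows "\<exists>g\<in>grouplikes. t' = twist t g"
proof -
  note tD' = k_embeddingsD[OF t']
  obtain d where d: "\<And>y. t' y = (\<Sum>k<m. d k * t (act k y))"
    using conjugate_act_span[OF t k_embedding_linear[OF t']] by blast
  define g where "g k = (if k < m then d k else 0)" for k
  have tg: "twist t g = t'" by (rule ext) (simp add: twist_def d g_def)
  have "(\<Sum>k<m. g k * to_ac (de k i j)) = g i * g j" if ij: "i < m" "j < m" for i j
  proof -
    define r where "r i j = (\<Sum>k<m. g k * to_ac (de k i j)) - g i * g j" for i j
    have r0: "(\<Sum>i<m. (\<Sum>j<m. r i j * t (act j y)) * t (act i x)) = 0" for x y
    proof -
      have "twist t g x * twist t g y = (\<Sum>i<m. \<Sum>j<m. (g i * g j) * (t (act i x) * t (act j y)))"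
        unfolding twist_def sum_product by (simp add: mult_ac)
      moreover have "(\<Sum>i<m. (\<Sum>j<m. r i j * t (act j y)) * t (act i x))
          = (\<Sum>i<m. \<Sum>j<m. r i j * (t (act i x) * t (act j y)))"
        unfolding sum_distrib_right by (simp add: mult_ac)
      ultimately have "(\<Sum>i<m. (\<Sum>j<m. r i j * t (act j y)) * t (act i x))
          = twist t g (x * y) - twist t g x * twist t g y"
        unfolding twist_mult[OF t] r_def by (simp only: left_diff_distrib sum_subtractf)
      also have "\<dots> = 0" unfolding tg by (simp add: tD'(2))
      finally show ?thesis .
    qed
    have "(\<Sum>j<m. r i j * t (act j y)) = 0" for y
      by (rule conjugate_act_independent[OF t r0 ij(1)])
    then have "r i j = 0" by (rule conjugate_act_independent[OF t _ ij(2)])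
    then show ?thesis by (simp add: r_def)
  qed
  moreover have "(\<Sum>k<m. g k * to_ac (ep k)) = 1"
    using twist_one[OF t, of g] unfolding tg by (simp add: tD'(3))
  ultimately have "g \<in> grouplikes" by (auto simp: grouplikes_def g_def)
  with tg show ?thesis by blast
qed

lemma bij_twist:
  assumes t: "t \<in> X_emb"
  shows "bij_betw (twist t) grouplikes X_emb"
  unfolding bij_betw_def
proof
  show "inj_on (twist t) grouplikes"
    by (intro inj_onI twist_inj[OF t]) (auto simp: grouplikesD)
  show "twist t ` grouplikes = X_emb"
    using twist_embedding[OF t] twist_transitive[OF t] by blast
qed

lemma embedding_exists: "\<exists>t. t \<in> X_emb"
proof -
  have "X_emb \<noteq> {}" using card_embeddings degree_pos by auto
  then show ?thesis by blast
qed

lemma card_grouplikes: "card grouplikes = n" "finite grouplikes"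
proof -
  obtain t where t: "t \<in> X_emb" using embedding_exists by blast
  show "card grouplikes = n" "finite grouplikes"
    using bij_betw_same_card[OF bij_twist[OF t]] bij_betw_finite[OF bij_twist[OF t]]
      card_embeddings finite_embeddings by simp_all
qed

text \<open>The map \<open>twist t a\<close> is a combination of embeddings, that is, of twists of t
  by grouplikes; independence of the conjugated action allows t to be cancelled.\<close>

lemma grouplikes_span: "\<exists>w. \<forall>k<m. a k = (\<Sum>g\<in>grouplikes. w g * g k)"
proof -
  obtain t where t: "t \<in> X_emb" using embedding_exists by blast
  obtain w where w: "\<And>x. twist t a x = (\<Sum>t'\<in>X_emb. w t' * t' x)"
    using embeddings_span[OF twist_linear[OF k_embedding_linear[OF t]]] by blast
  define c where "c k = (\<Sum>g\<in>grouplikes. w (twist t g) * g k)" for k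
  have "(\<Sum>k<m. (a k - c k) * t (act k x)) = 0" for x
  proof -
    have "(\<Sum>t'\<in>X_emb. w t' * t' x) = (\<Sum>g\<in>grouplikes. w (twist t g) * twist t g x)"
      by (rule sum.reindex_bij_betw[OF bij_twist[OF t], symmetric])
    also have "\<dots> = (\<Sum>k<m. c k * t (act k x))"
    proof -
      have tw: "twist t g x = (\<Sum>k<m. g k * t (act k x))" for g by (simp add: twist_def)
      show ?thesis
        unfolding c_def sum_distrib_right tw sum_distrib_left by (subst sum.swap) (simp only: mult.assoc)
    qed
    finally show ?thesis using w[of x] by (simp add: twist_def left_diff_distrib sum_subtractf)
  qed
  then have "k < m \<Longrightarrow> a k - c k = 0" for k by (rule conjugate_act_independent[OF t])
  then show ?thesis unfolding c_def by (intro exI[of _ "\<lambda>g. w (twist t g)"]) simp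
qed

text \<open>The form in which the spanning is applied: an equation indexed by the basis of H holds
  as soon as it holds after pairing with every grouplike.\<close>

lemma grouplikes_separate:
  assumes y: "\<And>g. g \<in> grouplikes \<Longrightarrow> (\<Sum>k<m. g k * y k) = 0" and k: "k < m"
  shows "y k = 0"
proof -
  obtain w where w: "\<And>j. j < m \<Longrightarrow> (if j = k then 1 else 0) = (\<Sum>g\<in>grouplikes. w g * g j)"
    using grouplikes_span[of "\<lambda>j. if j = k then 1 else 0"] by metis
  have "y k = (\<Sum>j<m. if j = k then y j else 0)" using k by simp
  also have "\<dots> = (\<Sum>j<m. (if j = k then 1 else 0) * y j)" by (intro sum.cong) auto
  also have "\<dots> = (\<Sum>j<m. \<Sum>g\<in>grouplikes. w g * (g j * y j))"
    using w by (intro sum.cong) (simp_all add: sum_distrib_right mult.assoc)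
  also have "\<dots> = (\<Sum>g\<in>grouplikes. w g * (\<Sum>j<m. g j * y j))"
    unfolding sum_distrib_left by (rule sum.swap)
  finally show ?thesis using y by simp
qed

end

section \<open>The group of grouplikes, trace identities and invariants\<close>

context hopf_galois_extension
begin

definition gmul :: "(nat \<Rightarrow> 'a alg_closure) \<Rightarrow> (nat \<Rightarrow> 'a alg_closure) \<Rightarrow> nat \<Rightarrow> 'a alg_closure" where
  "gmul g h = (\<lambda>r. if r < m then \<Sum>k<m. \<Sum>l<m. g k * h l * to_ac (mu k l r) else 0)"

definition gunit :: "nat \<Rightarrow> 'a alg_closure" where
  "gunit = (\<lambda>k. if k < m then to_ac (u k) else 0)"

lemma twist_gmul:
  assumes t: "t \<in> X_emb"
  shows "twist (twist t g) h = twist t (gmul g h)"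
proof
  fix x
  note tD = k_embeddingsD[OF t]
  have "twist (twist t g) h x = (\<Sum>l<m. \<Sum>k<m. g k * h l * t (act k (act l x)))"
    by (simp add: twist_def sum_distrib_left mult_ac)
  also have "\<dots> = (\<Sum>l<m. \<Sum>k<m. \<Sum>r<m. g k * h l * to_ac (mu k l r) * t (act r x))"
  proof (intro sum.cong refl)
    fix k l assume kl: "l \<in> {..<m}" "k \<in> {..<m}"
    have "t (act k (act l x)) = (\<Sum>r<m. t (mu k l r) * t (act r x))"
      using kl by (simp add: act_comp tD(6) tD(2))
    also have "\<dots> = (\<Sum>r<m. to_ac (mu k l r) * t (act r x))"
      using kl tD(4)[OF structure_constants(1)] by (intro sum.cong refl) auto
    finally show "g k * h l * t (act k (act l x)) = (\<Sum>r<m. g k * h l * to_ac (mu k l r) * t (act r x))"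
      by (simp add: sum_distrib_left mult.assoc)
  qed
  also have "\<dots> = (\<Sum>l<m. \<Sum>r<m. \<Sum>k<m. g k * h l * to_ac (mu k l r) * t (act r x))"
    by (rule sum.cong[OF refl]) (rule sum.swap)
  also have "\<dots> = (\<Sum>r<m. \<Sum>l<m. \<Sum>k<m. g k * h l * to_ac (mu k l r) * t (act r x))"
    by (rule sum.swap)
  also have "\<dots> = (\<Sum>r<m. \<Sum>k<m. \<Sum>l<m. g k * h l * to_ac (mu k l r) * t (act r x))"
    by (rule sum.cong[OF refl]) (rule sum.swap)
  also have "\<dots> = twist t (gmul g h) x"
    unfolding twist_def sum_distrib_right[symmetric] by (intro sum.cong refl) (simp add: gmul_def)
  finally show "twist (twist t g) h x = twist t (gmul g h) x" .
qed

lemma twist_gunit: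
  assumes t: "t \<in> X_emb"
  shows "twist t gunit = t"
proof
  fix x
  note tD = k_embeddingsD[OF t]
  have "twist t gunit x = (\<Sum>k<m. t (u k) * t (act k x))"
    unfolding twist_def using tD(4)[OF structure_constants(3)] by (intro sum.cong refl) (simp add: gunit_def)
  also have "\<dots> = t (\<Sum>k<m. u k * act k x)" unfolding tD(6) tD(2) ..
  finally show "twist t gunit x = t x" unfolding act_unit .
qed

text \<open>Converse of \<open>twist_embedding\<close>: by transitivity the twisted map comes from
  some grouplike, and twisting is injective. Closure under products follows without expanding the
  coproduct of a product.\<close>

lemma grouplikeI:
  assumes t: "t \<in> X_emb" and "\<And>k. k \<ge> m \<Longrightarrow> g k = 0" "twist t g \<in> X_emb"
  shows "g \<in> grouplikes"
proof -
  obtain g' where g': "g' \<in> grouplikes" "twist t g = twist t g'"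
    using twist_transitive[OF t assms(3)] by blast
  have "g = g'" using grouplikesD(1)[OF g'(1)] by (intro twist_inj[OF t assms(2) _ g'(2)]) auto
  with g' show ?thesis by simp
qed

lemma gmul_closed: "g \<in> grouplikes \<Longrightarrow> h \<in> grouplikes \<Longrightarrow> gmul g h \<in> grouplikes"
  and gunit_closed: "gunit \<in> grouplikes"
proof -
  obtain t where t: "t \<in> X_emb" using embedding_exists by blast
  show "gunit \<in> grouplikes" using t by (intro grouplikeI[OF t]) (simp_all add: twist_gunit, simp add: gunit_def)
  assume g: "g \<in> grouplikes" "h \<in> grouplikes"
  have "twist t (gmul g h) \<in> X_emb"
    unfolding twist_gmul[OF t, symmetric] using g t by (intro twist_embedding)
  then show "gmul g h \<in> grouplikes" by (intro grouplikeI[OF t]) (simp_all add: gmul_def)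
qed

lemma grouplike_eqI:
  assumes "g \<in> grouplikes" "h \<in> grouplikes" "\<And>t. t \<in> X_emb \<Longrightarrow> twist t g = twist t h"
  shows "g = h"
proof -
  obtain t where t: "t \<in> X_emb" using embedding_exists by blast
  from assms(3)[OF t] show ?thesis
    using grouplikesD(1)[OF assms(1)] grouplikesD(1)[OF assms(2)] by (intro twist_inj[OF t]) auto
qed

lemma twist_gmul3: "t \<in> X_emb \<Longrightarrow> g \<in> grouplikes \<Longrightarrow>
    twist t (gmul (gmul g h) k) = twist t (gmul g (gmul h k))"
  using twist_embedding[of t g] by (simp only: twist_gmul[symmetric])

lemma gmul_right_inverse:
  assumes g: "g \<in> grouplikes"
  shows "\<exists>h\<in>grouplikes. gmul g h = gunit"
proof -
  obtain t where t: "t \<in> X_emb" using embedding_exists by blast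
  obtain h where h: "h \<in> grouplikes" "t = twist (twist t g) h"
    using twist_transitive[OF twist_embedding[OF t g] t] by blast
  have "gmul g h = gunit"
  proof (rule twist_inj[OF t])
    show "twist t (gmul g h) = twist t gunit"
      unfolding twist_gmul[OF t, symmetric] twist_gunit[OF t] by (rule h(2)[symmetric])
  qed (simp_all add: gmul_def gunit_def)
  with h show ?thesis by blast
qed

text \<open>The opposite multiplication, so that the right inverses obtained from transitivity become
  left inverses.\<close>
definition "GL = \<lparr>carrier = grouplikes, monoid.mult = (\<lambda>g h. gmul h g), one = gunit\<rparr>"

lemma group_GL: "group GL"
proof (rule groupI)
  show "\<one>\<^bsub>GL\<^esub> \<in> carrier GL" by (simp add: GL_def gunit_closed)
  fix x y z assume x: "x \<in> carrier GL" and y: "y \<in> carrier GL"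
  show "x \<otimes>\<^bsub>GL\<^esub> y \<in> carrier GL" using x y by (simp add: GL_def gmul_closed)
  show "\<exists>y\<in>carrier GL. y \<otimes>\<^bsub>GL\<^esub> x = \<one>\<^bsub>GL\<^esub>" using x gmul_right_inverse by (simp add: GL_def)
  have "gmul x gunit = x"
  proof (rule grouplike_eqI)
    show "gmul x gunit \<in> grouplikes" "x \<in> grouplikes"
      using x by (simp_all add: GL_def gmul_closed gunit_closed)
    fix t assume t: "t \<in> X_emb"
    show "twist t (gmul x gunit) = twist t x"
      unfolding twist_gmul[OF t, symmetric] using twist_gunit[OF twist_embedding[OF t]] x
      by (simp add: GL_def)
  qed
  then show "\<one>\<^bsub>GL\<^esub> \<otimes>\<^bsub>GL\<^esub> x = x" by (simp add: GL_def)
  assume z: "z \<in> carrier GL"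
  have "gmul z (gmul y x) = gmul (gmul z y) x"
  proof (rule grouplike_eqI)
    show "gmul z (gmul y x) \<in> grouplikes" "gmul (gmul z y) x \<in> grouplikes"
      using x y z by (simp_all add: GL_def gmul_closed)
    fix t assume "t \<in> X_emb"
    then show "twist t (gmul z (gmul y x)) = twist t (gmul (gmul z y) x)"
      using twist_gmul3 z by (simp add: GL_def)
  qed
  then show "(x \<otimes>\<^bsub>GL\<^esub> y) \<otimes>\<^bsub>GL\<^esub> z = x \<otimes>\<^bsub>GL\<^esub> (y \<otimes>\<^bsub>GL\<^esub> z)" by (simp add: GL_def)
qed

lemma twist_pow_GL:
  assumes "g \<in> grouplikes" "t \<in> X_emb"
  shows "twist t (g [^]\<^bsub>GL\<^esub> (j::nat)) = ((\<lambda>t. twist t g) ^^ j) t"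
  using assms(2)
proof (induction j arbitrary: t)
  case 0
  then show ?case using twist_gunit by (simp add: GL_def)
next
  case (Suc j)
  have "g [^]\<^bsub>GL\<^esub> Suc j = gmul g (g [^]\<^bsub>GL\<^esub> j)" by (simp add: GL_def)
  then have "twist t (g [^]\<^bsub>GL\<^esub> Suc j) = twist (twist t g) (g [^]\<^bsub>GL\<^esub> j)"
    using twist_gmul[OF Suc.prems] by simp
  also have "\<dots> = ((\<lambda>t. twist t g) ^^ j) (twist t g)"
    by (rule Suc.IH) (rule twist_embedding[OF Suc.prems assms(1)])
  finally show ?case by (simp only: funpow_Suc_right o_apply)
qed

lemma sum_embeddings_twist:
  assumes g: "g \<in> grouplikes"
  shows "(\<Sum>t\<in>X_emb. f (twist t g)) = (\<Sum>t\<in>X_emb. f t)"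
proof -
  obtain h where h: "h \<in> grouplikes" "gmul g h = gunit" using gmul_right_inverse[OF g] by blast
  have "inj_on (\<lambda>t. twist t g) X_emb"
  proof (rule inj_onI)
    fix t t' assume tt: "t \<in> X_emb" "t' \<in> X_emb" "twist t g = twist t' g"
    then have "twist (twist t g) h = twist (twist t' g) h" by simp
    with tt show "t = t'" using h twist_gmul twist_gunit by metis
  qed
  moreover have "(\<lambda>t. twist t g) ` X_emb \<subseteq> X_emb" using twist_embedding g by blast
  ultimately have "bij_betw (\<lambda>t. twist t g) X_emb X_emb"
    using finite_embeddings by (simp add: bij_betw_def endo_inj_surj)
  then show ?thesis by (rule sum.reindex_bij_betw)
qed

text \<open>For a grouplike g, twisting permutes the embeddings, so that their sum is unchanged and
  \<epsilon>(g) = 1 is the right factor. Both sides are linear in the element of H.\<close>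

lemma trace_act:
  assumes k: "k < m"
  shows "field_trace K (act k x) = ep k * field_trace K x"
proof -
  define T where "T = (\<Sum>t\<in>X_emb. t x)"
  define y where "y k = (\<Sum>t\<in>X_emb. t (act k x)) - to_ac (ep k) * T" for k
  have "y k = 0"
  proof (rule grouplikes_separate[OF _ k])
    fix g assume g: "g \<in> grouplikes"
    have "(\<Sum>k<m. g k * y k) = (\<Sum>k<m. \<Sum>t\<in>X_emb. g k * t (act k x))
        - (\<Sum>k<m. g k * to_ac (ep k)) * T"
      by (simp add: y_def right_diff_distrib sum_subtractf sum_distrib_left sum_distrib_right mult.assoc)
    also have "(\<Sum>k<m. \<Sum>t\<in>X_emb. g k * t (act k x)) = (\<Sum>t\<in>X_emb. twist t g x)"
      unfolding twist_def by (rule sum.swap)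
    also have "\<dots> = T" unfolding T_def by (rule sum_embeddings_twist[OF g])
    finally show "(\<Sum>k<m. g k * y k) = 0" using grouplikesD(3)[OF g] by simp
  qed
  then have "to_ac (field_trace K (act k x)) = to_ac (ep k * field_trace K x)"
    by (simp add: y_def T_def to_ac_field_trace)
  then show ?thesis by (simp only: to_ac_eq_iff)
qed

text \<open>If h is inverse to a grouplike g, reindexing the sum over embeddings by h turns Tr((g a)
  x) into Tr(a (h x)), and h x is a combination of the elements \<open>act l x\<close> of V. Inverse
  grouplikes do the work of the antipode as adjoint for the trace form.\<close>

lemma trace_orthogonal_stable:
  assumes V: "\<And>k x. k < m \<Longrightarrow> x \<in> V \<Longrightarrow> act k x \<in> V"
    and a: "\<And>x. x \<in> V \<Longrightarrow> field_trace K (a * x) = 0" and k: "k < m" and x: "x \<in> V"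
  shows "field_trace K (act k a * x) = 0"
proof -
  define y where "y k = (\<Sum>t\<in>X_emb. t (act k a) * t x)" for k
  have "y k = 0"
  proof (rule grouplikes_separate[OF _ k])
    fix g assume g: "g \<in> grouplikes"
    \<comment> \<open>A right inverse in \<open>GL\<close> is a left inverse for
      \<open>gmul\<close>, the multiplication there being reversed.\<close>
    obtain h where h: "h \<in> grouplikes" "gmul h g = gunit"
      using group.r_inv_ex[OF group_GL] g by (auto simp: GL_def)
    have untwist: "twist (twist t h) g = t" if "t \<in> X_emb" for t
      using that h twist_gmul twist_gunit by metis
    have "(\<Sum>k<m. g k * y k) = (\<Sum>k<m. \<Sum>t\<in>X_emb. g k * t (act k a) * t x)"
      by (simp add: y_def sum_distrib_left mult.assoc)
    also have "\<dots> = (\<Sum>t\<in>X_emb. twist t g a * t x)"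
      unfolding twist_def sum_distrib_right by (rule sum.swap)
    also have "\<dots> = (\<Sum>t\<in>X_emb. twist (twist t h) g a * twist t h x)"
      by (rule sum_embeddings_twist[OF h(1), symmetric])
    also have "\<dots> = (\<Sum>t\<in>X_emb. \<Sum>l<m. h l * (t a * t (act l x)))"
      using untwist by (intro sum.cong refl) (simp add: twist_def sum_distrib_left mult_ac)
    also have "\<dots> = (\<Sum>l<m. h l * (\<Sum>t\<in>X_emb. t a * t (act l x)))"
      unfolding sum_distrib_left by (rule sum.swap)
    also have "\<dots> = (\<Sum>l<m. h l * to_ac (field_trace K (a * act l x)))"
      unfolding to_ac_field_trace
      by (intro sum.cong refl arg_cong2[of _ _ _ _ "(*)"] k_embeddingsD(2)[where K=K, symmetric])
    also have "\<dots> = 0" using a V x by simp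
    finally show "(\<Sum>k<m. g k * y k) = 0" .
  qed
  moreover have "to_ac (field_trace K (act k a * x)) = y k"
    unfolding to_ac_field_trace y_def by (intro sum.cong refl k_embeddingsD(2)[where K=K])
  ultimately show ?thesis by simp
qed

lemma counit:
  assumes "k < m" "j < m"
  shows "(\<Sum>i<m. ep i * de k i j) = (if k = j then 1 else 0)"
proof -
  have "\<forall>k<m. \<forall>j<m. (\<Sum>i<m. ep i * de k i j) = (if k = j then 1 else 0) \<and>
                    (\<Sum>i<m. ep i * de k j i) = (if k = j then 1 else 0)"
    using hopf unfolding hopf_algebra_def by (elim conjE)
  with assms show ?thesis by simp
qed

text \<open>By the counit axiom, multiplication by an invariant x commutes with the action, hence
  with every functional written as an L-combination of it. A functional f with f 1 = 1 and values in
  K then gives x = x * f 1 = f x.\<close>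

lemma invariants_in_base:
  assumes inv: "\<And>k. k < m \<Longrightarrow> act k x = ep k * x"
  shows "x \<in> K"
proof -
  have comm: "x * act k y = act k (x * y)" if "k < m" for k y
  proof -
    have "act k (x * y) = (\<Sum>i<m. \<Sum>j<m. x * (ep i * de k i j * act j y))"
      unfolding act_mult[OF that] by (intro sum.cong refl) (simp add: inv mult_ac)
    also have "\<dots> = (\<Sum>j<m. \<Sum>i<m. x * (ep i * de k i j * act j y))" by (rule sum.swap)
    also have "\<dots> = (\<Sum>j<m. x * ((\<Sum>i<m. ep i * de k i j) * act j y))"
      by (simp add: sum_distrib_left sum_distrib_right)
    also have "\<dots> = (\<Sum>j<m. if j = k then x * act k y else 0)"
      using that by (intro sum.cong refl) (auto simp: counit)
    finally show ?thesis using that by simp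
  qed
  have K1: "k_subspace K {0}" by (simp add: k_subspace_def)
  obtain f where f: "k_linear K f" "range f \<subseteq> K" "f 1 = 1"
    using separating_functional[OF K K1, of 1] by auto
  obtain a where a: "\<And>y. f y = (\<Sum>k<m. a k * act k y)" using galois_surj[OF f(1)] by blast
  have "x = x * f 1" using f by simp
  also have "\<dots> = (\<Sum>k<m. a k * (x * act k 1))" unfolding a by (simp add: sum_distrib_left mult_ac)
  also have "\<dots> = f x" unfolding a using comm[of _ 1] by simp
  finally show ?thesis using f(2) by auto
qed

end

subsection \<open>Frobenius\<close>

locale hopf_galois_char_p = hopf_galois_extension K n m mu de u ep s act
  for K :: "'a::field set" and n m mu de u ep s act +
  fixes p :: nat
  assumes p: "prime p" "of_nat p = (0::'a)"
begin

lemma CHAR_eq: "CHAR('a) = p"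
proof -
  have "CHAR('a) dvd p" using p(2) by (simp add: of_nat_eq_0_iff_char_dvd)
  then have "CHAR('a) = 1 \<or> CHAR('a) = p" using p(1) unfolding prime_nat_iff by blast
  then show ?thesis using CHAR_not_1 by simp
qed

lemma power_p_sum: "sum f A ^ p = (\<Sum>i\<in>A. f i ^ p)"
  for f :: "'b \<Rightarrow> 'a"
  by (rule freshmans_dream_sum) (simp_all add: CHAR_eq p)

lemma power_p_sum_ac: "sum f A ^ p = (\<Sum>i\<in>A. f i ^ p)"
  for f :: "'b \<Rightarrow> 'a alg_closure"
  by (rule freshmans_dream_sum) (simp_all add: CHAR_eq p)

text \<open>The coordinates of the powers of the dual basis element \<open>e\<^sub>k\<^sup>*\<close> in the dual algebra of \<open>H\<close>.\<close>
primrec dual_power :: "nat \<Rightarrow> nat \<Rightarrow> nat \<Rightarrow> 'a" where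
  "dual_power k 0 = ep"
| "dual_power k (Suc j) = (\<lambda>a. \<Sum>b<m. de a k b * dual_power k j b)"

lemma dual_power_in_base: "k < m \<Longrightarrow> a < m \<Longrightarrow> dual_power k j a \<in> K"
  by (induction j arbitrary: a)
    (auto intro!: subfield_sum[OF K] subfieldD(4)[OF K] structure_constants)

text \<open>Evaluation at a grouplike is an algebra homomorphism on the dual of H. The nonlinear
  expression \<open>g k ^ j\<close> thereby becomes linear in g.\<close>

lemma grouplike_dual_power:
  assumes g: "g \<in> grouplikes" and k: "k < m"
  shows "(\<Sum>a<m. g a * to_ac (dual_power k j a)) = g k ^ j"
proof (induction j)
  case 0
  then show ?case using grouplikesD(3)[OF g] by simp
next
  case (Suc j)
  have "(\<Sum>a<m. g a * to_ac (dual_power k (Suc j) a))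
      = (\<Sum>a<m. \<Sum>b<m. g a * to_ac (de a k b) * to_ac (dual_power k j b))"
    by (simp add: to_ac_sum sum_distrib_left mult.assoc)
  also have "\<dots> = (\<Sum>b<m. (\<Sum>a<m. g a * to_ac (de a k b)) * to_ac (dual_power k j b))"
    unfolding sum_distrib_right by (rule sum.swap)
  also have "\<dots> = (\<Sum>b<m. g k * (g b * to_ac (dual_power k j b)))"
    using grouplikesD(2)[OF g k] by (intro sum.cong refl) (simp add: mult.assoc)
  also have "\<dots> = g k * g k ^ j" unfolding sum_distrib_left[symmetric] Suc.IH ..
  finally show ?case by simp
qed

text \<open>On grouplikes, g(x^p) = (g x)^p, and Frobenius distributes the power over the sum of the
  terms \<open>g k * t (act k x)\<close>. The factor \<open>g k ^ p\<close> is rewritten linearly by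
  \<open>grouplike_dual_power\<close>, after which the identity descends.\<close>

lemma act_power_p:
  assumes l: "l < m"
  shows "act l (x ^ p) = (\<Sum>k<m. dual_power k p l * act k x ^ p)"
proof -
  obtain t where t: "t \<in> X_emb" using embedding_exists by blast
  note tD = k_embeddingsD[OF t]
  define y where "y l = t (act l (x ^ p)) - (\<Sum>k<m. to_ac (dual_power k p l) * t (act k x) ^ p)" for l
  have "y l = 0"
  proof (rule grouplikes_separate[OF _ l])
    fix g assume g: "g \<in> grouplikes"
    have "(\<Sum>l<m. g l * y l) = twist t g (x ^ p)
        - (\<Sum>l<m. \<Sum>k<m. g l * to_ac (dual_power k p l) * t (act k x) ^ p)"
      by (simp add: y_def twist_def right_diff_distrib sum_subtractf sum_distrib_left mult.assoc)
    also have "(\<Sum>l<m. \<Sum>k<m. g l * to_ac (dual_power k p l) * t (act k x) ^ p)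
        = (\<Sum>k<m. (\<Sum>l<m. g l * to_ac (dual_power k p l)) * t (act k x) ^ p)"
      unfolding sum_distrib_right by (rule sum.swap)
    also have "\<dots> = (\<Sum>k<m. (g k * t (act k x)) ^ p)"
      using grouplike_dual_power[OF g] by (intro sum.cong refl) (simp add: power_mult_distrib)
    also have "\<dots> = twist t g x ^ p" unfolding twist_def power_p_sum_ac ..
    also have "\<dots> = twist t g (x ^ p)"
      by (rule k_embedding_power[OF twist_embedding[OF t g], symmetric])
    finally show "(\<Sum>l<m. g l * y l) = 0" by simp
  qed
  moreover have "t (\<Sum>k<m. dual_power k p l * act k x ^ p)
      = (\<Sum>k<m. to_ac (dual_power k p l) * t (act k x) ^ p)"
    unfolding tD(6) tD(2) k_embedding_power[OF t]
    using tD(4)[OF dual_power_in_base[OF _ l]] by (intro sum.cong refl) simp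
  ultimately have "t (act l (x ^ p) - (\<Sum>k<m. dual_power k p l * act k x ^ p)) = 0"
    unfolding tD(7) by (simp add: y_def)
  then show ?thesis unfolding k_embedding_eq_0_iff[OF t] by simp
qed

text \<open>For an element h with coordinates a, this finds an element with coordinates c acting on
  p-th powers as h does before taking them. Writing a as a combination of grouplikes and raising
  only the weights to the power p solves the system over the closure; a K-linear functional on the
  closure with values in K that fixes 1 carries the solution to K.\<close>

lemma frobenius_twist_surj:
  assumes a: "\<And>k. k < m \<Longrightarrow> a k \<in> K"
  shows "\<exists>c. (\<forall>l<m. c l \<in> K) \<and> (\<forall>k<m. (\<Sum>l<m. dual_power k p l * c l) = a k ^ p)"
proof -
  obtain w where w: "\<And>k. k < m \<Longrightarrow> to_ac (a k) = (\<Sum>g\<in>grouplikes. w g * g k)"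
    using grouplikes_span[of "\<lambda>k. to_ac (a k)"] by blast
  define d where "d l = (\<Sum>g\<in>grouplikes. w g ^ p * g l)" for l
  have d: "(\<Sum>l<m. to_ac (dual_power k p l) * d l) = to_ac (a k ^ p)" if k: "k < m" for k
  proof -
    have "(\<Sum>l<m. to_ac (dual_power k p l) * d l)
        = (\<Sum>l<m. \<Sum>g\<in>grouplikes. w g ^ p * (g l * to_ac (dual_power k p l)))"
      by (simp add: d_def sum_distrib_left mult_ac)
    also have "\<dots> = (\<Sum>g\<in>grouplikes. w g ^ p * (\<Sum>l<m. g l * to_ac (dual_power k p l)))"
      unfolding sum_distrib_left by (rule sum.swap)
    also have "\<dots> = (\<Sum>g\<in>grouplikes. (w g * g k) ^ p)"
      using grouplike_dual_power[OF _ k] by (intro sum.cong refl) (simp add: power_mult_distrib)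
    also have "\<dots> = to_ac (a k ^ p)" unfolding power_p_sum_ac[symmetric] w[OF k, symmetric] by simp
    finally show ?thesis .
  qed
  have KK: "subfield (to_ac ` K)"
    unfolding subfield_def
  proof (intro conjI ballI)
    show "0 \<in> to_ac ` K" by (rule image_eqI[OF _ subfieldD(1)[OF K]]) simp
    show "1 \<in> to_ac ` K" by (rule image_eqI[OF _ subfieldD(2)[OF K]]) simp
    fix x assume "x \<in> to_ac ` K"
    then obtain x' where x: "x' \<in> K" "x = to_ac x'" by auto
    show "- x \<in> to_ac ` K" by (rule image_eqI[OF _ subfieldD(5)[OF K x(1)]]) (simp add: x)
    show "inverse x \<in> to_ac ` K" by (rule image_eqI[OF _ subfieldD(6)[OF K x(1)]]) (simp add: x)
    fix y assume "y \<in> to_ac ` K"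
    then obtain y' where y: "y' \<in> K" "y = to_ac y'" by auto
    show "x + y \<in> to_ac ` K" by (rule image_eqI[OF _ subfieldD(3)[OF K x(1) y(1)]]) (simp add: x y)
    show "x * y \<in> to_ac ` K" by (rule image_eqI[OF _ subfieldD(4)[OF K x(1) y(1)]]) (simp add: x y)
  qed
  have "k_subspace (to_ac ` K) {0}" by (simp add: k_subspace_def)
  then obtain f where f: "k_linear (to_ac ` K) f" "range f \<subseteq> to_ac ` K" "f 1 = 1"
    using separating_functional[OF KK, of "{0}" 1] by auto
  have "\<forall>l. \<exists>c. c \<in> K \<and> f (d l) = to_ac c" using f(2) by blast
  then obtain c where c: "\<And>l. c l \<in> K" "\<And>l. f (d l) = to_ac (c l)" by metis
  have "(\<Sum>l<m. dual_power k p l * c l) = a k ^ p" if k: "k < m" for k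
  proof -
    have "to_ac (\<Sum>l<m. dual_power k p l * c l) = (\<Sum>l<m. to_ac (dual_power k p l) * f (d l))"
      by (simp add: to_ac_sum c)
    also have "\<dots> = (\<Sum>l<m. f (to_ac (dual_power k p l) * d l))"
      using dual_power_in_base[OF k]
      by (intro sum.cong refl k_linearD(2)[OF f(1), symmetric]) simp
    also have "\<dots> = f (to_ac (a k ^ p) * 1)"
      unfolding k_linear_sum(2)[OF f(1), symmetric] d[OF k] by simp
    also have "\<dots> = to_ac (a k ^ p) * f 1"
      by (rule k_linearD(2)[OF f(1)]) (intro imageI subfield_power[OF K a[OF k]])
    finally show ?thesis unfolding f(3) by (simp only: mult_1_right to_ac_eq_iff)
  qed
  with c(1) show ?thesis by blast
qed

end

subsection \<open>Submodules of L over the Hopf algebra\<close>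

text \<open>A relation would allow one vector to be dropped, leaving fewer than n that span
  L.\<close>

lemma lin_indep_of_spanning_card_le:
  assumes K: "subfield K" and n: "ext_degree_is K n" and "m \<le> n"
    and sp: "\<And>x. \<exists>c. (\<forall>k<m. c k \<in> K) \<and> x = (\<Sum>k<m. c k * w k)"
    and a: "\<And>k. k < m \<Longrightarrow> a k \<in> K" "(\<Sum>k<m. a k * w k) = 0" and k: "k < m"
  shows "a k = 0"
proof (rule ccontr)
  assume ak: "a k \<noteq> 0"
  define I where "I = {..<m} - {k}"
  have I: "finite I" "{..<m} = insert k I" "k \<notin> I" using k by (auto simp: I_def)
  have cardI: "card I < n" using k \<open>m \<le> n\<close> by (simp add: I_def)
  have wk: "w k = (\<Sum>j\<in>I. (- inverse (a k) * a j) * w j)"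
  proof -
    have "a k * w k = - (\<Sum>j\<in>I. a j * w j)" using a(2) I by (simp add: eq_neg_iff_add_eq_0)
    then have "w k = - inverse (a k) * (\<Sum>j\<in>I. a j * w j)" using ak by (simp add: field_simps)
    then show ?thesis by (simp add: sum_distrib_left mult.assoc)
  qed
  have sp': "\<exists>c. (\<forall>j\<in>I. c j \<in> K) \<and> x = (\<Sum>j\<in>I. c j * w j)" for x
  proof -
    obtain c where c: "\<forall>k<m. c k \<in> K" "x = (\<Sum>k<m. c k * w k)" using sp by blast
    have "x = c k * w k + (\<Sum>j\<in>I. c j * w j)" using c(2) I by simp
    also have "\<dots> = (\<Sum>j\<in>I. (c j + c k * (- inverse (a k) * a j)) * w j)"
      unfolding wk sum_distrib_left sum.distrib[symmetric]
      by (intro sum.cong refl) (simp add: algebra_simps)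
    finally have "x = (\<Sum>j\<in>I. (c j + c k * (- inverse (a k) * a j)) * w j)" .
    moreover have "c j + c k * (- inverse (a k) * a j) \<in> K" if "j \<in> I" for j
      using that c(1) a(1) k
      by (intro subfieldD(3)[OF K] subfieldD(4)[OF K] subfieldD(5)[OF K] subfieldD(6)[OF K]) (auto simp: I_def)
    ultimately show ?thesis by (intro exI[of _ "\<lambda>j. c j + c k * (- inverse (a k) * a j)"]) blast
  qed
  obtain b where b: "k_basis K b n" using n by (auto simp: ext_degree_is_def)
  have "\<exists>M. \<forall>i. (\<forall>j\<in>I. M i j \<in> K) \<and> b i = (\<Sum>j\<in>I. M i j * w j)"
    by (intro choice allI sp')
  then obtain M where M: "\<And>i j. j \<in> I \<Longrightarrow> M i j \<in> K" "\<And>i. b i = (\<Sum>j\<in>I. M i j * w j)"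
    by blast
  obtain d i where d: "\<forall>i\<in>{..<n}. d i \<in> K" "i < n" "d i \<noteq> 0"
      "\<forall>j\<in>I. (\<Sum>i<n. M i j * d i) = 0"
    using homogeneous_system_nontrivial_solution[OF K, of I "{..<n}" "\<lambda>j i. M i j"] I cardI M by auto
  have "(\<Sum>i<n. d i * b i) = (\<Sum>i<n. \<Sum>j\<in>I. (M i j * d i) * w j)"
    unfolding M(2) by (simp add: sum_distrib_left mult_ac)
  also have "\<dots> = (\<Sum>j\<in>I. (\<Sum>i<n. M i j * d i) * w j)"
    unfolding sum_distrib_right by (rule sum.swap)
  also have "\<dots> = 0" using d(4) by simp
  finally have s: "(\<Sum>i<n. d i * b i) = 0" .
  have "k_lin_indep K b n" using b by (simp add: k_basis_def)
  then have "d i = 0" by (rule k_lin_indepD[OF _ _ s d(2)]) (use d(1) in simp)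
  with d(3) show False by simp
qed

section \<open>The trace form and orthogonal complements\<close>

context separable_extension
begin

lemma trace_add: "field_trace K (x + y) = field_trace K x + field_trace K y"
  and trace_scale: "c \<in> K \<Longrightarrow> field_trace K (c * x) = c * field_trace K x"
  and trace_0: "field_trace K 0 = 0"
  and trace_sum: "field_trace K (sum f A) = (\<Sum>i\<in>A. field_trace K (f i))"
  and trace_diff: "field_trace K (x - y) = field_trace K x - field_trace K y"
  and trace_in: "field_trace K x \<in> K"
  by (rule k_linearD[OF field_trace_linear(1)[OF K deg]] k_linear_sum[OF field_trace_linear(1)[OF K deg]]
      field_trace_linear(2)[OF K deg] | assumption)+

definition trace_perp :: "'a set \<Rightarrow> 'a set" where
  "trace_perp V = {a. \<forall>x\<in>V. field_trace K (a * x) = 0}"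

lemma k_subspace_trace_perp: "k_subspace K (trace_perp V)"
  unfolding k_subspace_def trace_perp_def
  by (auto simp: trace_0 distrib_right trace_add mult.assoc trace_scale)

text \<open>Orthogonality to a basis of W imposes fewer than n conditions on n coordinates.\<close>

lemma trace_perp_nonzero:
  assumes W: "k_subspace K W" "W \<noteq> UNIV"
  shows "\<exists>a\<in>trace_perp W. a \<noteq> 0"
proof -
  obtain b where b: "k_basis K b n" using deg by (auto simp: ext_degree_is_def)
  let ?d = "k_dim K W"
  have d: "?d < n" using k_dim_strict_mono[OF K deg W(1), of UNIV] W(2) k_dim_UNIV[OF K deg] by auto
  obtain v where v: "\<forall>i<?d. v i \<in> W" "k_lin_indep K v ?d" using k_dim_props(1)[OF K deg] by blast
  obtain c j where c: "\<forall>j\<in>{..<n}. c j \<in> K" "j < n" "c j \<noteq> 0"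
      "\<forall>i\<in>{..<?d}. (\<Sum>j<n. field_trace K (b j * v i) * c j) = 0"
    using homogeneous_system_nontrivial_solution[OF K, of "{..<?d}" "{..<n}"
        "\<lambda>i j. field_trace K (b j * v i)"] d trace_in by auto
  define a where "a = (\<Sum>j<n. c j * b j)"
  have "a \<noteq> 0"
  proof
    assume "a = 0"
    then have s: "(\<Sum>j<n. c j * b j) = 0" by (simp add: a_def)
    have "k_lin_indep K b n" using b by (simp add: k_basis_def)
    then have "c j = 0" by (rule k_lin_indepD[OF _ _ s c(2)]) (use c(1) in simp)
    with c(3) show False by simp
  qed
  moreover have "field_trace K (a * x) = 0" if x: "x \<in> W" for x
  proof -
    obtain e where e: "\<forall>i<?d. e i \<in> K" "x = (\<Sum>i<?d. e i * v i)"
      using k_dim_spanning[OF K deg v x] by blast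
    have av: "field_trace K (a * v i) = 0" if "i < ?d" for i
    proof -
      have "field_trace K (a * v i) = (\<Sum>j<n. field_trace K (c j * (b j * v i)))"
        unfolding a_def by (simp add: sum_distrib_right trace_sum mult.assoc)
      also have "\<dots> = (\<Sum>j<n. field_trace K (b j * v i) * c j)"
        using c(1) by (intro sum.cong refl) (simp add: trace_scale)
      finally show ?thesis using c(4) that by simp
    qed
    have "field_trace K (a * x) = (\<Sum>i<?d. field_trace K (e i * (a * v i)))"
      unfolding e(2) by (simp add: sum_distrib_left trace_sum mult.left_commute)
    also have "\<dots> = 0" using e(1) av by (simp add: trace_scale)
    finally show ?thesis .
  qed
  ultimately show ?thesis by (auto simp: trace_perp_def)
qed

lemma trace_perp_eq_UNIV:
  assumes "trace_perp V = UNIV" "x \<in> V"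
  shows "x = 0"
proof (rule ccontr)
  assume "x \<noteq> 0"
  obtain y where y: "field_trace K y \<noteq> 0" using field_trace_nonzero by blast
  have "y / x \<in> trace_perp V" using assms by simp
  then have "field_trace K (y / x * x) = 0" using assms(2) unfolding trace_perp_def by blast
  with y \<open>x \<noteq> 0\<close> show False by simp
qed

end

section \<open>The operator algebra of H, its left ideals and the submodules of L\<close>

context hopf_galois_extension
begin

text \<open>The image of \<open>H\<close> in \<open>End\<^sub>K(L)\<close>; the counit of \<open>h\<close> is \<open>h 1\<close>.\<close>
definition ops :: "('a \<Rightarrow> 'a) set" where
  "ops = {h. \<exists>a. (\<forall>k<m. a k \<in> K) \<and> h = (\<lambda>x. \<Sum>k<m. a k * act k x)}"

lemma opsE:
  assumes "h \<in> ops"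
  obtains a where "\<And>k. k < m \<Longrightarrow> a k \<in> K" "h = (\<lambda>x. \<Sum>k<m. a k * act k x)"
proof -
  have "\<exists>a. (\<forall>k<m. a k \<in> K) \<and> h = (\<lambda>x. \<Sum>k<m. a k * act k x)"
    using assms unfolding ops_def by (rule CollectD)
  then obtain a where a: "\<forall>k<m. a k \<in> K" "h = (\<lambda>x. \<Sum>k<m. a k * act k x)" by (elim exE conjE)
  show ?thesis by (rule that[OF _ a(2)]) (use a(1) in blast)
qed

lemma opsI: "(\<And>k. k < m \<Longrightarrow> a k \<in> K) \<Longrightarrow> (\<lambda>x. \<Sum>k<m. a k * act k x) \<in> ops"
  unfolding ops_def by (intro CollectI exI[of _ a]) simp

lemma ops_linear:
  assumes "h \<in> ops"
  shows "k_linear K h"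
proof -
  obtain a where a: "\<And>k. k < m \<Longrightarrow> a k \<in> K" "h = (\<lambda>x. \<Sum>k<m. a k * act k x)"
    by (rule opsE[OF assms]) (rule that)
  show ?thesis unfolding k_linear_def a(2)
    by (simp add: k_linearD[OF act_linear] distrib_left sum.distrib sum_distrib_left mult.left_commute)
qed

lemmas ops_apply = k_linearD[OF ops_linear] k_linear_sum[OF ops_linear]

lemma ops_add:
  assumes "h \<in> ops" "g \<in> ops"
  shows "(\<lambda>x. h x + g x) \<in> ops"
proof -
  obtain a where a: "\<And>k. k < m \<Longrightarrow> a k \<in> K" "h = (\<lambda>x. \<Sum>k<m. a k * act k x)"
    by (rule opsE[OF assms(1)]) (rule that)
  obtain b where b: "\<And>k. k < m \<Longrightarrow> b k \<in> K" "g = (\<lambda>x. \<Sum>k<m. b k * act k x)"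
    by (rule opsE[OF assms(2)]) (rule that)
  have "(\<lambda>x. \<Sum>k<m. (a k + b k) * act k x) \<in> ops"
    using a b by (intro opsI subfieldD(3)[OF K])
  then show ?thesis unfolding a(2) b(2) by (simp add: distrib_right sum.distrib)
qed

lemma ops_scale:
  assumes "h \<in> ops" "c \<in> K"
  shows "(\<lambda>x. c * h x) \<in> ops"
proof -
  obtain a where a: "\<And>k. k < m \<Longrightarrow> a k \<in> K" "h = (\<lambda>x. \<Sum>k<m. a k * act k x)"
    by (rule opsE[OF assms(1)]) (rule that)
  have "(\<lambda>x. \<Sum>k<m. (c * a k) * act k x) \<in> ops"
    using a assms(2) by (intro opsI subfieldD(4)[OF K])
  then show ?thesis unfolding a(2) by (simp add: sum_distrib_left mult.assoc)
qed

lemma ops_diff: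
  assumes "h \<in> ops" "g \<in> ops"
  shows "(\<lambda>x. h x - g x) \<in> ops"
  using ops_add[OF assms(1) ops_scale[OF assms(2) subfieldD(5)[OF K subfieldD(2)[OF K]]]] by simp

lemma ops_zero: "(\<lambda>x. 0) \<in> ops"
  using opsI[of "\<lambda>_. 0"] subfieldD(1)[OF K] by simp

lemma ops_id: "(\<lambda>x. x) \<in> ops"
  using opsI[of u] structure_constants(3) act_unit by simp

lemma ops_sum: "(\<And>i. i \<in> A \<Longrightarrow> h i \<in> ops) \<Longrightarrow> (\<lambda>x. \<Sum>i\<in>A. h i x) \<in> ops"
  by (induction A rule: infinite_finite_induct) (auto intro: ops_zero ops_add)

lemma ops_act: "k < m \<Longrightarrow> act k \<in> ops"
proof -
  assume k: "k < m"
  have "(\<lambda>x. \<Sum>j<m. (if j = k then 1 else 0) * act j x) \<in> ops"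
    by (rule opsI) (auto intro: subfieldD[OF K])
  moreover have "(\<Sum>j<m. (if j = k then 1 else 0) * act j x) = (\<Sum>j<m. if j = k then act k x else 0)" for x
    by (intro sum.cong) auto
  ultimately show ?thesis using k by simp
qed

lemma ops_comp:
  assumes h: "h \<in> ops" and g: "g \<in> ops"
  shows "(\<lambda>x. h (g x)) \<in> ops"
proof -
  obtain a where a: "\<And>k. k < m \<Longrightarrow> a k \<in> K" "h = (\<lambda>x. \<Sum>k<m. a k * act k x)"
    by (rule opsE[OF h]) (rule that)
  obtain b where b: "\<And>k. k < m \<Longrightarrow> b k \<in> K" "g = (\<lambda>x. \<Sum>k<m. b k * act k x)"
    by (rule opsE[OF g]) (rule that)
  have aa: "act k (g x) = (\<Sum>l<m. b l * (\<Sum>r<m. mu k l r * act r x))" if "k < m" for k x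
    unfolding b(2) k_linear_sum(2)[OF act_linear[OF that]]
    by (intro sum.cong refl) (simp add: k_linearD(2)[OF act_linear[OF that] b(1)] act_comp that)
  have "(\<lambda>x. \<Sum>k<m. a k * (\<Sum>l<m. b l * (\<Sum>r<m. mu k l r * act r x))) \<in> ops"
    using a(1) b(1) structure_constants(1) by (intro ops_sum ops_scale opsI) auto
  moreover have "h (g x) = (\<Sum>k<m. a k * (\<Sum>l<m. b l * (\<Sum>r<m. mu k l r * act r x)))" for x
    unfolding a(2) by (intro sum.cong refl) (simp add: aa)
  ultimately show ?thesis by (simp only:)
qed

lemma ops_one:
  assumes "h \<in> ops"
  shows "h 1 \<in> K"
proof -
  obtain a where a: "\<And>k. k < m \<Longrightarrow> a k \<in> K" "h = (\<lambda>x. \<Sum>k<m. a k * act k x)"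
    by (rule opsE[OF assms]) (rule that)
  show ?thesis unfolding a(2) using a(1) structure_constants(4)
    by (intro subfield_sum[OF K] subfieldD(4)[OF K]) (simp_all add: act_one)
qed

lemma ops_base:
  assumes "h \<in> ops" "c \<in> K"
  shows "h c = c * h 1"
  using ops_apply(2)[OF assms, of 1] by simp

lemma trace_ops:
  assumes "h \<in> ops"
  shows "field_trace K (h x) = h 1 * field_trace K x"
proof -
  obtain a where a: "\<And>k. k < m \<Longrightarrow> a k \<in> K" "h = (\<lambda>x. \<Sum>k<m. a k * act k x)"
    by (rule opsE[OF assms]) (rule that)
  show ?thesis unfolding a(2)
    by (simp add: trace_sum trace_scale[OF a(1)] trace_act act_one sum_distrib_right mult.assoc)
qed

lemma ops_act_minus_counit:
  assumes "k < m"
  shows "(\<lambda>x. act k x - ep k * x) \<in> ops" "act k 1 - ep k * 1 = 0"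
proof -
  show "(\<lambda>x. act k x - ep k * x) \<in> ops"
    by (intro ops_diff ops_act ops_scale ops_id structure_constants(4) assms)
  show "act k 1 - ep k * 1 = 0" by (simp add: act_one assms)
qed

lemma ops_invariants_in_base:
  assumes "\<And>h. h \<in> ops \<Longrightarrow> h 1 = 0 \<Longrightarrow> h x = 0"
  shows "x \<in> K"
proof (rule invariants_in_base)
  fix k assume "k < m"
  from assms[OF ops_act_minus_counit[OF this]] show "act k x = ep k * x" by simp
qed

definition submodule :: "'a set \<Rightarrow> bool" where
  "submodule U \<longleftrightarrow> k_subspace K U \<and> (\<forall>h\<in>ops. \<forall>x\<in>U. h x \<in> U)"

lemma submoduleD:
  assumes "submodule U"
  shows "k_subspace K U" "h \<in> ops \<Longrightarrow> x \<in> U \<Longrightarrow> h x \<in> U"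
    "0 \<in> U" "x \<in> U \<Longrightarrow> y \<in> U \<Longrightarrow> x + y \<in> U" "x \<in> U \<Longrightarrow> y \<in> U \<Longrightarrow> x - y \<in> U"
    "c \<in> K \<Longrightarrow> x \<in> U \<Longrightarrow> c * x \<in> U"
proof -
  have U: "k_subspace K U" "\<forall>h\<in>ops. \<forall>x\<in>U. h x \<in> U" using assms by (simp_all add: submodule_def)
  show "k_subspace K U" by (rule U(1))
  show "h \<in> ops \<Longrightarrow> x \<in> U \<Longrightarrow> h x \<in> U" using U(2) by blast
  show "0 \<in> U" by (rule k_subspaceD(1)[OF U(1)])
  show "x \<in> U \<Longrightarrow> y \<in> U \<Longrightarrow> x + y \<in> U" by (rule k_subspaceD(2)[OF U(1)])
  show "x \<in> U \<Longrightarrow> y \<in> U \<Longrightarrow> x - y \<in> U" by (rule k_subspace_diff[OF K U(1)])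
  show "c \<in> K \<Longrightarrow> x \<in> U \<Longrightarrow> c * x \<in> U" by (rule k_subspaceD(3)[OF U(1)])
qed

lemma submoduleI_act:
  assumes "k_subspace K U" "\<And>k x. k < m \<Longrightarrow> x \<in> U \<Longrightarrow> act k x \<in> U"
  shows "submodule U"
  unfolding submodule_def
proof (intro conjI ballI)
  fix h x assume h: "h \<in> ops" and x: "x \<in> U"
  obtain a where a: "\<And>k. k < m \<Longrightarrow> a k \<in> K" "h = (\<lambda>x. \<Sum>k<m. a k * act k x)"
    by (rule opsE[OF h]) (rule that)
  show "h x \<in> U" unfolding a(2) using a(1) assms(2) x
    by (intro k_subspace_sum[OF assms(1)] k_subspaceD(3)[OF assms(1)]) auto
qed fact

lemma submodule_trace_perp:
  assumes V: "submodule V"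
  shows "submodule (trace_perp V)"
proof (rule submoduleI_act[OF k_subspace_trace_perp])
  fix k a assume k: "k < m" and a: "a \<in> trace_perp V"
  have "field_trace K (act k a * x) = 0" if "x \<in> V" for x
    using k a that submoduleD(2)[OF V ops_act]
    by (intro trace_orthogonal_stable[of V]) (auto simp: trace_perp_def)
  then show "act k a \<in> trace_perp V" by (simp add: trace_perp_def)
qed

definition left_ideal :: "('a \<Rightarrow> 'a) set \<Rightarrow> bool" where
  "left_ideal J \<longleftrightarrow> J \<subseteq> ops \<and> (\<lambda>x. 0) \<in> J \<and> (\<forall>h\<in>J. \<forall>g\<in>J. (\<lambda>x. h x + g x) \<in> J) \<and>
     (\<forall>g\<in>ops. \<forall>h\<in>J. (\<lambda>x. g (h x)) \<in> J)"

lemma app_mem: "h \<in> J \<Longrightarrow> h x \<in> {h x | h. h \<in> J}"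
  by blast

lemma submodule_left_ideal_image:
  assumes J: "left_ideal J"
  shows "submodule {h x | h. h \<in> J}"
  unfolding submodule_def k_subspace_def
proof (intro conjI ballI)
  have "(\<lambda>x. 0) \<in> J" using J unfolding left_ideal_def by blast
  from app_mem[OF this, of x] show "0 \<in> {h x | h. h \<in> J}" .
  fix y assume "y \<in> {h x | h. h \<in> J}"
  then obtain h where h: "h \<in> J" "y = h x" by blast
  have comp: "g y \<in> {h x | h. h \<in> J}" if g: "g \<in> ops" for g
  proof -
    have "(\<lambda>x. g (h x)) \<in> J" using J h g unfolding left_ideal_def by blast
    then show ?thesis using h(2) by (intro CollectI exI[of _ "\<lambda>x. g (h x)"]) simp
  qed
  {
    fix z assume "z \<in> {h x | h. h \<in> J}"
    then obtain g where g: "g \<in> J" "z = g x" by blast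
    have "(\<lambda>x. h x + g x) \<in> J" using J h g unfolding left_ideal_def by blast
    then show "y + z \<in> {h x | h. h \<in> J}"
      using h(2) g(2) by (intro CollectI exI[of _ "\<lambda>x. h x + g x"]) simp
  }
  fix c assume "c \<in> K"
  then show "c * y \<in> {h x | h. h \<in> J}" using comp[OF ops_scale[OF ops_id]] by simp
next
  fix g y assume g: "g \<in> ops" and "y \<in> {h x | h. h \<in> J}"
  then obtain h where h: "h \<in> J" "y = h x" by blast
  have "(\<lambda>x. g (h x)) \<in> J" using J h g unfolding left_ideal_def by blast
  then show "g y \<in> {h x | h. h \<in> J}" using h(2) by (intro CollectI exI[of _ "\<lambda>x. g (h x)"]) simp
qed

lemma left_ideal_ops: "left_ideal ops"
  by (simp add: left_ideal_def ops_zero ops_add ops_comp)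

lemma left_ideal_annihilator: "left_ideal {h \<in> ops. \<forall>y\<in>S. h y = 0}"
  by (auto simp: left_ideal_def ops_zero ops_add ops_comp ops_apply(3))

definition aug :: "('a \<Rightarrow> 'a) set" where
  "aug = {h \<in> ops. h 1 = 0}"

lemma left_ideal_aug: "left_ideal aug"
  using left_ideal_annihilator[of "{1}"] by (simp add: aug_def)

text \<open>The ideal is two-sided because \<open>g 1\<close> lies in K, so that
  \<open>h (g 1) = g 1 * h 1\<close>.\<close>

lemma aug_comp: "h \<in> aug \<Longrightarrow> g \<in> ops \<Longrightarrow> (\<lambda>x. h (g x)) \<in> aug"
  by (simp add: aug_def ops_comp ops_base[OF _ ops_one])

lemma submodule_sum:
  assumes U: "submodule U" and W: "submodule W"
  shows "submodule {x + y | x y. x \<in> U \<and> y \<in> W}"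
  unfolding submodule_def k_subspace_def
proof (intro conjI ballI)
  show "0 \<in> {x + y | x y. x \<in> U \<and> y \<in> W}" using submoduleD(3)[OF U] submoduleD(3)[OF W] by force
next
  fix a b assume "a \<in> {x + y | x y. x \<in> U \<and> y \<in> W}" "b \<in> {x + y | x y. x \<in> U \<and> y \<in> W}"
  then obtain x y x' y' where *: "x \<in> U" "y \<in> W" "x' \<in> U" "y' \<in> W" "a = x + y" "b = x' + y'" by blast
  then have "a + b = (x + x') + (y + y')" by (simp add: algebra_simps)
  then show "a + b \<in> {x + y | x y. x \<in> U \<and> y \<in> W}"
    using * submoduleD(4)[OF U] submoduleD(4)[OF W] by blast
next
  fix c a assume "c \<in> K" "a \<in> {x + y | x y. x \<in> U \<and> y \<in> W}"
  then obtain x y where *: "x \<in> U" "y \<in> W" "a = x + y" "c \<in> K" by blast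
  then have "c * a = c * x + c * y" by (simp add: algebra_simps)
  then show "c * a \<in> {x + y | x y. x \<in> U \<and> y \<in> W}"
    using * submoduleD(6)[OF U] submoduleD(6)[OF W] by blast
next
  fix h a assume h: "h \<in> ops" and "a \<in> {x + y | x y. x \<in> U \<and> y \<in> W}"
  then obtain x y where *: "x \<in> U" "y \<in> W" "a = x + y" by blast
  then have "h a = h x + h y" using ops_apply(1)[OF h] by simp
  then show "h a \<in> {x + y | x y. x \<in> U \<and> y \<in> W}"
    using * submoduleD(2)[OF U h] submoduleD(2)[OF W h] by blast
qed

text \<open>It contains every nontrivial simple submodule; unlike the sum of these, it is visibly stable
  under Frobenius.\<close>
definition nontrivial_part :: "'a set" where
  "nontrivial_part = {x. \<exists>h\<in>ops. h 1 = 1 \<and> (\<forall>g\<in>ops. h (g x) = 0)}"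

lemma submodule_nontrivial_part: "submodule nontrivial_part"
  unfolding submodule_def k_subspace_def
proof (intro conjI ballI)
  show "0 \<in> nontrivial_part"
    unfolding nontrivial_part_def using ops_id ops_apply(3) by (auto intro!: bexI[of _ "\<lambda>x. x"])
next
  fix x y assume "x \<in> nontrivial_part" "y \<in> nontrivial_part"
  then obtain h h' where h: "h \<in> ops" "h 1 = 1" "\<And>g. g \<in> ops \<Longrightarrow> h (g x) = 0"
    and h': "h' \<in> ops" "h' 1 = 1" "\<And>g. g \<in> ops \<Longrightarrow> h' (g y) = 0"
    unfolding nontrivial_part_def by blast
  \<comment> \<open>The composite serves for the sum: \<open>h'\<close> kills Hy, while
    \<open>h\<close> kills Hx, to which \<open>h' (g x)\<close> belongs.\<close>
  have "h (h' (g (x + y))) = 0" if g: "g \<in> ops" for g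
    using h(3)[OF ops_comp[OF h'(1) g]] h'(3)[OF g]
    by (simp add: ops_apply(1)[OF g] ops_apply(1)[OF h'(1)] ops_apply(1)[OF h(1)] ops_apply(3)[OF h(1)])
  then show "x + y \<in> nontrivial_part"
    unfolding nontrivial_part_def using ops_comp[OF h(1) h'(1)] h(2) h'(2)
    by (intro CollectI bexI[of _ "\<lambda>x. h (h' x)"]) simp_all
next
  fix f x assume f: "f \<in> ops" and "x \<in> nontrivial_part"
  then obtain h where h: "h \<in> ops" "h 1 = 1" "\<And>g. g \<in> ops \<Longrightarrow> h (g x) = 0"
    unfolding nontrivial_part_def by blast
  then have "h (g (f x)) = 0" if "g \<in> ops" for g using ops_comp[OF that f] by blast
  with h show "f x \<in> nontrivial_part" unfolding nontrivial_part_def by blast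
next
  fix c x assume c: "c \<in> K" and "x \<in> nontrivial_part"
  then obtain h where h: "h \<in> ops" "h 1 = 1" "\<And>g. g \<in> ops \<Longrightarrow> h (g x) = 0"
    unfolding nontrivial_part_def by blast
  have "h (g (c * x)) = 0" if "g \<in> ops" for g
    using h(3)[OF that] by (simp add: ops_apply(2)[OF that c] ops_apply(2)[OF h(1) c])
  with h show "c * x \<in> nontrivial_part" unfolding nontrivial_part_def by blast
qed

lemma one_notin_nontrivial_part: "1 \<notin> nontrivial_part"
proof
  assume "1 \<in> nontrivial_part"
  then obtain h where h: "h \<in> ops" "h 1 = 1" "\<And>g. g \<in> ops \<Longrightarrow> h (g 1) = 0"
    unfolding nontrivial_part_def by blast
  from h(3)[OF ops_id] h(2) show False by simp
qed

text \<open>A density argument for the two non-isomorphic simple modules K and W. To add x to S, let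
  J be the annihilator of 1 and S. If J x = W, some g in J agrees with h at x and is subtracted from
  h. If J x = 0, then everything of counit 0 kills \<open>h x\<close>, so \<open>h x\<close> is an
  invariant; as W contains no nonzero element of K, it is 0 already.\<close>

lemma kill_finite_subset_of_simple:
  assumes W: "submodule W" "1 \<notin> W" and simple: "\<And>U. submodule U \<Longrightarrow> U \<subseteq> W \<Longrightarrow> U = {0} \<or> U = W"
    and "finite S" "S \<subseteq> W"
  shows "\<exists>h\<in>ops. h 1 = 1 \<and> (\<forall>x\<in>S. h x = 0)"
  using assms(4,5)
proof (induction S rule: finite_induct)
  case empty
  then show ?case using ops_id by (intro bexI[of _ "\<lambda>x. x"]) auto
next
  case (insert x S)
  then obtain h where h: "h \<in> ops" "h 1 = 1" "\<forall>x\<in>S. h x = 0" by auto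
  have x: "x \<in> W" using insert.prems by simp
  define J where "J = {g \<in> ops. \<forall>y\<in>insert 1 S. g y = 0}"
  have "submodule {g x | g. g \<in> J}"
    unfolding J_def by (rule submodule_left_ideal_image[OF left_ideal_annihilator])
  moreover have "{g x | g. g \<in> J} \<subseteq> W" using submoduleD(2)[OF W(1) _ x] by (auto simp: J_def)
  ultimately consider "{g x | g. g \<in> J} = {0}" | "{g x | g. g \<in> J} = W" using simple by blast
  then show ?case
  proof cases
    case 1
    have "h x \<in> K"
    proof (rule ops_invariants_in_base)
      fix g assume g: "g \<in> ops" "g 1 = 0"
      then have "(\<lambda>x. g (h x)) \<in> J" using h by (auto simp: J_def ops_comp ops_apply(3))
      from app_mem[OF this, of x] show "g (h x) = 0" unfolding 1 by simp
    qed
    have "h x = 0"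
    proof (rule ccontr)
      assume nz: "h x \<noteq> 0"
      have "inverse (h x) * h x \<in> W"
        using submoduleD(2)[OF W(1) h(1) x] \<open>h x \<in> K\<close>
        by (intro submoduleD(6)[OF W(1)] subfieldD(6)[OF K])
      with nz W(2) show False by simp
    qed
    with h show ?thesis by blast
  next
    case 2
    then have "h x \<in> {g x | g. g \<in> J}" using submoduleD(2)[OF W(1) h(1) x] by simp
    then obtain g where g: "g \<in> J" "h x = g x" by blast
    have "(\<lambda>x. h x - g x) \<in> ops" using h g by (intro ops_diff) (auto simp: J_def)
    then show ?thesis using h g by (intro bexI[of _ "\<lambda>x. h x - g x"]) (auto simp: J_def)
  qed
qed

text \<open>A nonzero submodule of least dimension inside U is simple. If it did not contain 1, an
  operator of counit 1 would kill a basis of it and hence all of it, which places it inside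
  \<open>nontrivial_part\<close>.\<close>

lemma one_in_submodule:
  assumes triv: "nontrivial_part \<subseteq> {0}" and U: "submodule U" "U \<noteq> {0}"
  shows "1 \<in> U"
proof (rule ccontr)
  assume 1: "1 \<notin> U"
  obtain W where W: "submodule W" "W \<noteq> {0}" "W \<subseteq> U"
    and min: "\<And>W'. submodule W' \<Longrightarrow> W' \<noteq> {0} \<Longrightarrow> W' \<subseteq> U \<Longrightarrow> k_dim K W \<le> k_dim K W'"
    using ex_has_least_nat[of "\<lambda>W. submodule W \<and> W \<noteq> {0} \<and> W \<subseteq> U" U "k_dim K"] U by blast
  have simple: "U' = {0} \<or> U' = W" if U': "submodule U'" "U' \<subseteq> W" for U'
  proof (rule ccontr)
    assume ne: "\<not> (U' = {0} \<or> U' = W)"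
    then have "k_dim K U' < k_dim K W"
      using U'(2) by (intro k_dim_strict_mono[OF K deg submoduleD(1)[OF U'(1)]]) auto
    moreover have "k_dim K W \<le> k_dim K U'" using U' W(3) ne by (intro min) auto
    ultimately show False by simp
  qed
  obtain v where v: "\<forall>i<k_dim K W. v i \<in> W" "k_lin_indep K v (k_dim K W)"
    using k_dim_props(1)[OF K deg] by blast
  have "1 \<notin> W" using 1 W by blast
  moreover have "v ` {..<k_dim K W} \<subseteq> W" using v(1) by auto
  ultimately obtain h where h: "h \<in> ops" "h 1 = 1" "\<forall>x\<in>v ` {..<k_dim K W}. h x = 0"
    using kill_finite_subset_of_simple[OF W(1) _ simple, of "v ` {..<k_dim K W}"] by blast
  have hW: "h x = 0" if x: "x \<in> W" for x
  proof -
    obtain c where c: "\<forall>i<k_dim K W. c i \<in> K" "x = (\<Sum>i<k_dim K W. c i * v i)"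
      using k_dim_spanning[OF K deg v x] by blast
    have "h x = (\<Sum>i<k_dim K W. c i * h (v i))"
      unfolding c(2) ops_apply(4)[OF h(1)] using c(1) by (intro sum.cong refl) (simp add: ops_apply(2)[OF h(1)])
    then show ?thesis using h(3) by simp
  qed
  obtain x where x: "x \<in> W" "x \<noteq> 0" using W submoduleD(3)[OF W(1)] by blast
  have "x \<in> nontrivial_part" unfolding nontrivial_part_def
    using h(1,2) hW submoduleD(2)[OF W(1) _ x(1)] by blast
  with triv x show False by blast
qed

section \<open>Consequences of a vanishing \<open>nontrivial_part\<close>\<close>

lemma trace_zero_on_proper_submodule:
  assumes triv: "nontrivial_part \<subseteq> {0}" and W: "submodule W" "W \<noteq> UNIV" and x: "x \<in> W"
  shows "field_trace K x = 0"
proof -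
  obtain a where "a \<in> trace_perp W" "a \<noteq> 0"
    using trace_perp_nonzero[OF submoduleD(1)[OF W(1)] W(2)] by blast
  then have "1 \<in> trace_perp W"
    using one_in_submodule[OF triv submodule_trace_perp[OF W(1)]] by blast
  with x have "field_trace K (1 * x) = 0" unfolding trace_perp_def by blast
  then show ?thesis by simp
qed

text \<open>Any y of nonzero trace generates L, as Hy is not in the kernel of the trace. Since Tr(h
  y) is Tr(y) times the counit of h, the element \<open>h y\<close> generates too, and some h' takes
  it back to y. The m \<le> n elements \<open>act k y\<close> span L and are therefore independent,
  so h' h - 1, which kills y, is zero.\<close>

lemma left_inverse_if_counit_nonzero:
  assumes triv: "nontrivial_part \<subseteq> {0}" and h: "h \<in> ops" "h 1 \<noteq> 0"
  shows "\<exists>h'\<in>ops. \<forall>x. h' (h x) = x"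
proof -
  have gen: "\<exists>g\<in>ops. x = g y" if "field_trace K y \<noteq> 0" for x y
  proof -
    have sub: "submodule {g y | g. g \<in> ops}" by (rule submodule_left_ideal_image[OF left_ideal_ops])
    have "y \<in> {g y | g. g \<in> ops}" by (rule app_mem[OF ops_id])
    then have "{g y | g. g \<in> ops} = UNIV"
      using trace_zero_on_proper_submodule[OF triv sub] that by blast
    then show ?thesis by blast
  qed
  obtain y where y: "field_trace K y \<noteq> 0" using field_trace_nonzero by blast
  have "field_trace K (h y) \<noteq> 0" using y h by (simp add: trace_ops)
  then obtain h' where h': "h' \<in> ops" "y = h' (h y)" using gen by blast
  have "(\<lambda>x. h' (h x) - x) \<in> ops" by (rule ops_diff[OF ops_comp[OF h'(1) h(1)] ops_id])
  then obtain a where a: "\<And>k. k < m \<Longrightarrow> a k \<in> K" "(\<lambda>x. h' (h x) - x) = (\<lambda>x. \<Sum>k<m. a k * act k x)"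
    by (rule opsE) (rule that)
  have sp: "\<exists>c. (\<forall>k<m. c k \<in> K) \<and> x = (\<Sum>k<m. c k * act k y)" for x
  proof -
    obtain g where g: "g \<in> ops" "x = g y" using gen[OF y] by blast
    obtain c where c: "\<And>k. k < m \<Longrightarrow> c k \<in> K" "g = (\<lambda>x. \<Sum>k<m. c k * act k x)"
      by (rule opsE[OF g(1)]) (rule that)
    show ?thesis unfolding g(2) c(2) using c(1) by (intro exI[of _ c]) simp
  qed
  have "(\<Sum>k<m. a k * act k y) = h' (h y) - y" using fun_cong[OF a(2), of y] by simp
  then have s: "(\<Sum>k<m. a k * act k y) = 0" using h'(2) by simp
  have "a k = 0" if "k < m" for k
    by (rule lin_indep_of_spanning_card_le[OF K deg hopf_dim_le sp a(1) s that])
  then have "h' (h x) - x = 0" for x using fun_cong[OF a(2), of x] by simp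
  with h' show ?thesis by (intro bexI[of _ h']) simp_all
qed

text \<open>Nakayama's argument with a maximal proper submodule T' and some t outside it. If aug t
  were not inside T', then t = x + h t with x in T' and h of counit 0; the operator 1 - h has counit
  1, is left invertible, and would bring t into T'. As T = T' + Ht and \<open>aug\<close> is
  two-sided, all of T is sent into T'.\<close>

lemma aug_decreases:
  assumes triv: "nontrivial_part \<subseteq> {0}" and T: "submodule T" "T \<noteq> {0}"
  shows "\<exists>T'. submodule T' \<and> T' \<subset> T \<and> (\<forall>h\<in>aug. \<forall>x\<in>T. h x \<in> T')"
proof -
  let ?P = "\<lambda>U. submodule U \<and> U \<subset> T"
  have "?P {0}"
    using T submoduleD(3)[OF T(1)] by (auto simp: submodule_def k_subspace_def ops_apply(3))
  then obtain T' where T': "submodule T'" "T' \<subset> T"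
    and max: "\<And>U. ?P U \<Longrightarrow> k_dim K U \<le> k_dim K T'"
    using ex_has_greatest_nat[of ?P "{0}" "k_dim K" "Suc n"] k_dim_props(3)[OF K deg]
    by (auto simp: less_Suc_eq_le)
  have max': "U = T' \<or> U = T" if U: "submodule U" "T' \<subseteq> U" "U \<subseteq> T" for U
  proof (rule ccontr)
    assume ne: "\<not> (U = T' \<or> U = T)"
    then have "k_dim K T' < k_dim K U"
      using U(2) by (intro k_dim_strict_mono[OF K deg submoduleD(1)[OF T'(1)]]) auto
    moreover have "k_dim K U \<le> k_dim K T'" using U ne by (intro max) auto
    ultimately show False by simp
  qed
  obtain t where t: "t \<in> T" "t \<notin> T'" using T' by blast
  have step: "{x + y | x y. x \<in> T' \<and> y \<in> {h t | h. h \<in> J}} = T' \<or>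
      {x + y | x y. x \<in> T' \<and> y \<in> {h t | h. h \<in> J}} = T" if J: "left_ideal J" for J
  proof (rule max')
    show "submodule {x + y | x y. x \<in> T' \<and> y \<in> {h t | h. h \<in> J}}"
      by (rule submodule_sum[OF T'(1) submodule_left_ideal_image[OF J]])
    have "(\<lambda>x. 0) \<in> J" using J unfolding left_ideal_def by blast
    from app_mem[OF this, of t] have "0 \<in> {h t | h. h \<in> J}" .
    then show "T' \<subseteq> {x + y | x y. x \<in> T' \<and> y \<in> {h t | h. h \<in> J}}" by force
    show "{x + y | x y. x \<in> T' \<and> y \<in> {h t | h. h \<in> J}} \<subseteq> T"
      using T' t J submoduleD(2,4)[OF T(1)] unfolding left_ideal_def by blast
  qed
  have "t \<in> {h t | h. h \<in> ops}" by (rule app_mem[OF ops_id])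
  then have "0 + t \<in> {x + y | x y. x \<in> T' \<and> y \<in> {h t | h. h \<in> ops}}"
    using submoduleD(3)[OF T'(1)] by blast
  then have "t \<in> {x + y | x y. x \<in> T' \<and> y \<in> {h t | h. h \<in> ops}}" by simp
  then have all: "{x + y | x y. x \<in> T' \<and> y \<in> {h t | h. h \<in> ops}} = T"
    using step[OF left_ideal_ops] t by blast
  have aug: "{x + y | x y. x \<in> T' \<and> y \<in> {h t | h. h \<in> aug}} = T'"
  proof (rule ccontr)
    assume "\<not> ?thesis"
    then have "t \<in> {x + y | x y. x \<in> T' \<and> y \<in> {h t | h. h \<in> aug}}"
      using step[OF left_ideal_aug] t by blast
    then obtain x z where z: "x \<in> T'" "z \<in> {h t | h. h \<in> aug}" "t = x + z" by blast
    then obtain h where h: "x \<in> T'" "h \<in> aug" "t = x + h t" by blast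
    have "(\<lambda>x. x - h x) \<in> ops" using h by (intro ops_diff ops_id) (simp add: aug_def)
    moreover have "1 - h 1 \<noteq> 0" using h by (simp add: aug_def)
    ultimately obtain h' where h': "h' \<in> ops" "\<And>x. h' (x - h x) = x"
      using left_inverse_if_counit_nonzero[OF triv, of "\<lambda>x. x - h x"] by blast
    have "t - h t = x" using h(3) by (simp add: algebra_simps)
    then have "t - h t \<in> T'" using h(1) by simp
    from submoduleD(2)[OF T'(1) h'(1) this] show False using h'(2) t by simp
  qed
  have "h x \<in> T'" if h: "h \<in> aug" and x: "x \<in> T" for h x
  proof -
    obtain t' z where z: "t' \<in> T'" "z \<in> {h t | h. h \<in> ops}" "x = t' + z" using x all by blast
    then obtain g where g: "t' \<in> T'" "g \<in> ops" "x = t' + g t" by blast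
    have hops: "h \<in> ops" using h by (simp add: aug_def)
    from app_mem[OF aug_comp[OF h g(2)], of t] have "h (g t) \<in> {h t | h. h \<in> aug}" .
    then have "0 + h (g t) \<in> {x + y | x y. x \<in> T' \<and> y \<in> {h t | h. h \<in> aug}}"
      using submoduleD(3)[OF T'(1)] by blast
    then have "0 + h (g t) \<in> T'" unfolding aug .
    then have "h (g t) \<in> T'" by simp
    then show ?thesis unfolding g(3) ops_apply(1)[OF hops]
      using submoduleD(2)[OF T'(1) hops g(1)] by (rule submoduleD(4)[OF T'(1), rotated])
  qed
  with T' show ?thesis by blast
qed

end

context hopf_galois_char_p
begin

text \<open>If h kills Hx, its Frobenius companion h' with h'(y^p) = (h y)^p again has counit 1, and
  it kills H(x^p) because each \<open>act l (x ^ p)\<close> is a K-combination of the powers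
  \<open>act k x ^ p\<close>.\<close>

lemma nontrivial_part_power_p:
  assumes "x \<in> nontrivial_part"
  shows "x ^ p \<in> nontrivial_part"
proof -
  obtain h where h: "h \<in> ops" "h 1 = 1" "\<And>g. g \<in> ops \<Longrightarrow> h (g x) = 0"
    using assms unfolding nontrivial_part_def by blast
  obtain a where a: "\<And>k. k < m \<Longrightarrow> a k \<in> K" "h = (\<lambda>x. \<Sum>k<m. a k * act k x)"
    by (rule opsE[OF h(1)]) (rule that)
  obtain c where c: "\<And>l. l < m \<Longrightarrow> c l \<in> K" "\<And>k. k < m \<Longrightarrow> (\<Sum>l<m. dual_power k p l * c l) = a k ^ p"
    using frobenius_twist_surj[of a] a(1) by blast
  define h' where "h' = (\<lambda>x. \<Sum>l<m. c l * act l x)"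
  have h': "h' \<in> ops" unfolding h'_def using c(1) by (rule opsI)
  have frob: "h' (y ^ p) = h y ^ p" for y
  proof -
    have "h' (y ^ p) = (\<Sum>l<m. \<Sum>k<m. dual_power k p l * c l * act k y ^ p)"
      unfolding h'_def by (intro sum.cong refl) (simp add: act_power_p sum_distrib_left mult_ac)
    also have "\<dots> = (\<Sum>k<m. (\<Sum>l<m. dual_power k p l * c l) * act k y ^ p)"
      unfolding sum_distrib_right by (rule sum.swap)
    also have "\<dots> = (\<Sum>k<m. (a k * act k y) ^ p)"
      by (intro sum.cong refl) (simp add: c(2) power_mult_distrib)
    finally show ?thesis unfolding a(2) power_p_sum .
  qed
  have "h' 1 = 1" using frob[of 1] h(2) by simp
  moreover have "h' (g (x ^ p)) = 0" if g: "g \<in> ops" for g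
  proof -
    obtain d where d: "\<And>k. k < m \<Longrightarrow> d k \<in> K" "g = (\<lambda>x. \<Sum>k<m. d k * act k x)"
      by (rule opsE[OF g]) (rule that)
    have "h' (act l (x ^ p)) = 0" if l: "l < m" for l
    proof -
      have "h' (act l (x ^ p)) = (\<Sum>k<m. dual_power k p l * h' (act k x ^ p))"
        unfolding act_power_p[OF l] ops_apply(4)[OF h']
        by (intro sum.cong refl) (simp add: ops_apply(2)[OF h' dual_power_in_base[OF _ l]])
      also have "\<dots> = 0" using h(3)[OF ops_act] prime_gt_0_nat[OF p(1)]
        by (intro sum.neutral ballI) (simp add: frob zero_power)
      finally show ?thesis .
    qed
    then show ?thesis unfolding d(2) ops_apply(4)[OF h']
      by (intro sum.neutral ballI) (simp add: ops_apply(2)[OF h' d(1)])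
  qed
  ultimately show ?thesis using h' unfolding nontrivial_part_def by blast
qed

text \<open>Let B be the difference between the twist of t by g and t. As \<epsilon>(g) = 1, B
  involves only the operators \<open>act k - ep k\<close>, which take T to a smaller T' where g acts
  trivially by induction. Hence B does not change when t is replaced by its twist, so twisting j
  times adds j * B on T. For j = q nothing changes, and q is invertible in characteristic p.\<close>

lemma twist_unipotent_trivial:
  assumes triv: "nontrivial_part \<subseteq> {0}" and g: "g \<in> grouplikes"
    and q: "g [^]\<^bsub>GL\<^esub> q = gunit" "\<not> p dvd q"
    and "submodule T" "x \<in> T" "t \<in> X_emb"
  shows "twist t g x = t x"
  using assms(5-)
proof (induction "k_dim K T" arbitrary: T t x rule: less_induct)
  case less
  show ?case
  proof (cases "T = {0}")
    case True
    then have "x = 0" using less.prems by simp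
    then show ?thesis
      using k_embeddingsD(5)[OF less.prems(3)] k_embeddingsD(5)[OF twist_embedding[OF less.prems(3) g]] by simp
  next
    case False
    obtain T' where T': "submodule T'" "T' \<subset> T" "\<And>h x. h \<in> aug \<Longrightarrow> x \<in> T \<Longrightarrow> h x \<in> T'"
      using aug_decreases[OF triv less.prems(1) False] by blast
    have IH: "twist t g x = t x" if "x \<in> T'" "t \<in> X_emb" for t x
      using less.hyps[OF k_dim_strict_mono[OF K deg submoduleD(1)[OF T'(1)] T'(2)] T'(1)] that by blast
    define B where "B t x = twist t g x - t x" for t x
    have B_aug: "B t x = (\<Sum>k<m. g k * t (act k x - ep k * x))" if "k_linear_ac K t" for t x
    proof -
      have "(\<Sum>k<m. g k * t (act k x - ep k * x)) = twist t g x - (\<Sum>k<m. g k * to_ac (ep k)) * t x"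
        using that structure_constants(4)
        by (simp add: k_linear_acD(2,5)[OF that] right_diff_distrib sum_subtractf twist_def
            sum_distrib_right mult.assoc)
      then show ?thesis using grouplikesD(3)[OF g] by (simp add: B_def)
    qed
    have BB: "B (twist t g) x = B t x" if t: "t \<in> X_emb" and x: "x \<in> T" for t x
    proof -
      have "act k x - ep k * x \<in> T'" if "k < m" for k
        using T'(3)[of "\<lambda>x. act k x - ep k * x" x] ops_act_minus_counit[OF that] x by (simp add: aug_def)
      then show ?thesis
        unfolding B_aug[OF k_embedding_linear[OF t]] B_aug[OF k_embedding_linear[OF twist_embedding[OF t g]]]
        using IH[OF _ t] by (intro sum.cong refl) simp
    qed
    have pow: "((\<lambda>t. twist t g) ^^ j) t x = t x + of_nat j * B t x" if "t \<in> X_emb" "x \<in> T" for j t x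
      using that
    proof (induction j arbitrary: t)
      case (Suc j)
      have "((\<lambda>t. twist t g) ^^ Suc j) t x = ((\<lambda>t. twist t g) ^^ j) (twist t g) x"
        by (simp only: funpow_Suc_right o_apply)
      also have "\<dots> = twist t g x + of_nat j * B (twist t g) x"
        by (rule Suc.IH[OF twist_embedding[OF Suc.prems(1) g] Suc.prems(2)])
      also have "\<dots> = t x + of_nat (Suc j) * B t x"
        unfolding BB[OF Suc.prems] by (simp add: B_def algebra_simps)
      finally show ?case .
    qed simp
    have "((\<lambda>t. twist t g) ^^ q) t = t"
      using twist_pow_GL[OF g less.prems(3), of q] twist_gunit[OF less.prems(3)] q(1) by simp
    then have "of_nat q * B t x = 0" using pow[OF less.prems(3,2), of q] by simp
    moreover have "of_nat q \<noteq> (0 :: 'a alg_closure)"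
      using q(2) CHAR_eq by (simp add: of_nat_eq_0_iff_char_dvd)
    ultimately show ?thesis by (simp add: B_def)
  qed
qed

lemma degree_prime_power:
  assumes triv: "nontrivial_part \<subseteq> {0}"
  shows "\<exists>k. n = p ^ k"
proof -
  have "q = p" if q: "prime q" "q dvd n" for q :: nat
  proof (rule ccontr)
    assume "q \<noteq> p"
    interpret G: group GL by (rule group_GL)
    have cG: "carrier GL = grouplikes" "\<one>\<^bsub>GL\<^esub> = gunit" by (simp_all add: GL_def)
    \<comment> \<open>Exponent 1 makes Sylow's theorem yield a subgroup of order q, as in Cauchy's
      theorem.\<close>
    have "Coset.order GL = q ^ 1 * (n div q)" using q by (simp add: Coset.order_def cG card_grouplikes)
    then obtain H where H: "subgroup H GL" "card H = q ^ 1"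
      using sylow_thm[OF q(1) group_GL, of 1 "n div q"] card_grouplikes by (auto simp: cG)
    have "card H > 1" using H q prime_gt_1_nat by simp
    then have "\<not> H \<subseteq> {gunit}" using card_mono[of "{gunit}" H] by auto
    then obtain g where g: "g \<in> H" "g \<noteq> gunit" by blast
    interpret SG: group "GL\<lparr>carrier := H\<rparr>" by (rule subgroup.subgroup_is_group[OF H(1) group_GL])
    have "g [^]\<^bsub>GL\<lparr>carrier := H\<rparr>\<^esub> Coset.order (GL\<lparr>carrier := H\<rparr>) = \<one>\<^bsub>GL\<lparr>carrier := H\<rparr>\<^esub>"
      using g by (intro SG.pow_order_eq_1) simp
    then have "g [^]\<^bsub>GL\<lparr>carrier := H\<rparr>\<^esub> q = gunit" using H(2) by (simp add: Coset.order_def cG)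
    then have gq: "g [^]\<^bsub>GL\<^esub> q = gunit" using G.nat_pow_consistent[of g q H] by simp
    have gG: "g \<in> grouplikes" using subgroup.subset[OF H(1)] g cG by blast
    have "\<not> p dvd q" using q p \<open>q \<noteq> p\<close> primes_dvd_imp_eq by blast
    then have "twist t g = twist t gunit" if "t \<in> X_emb" for t
      unfolding twist_gunit[OF that]
      using twist_unipotent_trivial[OF triv gG gq, of UNIV _ t] that
      by (intro ext) (simp add: submodule_def k_subspace_UNIV)
    then have "g = gunit" by (intro grouplike_eqI gG gunit_closed)
    with g show False by simp
  qed
  then have "prime_factors n \<subseteq> {p}" by (auto simp: prime_factors_dvd)
  then have "(\<Prod>q\<in>prime_factors n. q ^ multiplicity q n) = (\<Prod>q\<in>{p}. q ^ multiplicity q n)"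
    by (intro prod.mono_neutral_left) (auto simp: prime_factors_multiplicity p(1))
  then have "n = p ^ multiplicity p n" using prime_factorization_nat[OF degree_pos] by simp
  then show ?thesis by blast
qed

end

subsection \<open>Valuations and the different\<close>

locale valued_extension = separable_extension K n
  for K :: "'a::field set" and n :: nat +
  fixes v :: "'a \<Rightarrow> int"
  assumes valuation: "normalised_discrete_valuation v" and nontriv: "nontrivial_on v K"
    and fin: "finite_over (val_ring v \<inter> K) (val_ring v)"
begin

lemma v_mult: "x \<noteq> 0 \<Longrightarrow> y \<noteq> 0 \<Longrightarrow> v (x * y) = v x + v y"
  and v_add: "x \<noteq> 0 \<Longrightarrow> y \<noteq> 0 \<Longrightarrow> x + y \<noteq> 0 \<Longrightarrow> min (v x) (v y) \<le> v (x + y)"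
  and v_surj: "\<exists>x. x \<noteq> 0 \<and> v x = k"
  using valuation unfolding normalised_discrete_valuation_def by blast+

text \<open>The relation v x \<ge> k under the convention that 0 has infinite valuation;
  \<open>v 0\<close> itself is arbitrary.\<close>

definition vge :: "int \<Rightarrow> 'a \<Rightarrow> bool" where
  "vge k x \<longleftrightarrow> x = 0 \<or> k \<le> v x"

lemma val_ring_eq: "val_ring v = {x. vge 0 x}"
  by (simp add: val_ring_def vge_def)

lemma v_one: "v 1 = 0"
  using v_mult[of 1 1] by simp

lemma v_inverse: "x \<noteq> 0 \<Longrightarrow> v (inverse x) = - v x"
  using v_mult[of x "inverse x"] v_one by simp

lemma v_divide: "x \<noteq> 0 \<Longrightarrow> y \<noteq> 0 \<Longrightarrow> v (x / y) = v x - v y"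
  using v_mult[of x "inverse y"] v_inverse[of y] by (simp add: divide_inverse)

lemma v_minus: "v (- x) = v x"
proof (cases "x = 0")
  case False
  have "v (- 1) = 0" using v_mult[of "- 1" "- 1"] v_one by simp
  then show ?thesis using v_mult[of "- 1" x] False by simp
qed simp

lemma v_power: "x \<noteq> 0 \<Longrightarrow> v (x ^ j) = int j * v x"
  by (induction j) (simp_all add: v_one v_mult algebra_simps)

lemma v_power_int: "x \<noteq> 0 \<Longrightarrow> v (x powi j) = j * v x"
  by (cases "j \<ge> 0") (simp_all add: power_int_def v_power v_inverse)

lemma vge_0 [simp]: "vge k 0"
  by (simp add: vge_def)

lemma vge_mono: "vge k x \<Longrightarrow> k' \<le> k \<Longrightarrow> vge k' x"
  by (auto simp: vge_def)

lemma vge_add: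
  assumes "vge k x" "vge k y"
  shows "vge k (x + y)"
proof (cases "x = 0 \<or> y = 0 \<or> x + y = 0")
  case False
  then show ?thesis using v_add[of x y] assms by (simp add: vge_def)
qed (use assms in \<open>auto simp: vge_def\<close>)

lemma vge_minus: "vge k (- x) \<longleftrightarrow> vge k x"
  by (simp add: vge_def v_minus)

lemma vge_diff: "vge k x \<Longrightarrow> vge k y \<Longrightarrow> vge k (x - y)"
  using vge_add[of k x "- y"] by (simp add: vge_minus)

lemma vge_mult: "vge k x \<Longrightarrow> vge l y \<Longrightarrow> vge (k + l) (x * y)"
  by (cases "x = 0 \<or> y = 0") (auto simp: vge_def v_mult)

lemma vge_divide: "vge k x \<Longrightarrow> y \<noteq> 0 \<Longrightarrow> vge (k - v y) (x / y)"
  by (cases "x = 0") (auto simp: vge_def v_divide)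

lemma vge_sum: "(\<And>i. i \<in> A \<Longrightarrow> vge k (f i)) \<Longrightarrow> vge k (sum f A)"
  by (induction A rule: infinite_finite_induct) (auto intro: vge_add)

lemma vge_power:
  assumes "vge 1 x"
  shows "vge (int j) (x ^ j)"
proof (cases "x = 0")
  case False
  then show ?thesis using assms mult_left_mono[of 1 "v x" "int j"] by (simp add: vge_def v_power)
qed (cases j; simp add: vge_def v_one)

lemma v_add_eq:
  assumes "x \<noteq> 0" "vge (v x + 1) y"
  shows "x + y \<noteq> 0" "v (x + y) = v x"
proof -
  have not: "\<not> vge (v x + 1) x" using assms(1) by (simp add: vge_def)
  have xy: "\<not> vge (v x + 1) (x + y)"
    using vge_diff[of "v x + 1" "x + y" y] assms(2) not by auto
  then show "x + y \<noteq> 0" by auto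
  have "vge (v x) x" by (simp add: vge_def)
  moreover have "vge (v x) y" using assms(2) by (rule vge_mono) simp
  ultimately have "vge (v x) (x + y)" by (rule vge_add)
  with xy \<open>x + y \<noteq> 0\<close> show "v (x + y) = v x" by (simp add: vge_def)
qed

lemma v_sum_distinct:
  assumes "finite A" "A \<noteq> {}" "\<And>i. i \<in> A \<Longrightarrow> f i \<noteq> 0" "inj_on (\<lambda>i. v (f i)) A"
  shows "sum f A \<noteq> 0 \<and> (\<exists>i\<in>A. v (sum f A) = v (f i))"
  using assms
proof (induction A rule: finite_ne_induct)
  case (singleton x)
  then show ?case by simp
next
  case (insert a A)
  then have IH: "sum f A \<noteq> 0" and "\<exists>i\<in>A. v (sum f A) = v (f i)"
    by (auto simp: inj_on_insert)
  then obtain i where i: "i \<in> A" "v (sum f A) = v (f i)" by blast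
  have "f a \<noteq> 0" using insert.prems by simp
  have "v (f i) \<noteq> v (f a)" using insert.prems(2) i(1) insert.hyps by (auto simp: inj_on_def)
  then consider "v (f a) < v (sum f A)" | "v (sum f A) < v (f a)" using i by linarith
  then show ?case
  proof cases
    case 1
    then have "f a + sum f A \<noteq> 0" "v (f a + sum f A) = v (f a)"
      using v_add_eq[OF \<open>f a \<noteq> 0\<close>, of "sum f A"] by (auto simp: vge_def)
    then show ?thesis using insert.hyps by simp
  next
    case 2
    then have "sum f A + f a \<noteq> 0" "v (sum f A + f a) = v (sum f A)"
      using v_add_eq[OF IH, of "f a"] by (auto simp: vge_def)
    then show ?thesis using insert.hyps i by (auto simp: add.commute)
  qed
qed

abbreviation "e \<equiv> ram_index v K"

lemma ram_index_pos: "e > 0"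
  and uniformizer_exists: "\<exists>x\<in>K. x \<noteq> 0 \<and> v x = int e"
proof -
  obtain x where x: "x \<in> K" "x \<noteq> 0" "v x \<noteq> 0" using nontriv by (auto simp: nontrivial_on_def)
  have "\<exists>e. 0 < e \<and> (\<exists>x\<in>K. x \<noteq> 0 \<and> v x = int e)"
  proof (cases "v x > 0")
    case True
    with x show ?thesis by (intro exI[of _ "nat (v x)"]) auto
  next
    case False
    with x have "inverse x \<in> K \<and> inverse x \<noteq> 0 \<and> v (inverse x) = int (nat (- v x))"
      by (auto simp: v_inverse intro: subfieldD(6)[OF K])
    moreover have "0 < nat (- v x)" using False x by simp
    ultimately show ?thesis by blast
  qed
  from LeastI_ex[OF this] have *: "0 < e \<and> (\<exists>x\<in>K. x \<noteq> 0 \<and> v x = int e)"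
    unfolding ram_index_def .
  show "e > 0" by (rule conjunct1[OF *])
  show "\<exists>x\<in>K. x \<noteq> 0 \<and> v x = int e" by (rule conjunct2[OF *])
qed

definition \<pi> :: 'a where
  "\<pi> = (SOME x. x \<in> K \<and> x \<noteq> 0 \<and> v x = int e)"

lemma \<pi>: "\<pi> \<in> K" "\<pi> \<noteq> 0" "v \<pi> = int e"
proof -
  have "\<exists>x. x \<in> K \<and> x \<noteq> 0 \<and> v x = int e" using uniformizer_exists by blast
  from someI_ex[OF this] show "\<pi> \<in> K" "\<pi> \<noteq> 0" "v \<pi> = int e" unfolding \<pi>_def by blast+
qed

lemma \<pi>_nonzero [simp]: "\<pi> \<noteq> 0"
  by (rule \<pi>(2))

lemma \<pi>_powi: "\<pi> powi j \<in> K" "\<pi> powi j \<noteq> 0" "v (\<pi> powi j) = j * int e"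
  by (simp_all add: subfield_power_int[OF K] v_power_int \<pi>(1,3))

text \<open>Removing a power of the uniformiser of K reduces v c modulo e; a nonzero remainder would
  contradict the minimality of e.\<close>

lemma ram_index_dvd:
  assumes "c \<in> K" "c \<noteq> 0"
  shows "int e dvd v c"
proof (rule ccontr)
  assume nd: "\<not> int e dvd v c"
  define d where "d = c * \<pi> powi (- (v c div int e))"
  have d: "d \<in> K" "d \<noteq> 0" using assms \<pi>_powi by (auto simp: d_def intro: subfieldD(4)[OF K])
  have "v d = v c mod int e"
    using assms \<pi>_powi(2) by (simp add: d_def v_mult \<pi>_powi(3) minus_div_mult_eq_mod)
  moreover have "v c mod int e \<noteq> 0" using nd by (simp add: mod_eq_0_iff_dvd)
  moreover have "0 \<le> v c mod int e" "v c mod int e < int e" using ram_index_pos by simp_all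
  ultimately have "0 < v d" "v d < int e" by linarith+
  then have "nat (v d) < e" "0 < nat (v d)" "v d = int (nat (v d))" by (simp_all add: nat_less_iff)
  then show False using not_less_Least[of "nat (v d)"] d unfolding ram_index_def by blast
qed

text \<open>On S the values of f are bounded below by those at finitely many generators over R.
  Scaling by powers of the uniformiser extends the bound to L, which makes every functional
  continuous.\<close>

lemma k_functional_bounded:
  assumes f: "k_linear K f" "range f \<subseteq> K"
  shows "\<exists>C. \<forall>k x. vge k x \<longrightarrow> vge (k - C) (f x)"
proof -
  obtain r g where g: "\<And>i. i < r \<Longrightarrow> g i \<in> val_ring v"
    and S: "val_ring v = {y. \<exists>c. (\<forall>i<r. c i \<in> val_ring v \<inter> K) \<and> y = (\<Sum>i<(r::nat). c i * g i)}"
    using fin unfolding finite_over_def by blast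
  define M where "M = - (\<Sum>i<r. \<bar>v (f (g i))\<bar>)"
  have M: "vge M (f (g i))" if "i < r" for i
  proof -
    have "\<bar>v (f (g i))\<bar> \<le> (\<Sum>i<r. \<bar>v (f (g i))\<bar>)" using that by (intro member_le_sum) auto
    then have "M \<le> v (f (g i))" unfolding M_def by linarith
    then show ?thesis by (simp add: vge_def)
  qed
  have fS: "vge M (f x)" if x: "vge 0 x" for x
  proof -
    have "x \<in> val_ring v" using x by (simp add: val_ring_eq)
    then have "x \<in> {y. \<exists>c. (\<forall>i<r. c i \<in> val_ring v \<inter> K) \<and> y = (\<Sum>i<r. c i * g i)}"
      by (rule S[THEN equalityD1, THEN subsetD])
    then obtain c where c: "\<forall>i<r. c i \<in> val_ring v \<inter> K" "x = (\<Sum>i<r. c i * g i)" by blast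
    have "f x = (\<Sum>i<r. c i * f (g i))"
      unfolding c(2) k_linear_sum(2)[OF f(1)] using c(1)
      by (intro sum.cong refl) (simp add: k_linearD(2)[OF f(1)])
    moreover have "vge M (c i * f (g i))" if "i < r" for i
      using vge_mult[of 0 "c i" M "f (g i)"] c(1) M that by (simp add: val_ring_eq)
    ultimately show ?thesis by (auto intro!: vge_sum)
  qed
  have "vge (k - (int e - M)) (f x)" if x: "vge k x" for k x
  proof -
    \<comment> \<open>Valuations can be shifted by elements of K only in steps of e; the remainder
      of k modulo e is why e enters the bound.\<close>
    define q where "q = k div int e"
    have "vge (- q * int e) (\<pi> powi (- q))" using \<pi>_powi(3)[of "- q"] by (simp add: vge_def)
    then have "vge (- q * int e + k) (\<pi> powi (- q) * x)" using x by (rule vge_mult)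
    moreover have kq: "- q * int e + k = k mod int e"
      by (simp add: q_def minus_div_mult_eq_mod[symmetric])
    ultimately have "vge 0 (\<pi> powi (- q) * x)" using ram_index_pos by (auto intro: vge_mono)
    then have "vge M (f (\<pi> powi (- q) * x))" by (rule fS)
    moreover have "vge (q * int e) (\<pi> powi q)" using \<pi>_powi(3)[of q] by (simp add: vge_def)
    ultimately have "vge (q * int e + M) (\<pi> powi q * f (\<pi> powi (- q) * x))" by (intro vge_mult)
    also have "\<pi> powi q * f (\<pi> powi (- q) * x) = f (\<pi> powi q * (\<pi> powi (- q) * x))"
      by (rule k_linearD(2)[OF f(1) \<pi>_powi(1), symmetric])
    also have "\<pi> powi q * (\<pi> powi (- q) * x) = x" using \<pi>_powi(2) by (simp add: power_int_minus)
    finally show ?thesis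
      by (rule vge_mono) (use kq pos_mod_bound[of "int e" k] ram_index_pos in linarith)
  qed
  then show ?thesis by blast
qed

lemma different_exponent:
  obtains k\<^sub>0 y where "different_val v K = - k\<^sub>0" "\<And>x. vge k\<^sub>0 x \<Longrightarrow> vge 0 (field_trace K x)"
    "y \<noteq> 0" "v y = k\<^sub>0 - 1" "field_trace K y \<noteq> 0" "v (field_trace K y) = - int e"
proof -
  define Z where "Z k \<longleftrightarrow> (\<forall>x. vge k x \<longrightarrow> vge 0 (field_trace K x))" for k
  obtain C where C: "\<And>k x. vge k x \<Longrightarrow> vge (k - C) (field_trace K x)"
    using k_functional_bounded[OF field_trace_linear(1)[OF K deg]] trace_in by blast
  have ZC: "Z C" unfolding Z_def using C[of C] by simp
  have Z_mono: "Z k \<Longrightarrow> k \<le> k' \<Longrightarrow> Z k'" for k k' unfolding Z_def using vge_mono by blast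
  obtain z where z: "field_trace K z \<noteq> 0" using field_trace_nonzero by blast
  \<comment> \<open>Large enough that scaling z by the power -N of the uniformiser makes its trace
    nonintegral; this is where the search for the threshold starts.\<close>
  define N where "N = \<bar>v (field_trace K z)\<bar> + 1"
  define k\<^sub>1 where "k\<^sub>1 = v (\<pi> powi (- N) * z)"
  have "\<not> Z k\<^sub>1"
  proof
    assume "Z k\<^sub>1"
    moreover have "vge k\<^sub>1 (\<pi> powi (- N) * z)" by (simp add: vge_def k\<^sub>1_def)
    ultimately have "vge 0 (\<pi> powi (- N) * field_trace K z)"
      unfolding Z_def trace_scale[OF \<pi>_powi(1), symmetric] by blast
    then have "0 \<le> - N * int e + v (field_trace K z)"
      using z \<pi>_powi(2) v_mult[OF \<pi>_powi(2)[of "- N"] z] \<pi>_powi(3)[of "- N"]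
      by (auto simp: vge_def)
    moreover have "N * 1 \<le> N * int e" using ram_index_pos by (intro mult_left_mono) (auto simp: N_def)
    ultimately have "N \<le> v (field_trace K z)" by simp
    then show False unfolding N_def by linarith
  qed
  define j where "j = (LEAST j. Z (k\<^sub>1 + int j))"
  have "Z (k\<^sub>1 + int (nat (C - k\<^sub>1)))" using Z_mono[OF ZC] by simp
  then have j: "Z (k\<^sub>1 + int j)" unfolding j_def by (rule LeastI)
  then have "j > 0" using \<open>\<not> Z k\<^sub>1\<close> by (cases j) auto
  define k\<^sub>0 where "k\<^sub>0 = k\<^sub>1 + int j"
  have Z0: "Z k\<^sub>0" using j by (simp add: k\<^sub>0_def)
  have "\<not> Z (k\<^sub>1 + int (j - 1))" using \<open>j > 0\<close> unfolding j_def by (intro not_less_Least) simp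
  then have nZ: "\<not> Z (k\<^sub>0 - 1)" using \<open>j > 0\<close> by (simp add: k\<^sub>0_def of_nat_diff algebra_simps)
  then obtain y where y: "vge (k\<^sub>0 - 1) y" "\<not> vge 0 (field_trace K y)" by (auto simp: Z_def)
  have "\<not> vge k\<^sub>0 y" using Z0 y(2) by (auto simp: Z_def)
  with y(1) have vy: "y \<noteq> 0" "v y = k\<^sub>0 - 1" by (auto simp: vge_def)
  have tr_neg: "field_trace K y \<noteq> 0" "v (field_trace K y) < 0" using y(2) by (auto simp: vge_def)
  have "vge k\<^sub>0 (\<pi> * y)" using vy \<pi> ram_index_pos by (simp add: vge_def v_mult)
  then have "vge 0 (\<pi> * field_trace K y)"
    using Z0 unfolding Z_def trace_scale[OF \<pi>(1), symmetric] by blast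
  then have "0 \<le> int e + v (field_trace K y)" using \<pi> tr_neg by (auto simp: vge_def v_mult)
  moreover obtain d where d: "v (field_trace K y) = int e * d"
    using ram_index_dvd[OF trace_in tr_neg(1)] by (auto elim: dvdE)
  ultimately have "int e * d \<ge> int e * (- 1)" "int e * d < int e * 0" using tr_neg(2) by simp_all
  then have "d \<ge> - 1" "d < 0" using ram_index_pos by (simp_all only: mult_le_cancel_left_pos mult_less_cancel_left_pos of_nat_0_less_iff)
  then have "d = - 1" by linarith
  then have tre: "v (field_trace K y) = - int e" using d by simp
  have inv: "inv_different v K = {x. x = 0 \<or> k\<^sub>0 \<le> v x}"
  proof (intro subset_antisym subsetI)
    fix x assume x: "x \<in> inv_different v K"
    show "x \<in> {x. x = 0 \<or> k\<^sub>0 \<le> v x}"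
    proof (rule ccontr)
      assume "\<not> ?thesis"
      then have x0: "x \<noteq> 0" "v x \<le> k\<^sub>0 - 1" by auto
      have "Z (v x)" unfolding Z_def
      proof (intro allI impI)
        fix z assume "vge (v x) z"
        then have "vge 0 (z / x)" using vge_divide[of "v x" z x] x0(1) by simp
        then have "field_trace K (x * (z / x)) \<in> val_ring v \<inter> K"
          using x unfolding inv_different_def val_ring_eq by blast
        then show "vge 0 (field_trace K z)" using x0 by (simp add: val_ring_eq)
      qed
      with Z_mono x0 nZ show False by blast
    qed
  next
    fix x assume "x \<in> {x. x = 0 \<or> k\<^sub>0 \<le> v x}"
    then have x: "vge k\<^sub>0 x" by (simp add: vge_def)
    show "x \<in> inv_different v K"
      unfolding inv_different_def
    proof (intro CollectI ballI IntI trace_in)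
      fix s assume "s \<in> val_ring v"
      then have "vge k\<^sub>0 (x * s)" using vge_mult[OF x, of 0 s] by (simp add: val_ring_eq)
      then show "field_trace K (x * s) \<in> val_ring v" using Z0 by (simp add: Z_def val_ring_eq)
    qed
  qed
  have "different_val v K = - k\<^sub>0" unfolding different_val_def
  proof (rule the_equality)
    show "inv_different v K = {x. x = 0 \<or> - (- k\<^sub>0) \<le> v x}" using inv by simp
    fix w assume w: "inv_different v K = {x. x = 0 \<or> - w \<le> v x}"
    \<comment> \<open>Elements lying exactly on the two thresholds show that the fractional ideal
      determines its exponent.\<close>
    obtain x where x: "x \<noteq> 0" "v x = k\<^sub>0" using v_surj by blast
    obtain x' where x': "x' \<noteq> 0" "v x' = - w" using v_surj by blast
    have "x \<in> {x. x = 0 \<or> - w \<le> v x}" "x' \<in> {x. x = 0 \<or> k\<^sub>0 \<le> v x}"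
      using x x' w inv by auto
    then show "w = - k\<^sub>0" using x x' by auto
  qed
  with Z0 vy tr_neg tre show ?thesis using that[of k\<^sub>0 y] unfolding Z_def by blast
qed

text \<open>Up to a power of the uniformiser, b lies strictly between v y and v y + e for the
  critical element y. An element x of that valuation has integral trace, so Tr x / Tr y has
  valuation at least e, and subtracting this multiple of y kills the trace without touching the
  valuation.\<close>

lemma trace_zero_other_class:
  assumes "\<not> int e dvd b - (- different_val v K - 1)"
  shows "\<exists>\<rho>. \<rho> \<noteq> 0 \<and> v \<rho> = b \<and> field_trace K \<rho> = 0"
proof -
  obtain k\<^sub>0 y where k0: "different_val v K = - k\<^sub>0" "\<And>x. vge k\<^sub>0 x \<Longrightarrow> vge 0 (field_trace K x)"
    and y: "y \<noteq> 0" "v y = k\<^sub>0 - 1" "field_trace K y \<noteq> 0" "v (field_trace K y) = - int e"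
    using different_exponent by metis
  define r where "r = (b - (k\<^sub>0 - 1)) mod int e"
  define q where "q = (b - (k\<^sub>0 - 1)) div int e"
  have b: "b = k\<^sub>0 - 1 + r + q * int e" by (simp add: r_def q_def minus_mod_eq_div_mult[symmetric])
  have "r \<noteq> 0" using assms by (simp add: r_def k0(1) mod_eq_0_iff_dvd)
  moreover have "0 \<le> r" "r < int e" using ram_index_pos by (simp_all add: r_def)
  ultimately have r: "0 < r" "r < int e" by linarith+
  obtain x where x: "x \<noteq> 0" "v x = k\<^sub>0 - 1 + r" using v_surj by blast
  define c where "c = field_trace K x / field_trace K y"
  have cK: "c \<in> K" unfolding c_def by (intro subfieldD(8)[OF K] trace_in)
  have "vge 0 (field_trace K x)" using x r by (intro k0(2)) (simp add: vge_def)
  then have "vge (int e) c" using vge_divide[OF _ y(3), of 0 "field_trace K x"] y(4) by (simp add: c_def)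
  moreover have "vge (k\<^sub>0 - 1) y" using y(2) by (simp add: vge_def)
  ultimately have "vge (int e + (k\<^sub>0 - 1)) (c * y)" by (rule vge_mult)
  then have "vge (v x + 1) (- (c * y))" unfolding vge_minus by (rule vge_mono) (use x r in simp)
  from v_add_eq[OF x(1) this] have x': "x - c * y \<noteq> 0" "v (x - c * y) = v x" by simp_all
  have "field_trace K (x - c * y) = 0"
    using y(3) by (simp add: trace_diff trace_scale[OF cK]) (simp add: c_def)
  then have "field_trace K (\<pi> powi q * (x - c * y)) = 0" by (simp add: trace_scale[OF \<pi>_powi(1)])
  moreover have "v (\<pi> powi q * (x - c * y)) = b"
    using x' x b by (simp add: v_mult \<pi>_powi(3))
  ultimately show ?thesis using x' \<pi>_powi(2) by (intro exI[of _ "\<pi> powi q * (x - c * y)"]) simp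
qed

text \<open>In the critical class the element y is multiplied by x - c, where c = Tr(x y) / Tr(y) is
  integral and lies in K. Since x is congruent to no element of K, the factor x - c is still a
  unit.\<close>

lemma trace_zero_residue_extension:
  assumes x: "x \<noteq> 0" "v x = 0" "\<And>c. c \<in> K \<Longrightarrow> \<not> vge 1 (x - c)"
  shows "\<exists>\<rho>. \<rho> \<noteq> 0 \<and> v \<rho> = b \<and> field_trace K \<rho> = 0"
proof (cases "int e dvd b - (- different_val v K - 1)")
  case False
  then show ?thesis by (rule trace_zero_other_class)
next
  case True
  obtain k\<^sub>0 y where k0: "different_val v K = - k\<^sub>0" "\<And>x. vge k\<^sub>0 x \<Longrightarrow> vge 0 (field_trace K x)"
    and y: "y \<noteq> 0" "v y = k\<^sub>0 - 1" "field_trace K y \<noteq> 0" "v (field_trace K y) = - int e"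
    using different_exponent by metis
  obtain q where "b - (- different_val v K - 1) = int e * q" using True by (auto elim: dvdE)
  then have q: "b = k\<^sub>0 - 1 + int e * q" by (simp add: k0(1))
  define c where "c = field_trace K (x * y) / field_trace K y"
  have cK: "c \<in> K" unfolding c_def by (intro subfieldD(8)[OF K] trace_in)
  have "vge k\<^sub>0 (\<pi> * (x * y))" using x y \<pi> ram_index_pos by (simp add: vge_def v_mult)
  then have "vge 0 (\<pi> * field_trace K (x * y))"
    using k0(2) by (simp add: trace_scale[OF \<pi>(1), symmetric])
  then have "vge (- int e) (field_trace K (x * y))"
    using \<pi> by (cases "field_trace K (x * y) = 0") (auto simp: vge_def v_mult)
  then have "vge 0 c"
    using vge_divide[OF _ y(3), of "- int e" "field_trace K (x * y)"] y(4) by (simp add: c_def)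
  moreover have "vge 0 x" using x by (simp add: vge_def)
  ultimately have "vge 0 (x - c)" by (intro vge_diff)
  with x(3)[OF cK] have xc: "x - c \<noteq> 0" "v (x - c) = 0" by (auto simp: vge_def)
  have "field_trace K ((x - c) * y) = 0"
    using y(3) by (simp add: left_diff_distrib trace_diff trace_scale[OF cK]) (simp add: c_def)
  then have "field_trace K (\<pi> powi q * ((x - c) * y)) = 0" by (simp add: trace_scale[OF \<pi>_powi(1)])
  moreover have "v (\<pi> powi q * ((x - c) * y)) = b"
    using xc y q by (simp add: v_mult \<pi>_powi(3) mult.commute[of q])
  ultimately show ?thesis using xc y(1) \<pi>_powi(2) by (intro exI[of _ "\<pi> powi q * ((x - c) * y)"]) simp
qed

section \<open>Trivial residue extension: approximation by elements of K\<close>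

definition residue_trivial :: bool where
  "residue_trivial \<longleftrightarrow> (\<forall>x. x \<noteq> 0 \<longrightarrow> v x = 0 \<longrightarrow> (\<exists>c\<in>K. vge 1 (x - c)))"

lemma approximate_same_class:
  assumes res: residue_trivial and x: "x \<noteq> 0" and z: "z \<noteq> 0" and dv: "int e dvd v x - v z"
  shows "\<exists>c\<in>K. vge (v x + 1) (x - c * z)"
proof -
  obtain q where q: "v x - v z = int e * q" using dv by (auto elim: dvdE)
  define t where "t = \<pi> powi q * z"
  have t: "t \<noteq> 0" "v t = v x" using z q by (simp_all add: t_def v_mult \<pi>_powi(3) mult.commute[of q])
  then have "x / t \<noteq> 0" "v (x / t) = 0" using x by (simp_all add: v_divide)
  then obtain c where c: "c \<in> K" "vge 1 (x / t - c)"
    using res unfolding residue_trivial_def by blast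
  have "vge (1 + v x) ((x / t - c) * t)" using c(2) t by (intro vge_mult) (simp_all add: vge_def)
  moreover have "(x / t - c) * t = x - c * \<pi> powi q * z" using t by (simp add: left_diff_distrib t_def)
  moreover have "c * \<pi> powi q \<in> K" by (intro subfieldD(4)[OF K] c(1) \<pi>_powi(1))
  ultimately show ?thesis by (metis add.commute)
qed

text \<open>Successive approximation without completeness. If z were not in the span, a functional f
  would vanish on the span with f z = 1. Boundedness of f limits the valuations on the set f = 1, so
  some x in U attains the largest; subtracting a K-multiple of the representative of its class
  raises the valuation and keeps f x = 1.\<close>

lemma spanned_by_class_representatives:
  assumes res: residue_trivial and U: "k_subspace K U" and I: "finite I" "\<And>i. i \<in> I \<Longrightarrow> w i \<in> U"
    and cl: "\<And>x. x \<in> U \<Longrightarrow> x \<noteq> 0 \<Longrightarrow> \<exists>i\<in>I. w i \<noteq> 0 \<and> int e dvd v x - v (w i)"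
    and z: "z \<in> U"
  shows "\<exists>c. (\<forall>i\<in>I. c i \<in> K) \<and> z = (\<Sum>i\<in>I. c i * w i)"
proof -
  define W where "W = {x. \<exists>c. (\<forall>i\<in>I. c i \<in> K) \<and> x = (\<Sum>i\<in>I. c i * w i)}"
  have W: "k_subspace K W"
    unfolding k_subspace_def
  proof (intro conjI ballI)
    show "0 \<in> W" unfolding W_def using subfieldD(1)[OF K] by (intro CollectI exI[of _ "\<lambda>_. 0"]) simp
  next
    fix x y assume "x \<in> W" "y \<in> W"
    then obtain c d where *: "\<forall>i\<in>I. c i \<in> K" "x = (\<Sum>i\<in>I. c i * w i)" "\<forall>i\<in>I. d i \<in> K" "y = (\<Sum>i\<in>I. d i * w i)"
      unfolding W_def by blast
    then show "x + y \<in> W" unfolding W_def using subfieldD(3)[OF K]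
      by (intro CollectI exI[of _ "\<lambda>i. c i + d i"]) (simp add: distrib_right sum.distrib)
  next
    fix a x assume "a \<in> K" "x \<in> W"
    then obtain c where *: "a \<in> K" "\<forall>i\<in>I. c i \<in> K" "x = (\<Sum>i\<in>I. c i * w i)"
      unfolding W_def by blast
    then show "a * x \<in> W" unfolding W_def using subfieldD(4)[OF K]
      by (intro CollectI exI[of _ "\<lambda>i. a * c i"]) (simp add: sum_distrib_left mult.assoc)
  qed
  have wW: "c * w i \<in> W" if "i \<in> I" "c \<in> K" for c i
  proof -
    have "(\<Sum>j\<in>I. (if j = i then c else 0) * w j) = (\<Sum>j\<in>I. if j = i then c * w i else 0)"
      by (intro sum.cong) auto
    then show ?thesis unfolding W_def using that I(1) subfieldD(1)[OF K]
      by (intro CollectI exI[of _ "\<lambda>j. if j = i then c else 0"]) simp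
  qed
  have WU: "W \<subseteq> U" unfolding W_def using I(2)
    by (auto intro!: k_subspace_sum[OF U] k_subspaceD(3)[OF U])
  have "z \<in> W"
  proof (rule ccontr)
    assume "z \<notin> W"
    then obtain f where f: "k_linear K f" "range f \<subseteq> K" "\<forall>x\<in>W. f x = 0" "f z = 1"
      using separating_functional[OF K W] by blast
    obtain C where C: "\<And>k x. vge k x \<Longrightarrow> vge (k - C) (f x)" using k_functional_bounded[OF f(1,2)] by blast
    let ?P = "\<lambda>x. x \<in> U \<and> f x = 1"
    have bd: "x \<noteq> 0 \<and> v x \<le> C" if "f x = 1" for x
    proof -
      have "\<not> vge (C + 1) x" using C[of "C + 1" x] that by (auto simp: vge_def v_one)
      then show ?thesis by (auto simp: vge_def)
    qed
    have "?P z" using z f(4) by simp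
    \<comment> \<open>Minimal distance to the bound \<open>C\<close> means maximal valuation;
      \<open>nat\<close> loses nothing because of \<open>bd\<close>.\<close>
    then obtain x where x: "x \<in> U" "f x = 1" and min: "\<And>y. y \<in> U \<Longrightarrow> f y = 1 \<Longrightarrow> nat (C - v x) \<le> nat (C - v y)"
      using ex_has_least_nat[of ?P z "\<lambda>x. nat (C - v x)"] by blast
    obtain i where i: "i \<in> I" "w i \<noteq> 0" "int e dvd v x - v (w i)" using cl[OF x(1)] bd[OF x(2)] by blast
    obtain c where c: "c \<in> K" "vge (v x + 1) (x - c * w i)"
      using approximate_same_class[OF res _ i(2,3)] bd[OF x(2)] by blast
    have "x - c * w i \<in> U" using wW[OF i(1) c(1)] WU by (intro k_subspace_diff[OF K U x(1)]) blast
    moreover have fc: "f (x - c * w i) = 1"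
      using k_linear_sum(4)[OF f(1)] f(3) wW[OF i(1) c(1)] x(2) by simp
    ultimately have "nat (C - v x) \<le> nat (C - v (x - c * w i))" by (rule min)
    moreover have "v x + 1 \<le> v (x - c * w i)" "v (x - c * w i) \<le> C"
      using c(2) bd[OF fc] by (auto simp: vge_def)
    ultimately show False by simp
  qed
  then show ?thesis unfolding W_def by blast
qed

text \<open>Coefficients in K have valuation divisible by e, so nonzero terms from different classes
  have different valuations and cannot cancel.\<close>

lemma v_base_combination:
  assumes J: "finite J" and w: "\<And>j. j \<in> J \<Longrightarrow> w j \<noteq> 0"
    and dist: "\<And>i j. i \<in> J \<Longrightarrow> j \<in> J \<Longrightarrow> int e dvd v (w i) - v (w j) \<Longrightarrow> i = j"
    and c: "\<And>j. j \<in> J \<Longrightarrow> c j \<in> K" and nz: "\<exists>j\<in>J. c j \<noteq> 0"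
  shows "(\<Sum>j\<in>J. c j * w j) \<noteq> 0 \<and> (\<exists>j\<in>J. int e dvd v (\<Sum>j\<in>J. c j * w j) - v (w j))"
proof -
  define A where "A = {j \<in> J. c j \<noteq> 0}"
  have v: "v (c j * w j) = v (c j) + v (w j)" "int e dvd v (c j)" if "j \<in> A" for j
    using that w c by (auto simp: A_def v_mult ram_index_dvd)
  have "inj_on (\<lambda>j. v (c j * w j)) A"
  proof (rule inj_onI)
    fix i j assume ij: "i \<in> A" "j \<in> A" "v (c i * w i) = v (c j * w j)"
    then have "v (w i) - v (w j) = v (c j) - v (c i)" using v(1) by simp
    then have "int e dvd v (w i) - v (w j)" using v(2)[OF ij(1)] v(2)[OF ij(2)] by (simp add: dvd_diff)
    then show "i = j" using ij dist by (auto simp: A_def)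
  qed
  then have "(\<Sum>j\<in>A. c j * w j) \<noteq> 0 \<and> (\<exists>j\<in>A. v (\<Sum>j\<in>A. c j * w j) = v (c j * w j))"
    using J nz w by (intro v_sum_distinct) (auto simp: A_def)
  moreover have "(\<Sum>j\<in>J. c j * w j) = (\<Sum>j\<in>A. c j * w j)"
    using J by (intro sum.mono_neutral_right) (auto simp: A_def)
  ultimately obtain j where j: "j \<in> A" "(\<Sum>j\<in>J. c j * w j) \<noteq> 0" "v (\<Sum>j\<in>J. c j * w j) = v (c j * w j)"
    by auto
  then have "int e dvd v (\<Sum>j\<in>J. c j * w j) - v (w j)" using v[OF j(1)] by simp
  with j show ?thesis by (auto simp: A_def)
qed

lemma dvd_diff_less_imp_eq:
  assumes "i < k" "j < k" "int k dvd int i - int j"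
  shows "i = j"
proof -
  have "int i mod int k = int j mod int k" using assms(3) by (simp add: mod_eq_dvd_iff)
  then show ?thesis using assms(1,2) by simp
qed

text \<open>Elements of valuation 0, ..., e - 1 meet every class modulo e once and therefore form a
  K-basis of L.\<close>

lemma ram_index_eq_degree:
  assumes res: residue_trivial
  shows "e = n"
proof -
  have "\<forall>i. \<exists>x. x \<noteq> 0 \<and> v x = int i" using v_surj by blast
  then obtain w where w: "\<And>i. w i \<noteq> 0" "\<And>i. v (w i) = int i" by metis
  have "k_lin_indep K w e"
    unfolding k_lin_indep_def
  proof (intro allI impI)
    fix c i assume c: "\<forall>i<e. c i \<in> K" "(\<Sum>i<e. c i * w i) = 0" "i < e"
    show "c i = 0"
    proof (rule ccontr)
      assume "c i \<noteq> 0"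
      then have "(\<Sum>i<e. c i * w i) \<noteq> 0 \<and> (\<exists>j\<in>{..<e}. int e dvd v (\<Sum>i<e. c i * w i) - v (w j))"
        using c w dvd_diff_less_imp_eq by (intro v_base_combination) auto
      with c show False by simp
    qed
  qed
  moreover have "\<exists>c. (\<forall>i\<in>{..<e}. c i \<in> K) \<and> z = (\<Sum>i<e. c i * w i)" for z
  proof (rule spanned_by_class_representatives[OF res k_subspace_UNIV])
    fix x :: 'a assume "x \<noteq> 0"
    have "nat (v x mod int e) < e" using ram_index_pos by (simp add: nat_less_iff)
    moreover have "int e dvd v x - int (nat (v x mod int e))" using ram_index_pos by simp
    ultimately show "\<exists>i\<in>{..<e}. w i \<noteq> 0 \<and> int e dvd v x - v (w i)"
      using w by (intro bexI[of _ "nat (v x mod int e)"]) auto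
  qed simp_all
  ultimately have "k_basis K w e" by (simp add: k_basis_def k_spans_def Ball_def)
  then have "ext_degree_is K e" unfolding ext_degree_is_def by blast
  then show ?thesis using deg by (rule ext_degree_unique[OF K])
qed

lemma trace_nonzero_class:
  assumes res: residue_trivial and x: "x \<noteq> 0" "int e dvd v x - (- different_val v K - 1)"
  shows "field_trace K x \<noteq> 0"
proof
  assume tr0: "field_trace K x = 0"
  obtain k\<^sub>0 y where k0: "different_val v K = - k\<^sub>0" "\<And>x. vge k\<^sub>0 x \<Longrightarrow> vge 0 (field_trace K x)"
    and y: "y \<noteq> 0" "v y = k\<^sub>0 - 1" "field_trace K y \<noteq> 0" "v (field_trace K y) = - int e"
    using different_exponent by metis
  obtain c where c: "c \<in> K" "vge (v x + 1) (x - c * y)"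
    using approximate_same_class[OF res x(1) y(1)] x(2) k0(1) y(2) by auto
  have "vge (v x + 1) (- (x - c * y))" unfolding vge_minus by (rule c(2))
  from v_add_eq[OF x(1) this] have "c * y \<noteq> 0" "v (c * y) = v x" by simp_all
  then have c0: "c \<noteq> 0" and vc: "v c = v x - (k\<^sub>0 - 1)" using y by (auto simp: v_mult)
  have ic: "inverse c \<in> K" by (rule subfieldD(6)[OF K c(1)])
  have "vge (- v c + (v x + 1)) (inverse c * (x - c * y))"
    using c(2) c0 by (intro vge_mult) (auto simp: vge_def v_inverse)
  then have "vge 0 (field_trace K (inverse c * (x - c * y)))" using vc by (intro k0(2)) simp
  moreover have "field_trace K (inverse c * (x - c * y)) = - field_trace K y"
    using tr0 c0 by (simp add: trace_scale[OF ic] trace_diff trace_scale[OF c(1)])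
  ultimately show False using y ram_index_pos by (simp add: vge_minus) (simp add: vge_def)
qed

end

section \<open>Elements of prescribed valuation that do not generate\<close>

locale hopf_galois_valued = hopf_galois_char_p K n m mu de u ep s act p + valued_extension K n v
  for K :: "'a::field set" and n m mu de u ep s act p v
begin

lemma not_generator_if_in_proper_submodule:
  assumes W: "submodule W" "W \<noteq> UNIV" and \<rho>: "\<rho> \<in> W"
  shows "\<not> normal_basis_gen K m act \<rho>"
proof
  assume "normal_basis_gen K m act \<rho>"
  then have sp: "\<exists>c. (\<forall>k<m. c k \<in> K) \<and> y = (\<Sum>k<m. c k * act k \<rho>)" for y
    by (simp add: normal_basis_gen_def k_basis_def k_spans_def)
  have "y \<in> W" for y
  proof -
    obtain c where c: "\<forall>k<m. c k \<in> K" "y = (\<Sum>k<m. c k * act k \<rho>)" using sp by blast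
    show ?thesis unfolding c(2) using c(1) submoduleD(2)[OF W(1) ops_act \<rho>]
      by (intro k_subspace_sum[OF submoduleD(1)[OF W(1)]] submoduleD(6)[OF W(1)]) auto
  qed
  with W(2) show False by blast
qed

lemma trace_zero_not_generator:
  assumes "field_trace K \<rho> = 0"
  shows "\<not> normal_basis_gen K m act \<rho>"
proof (rule not_generator_if_in_proper_submodule)
  show "submodule {x. field_trace K x = 0}"
    by (auto simp: submodule_def k_subspace_def trace_0 trace_add trace_scale trace_ops)
  show "{x. field_trace K x = 0} \<noteq> UNIV" using field_trace_nonzero by blast
  show "\<rho> \<in> {x. field_trace K x = 0}" using assms by simp
qed

text \<open>If \<open>u = 1 + z\<close> lies in the submodule then so does \<open>u ^ p ^ j = 1 + z ^ p ^ j\<close>, which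
  tends to 1; finite dimensional subspaces are closed.\<close>
lemma nontrivial_part_avoids_base_class:
  assumes res: residue_trivial and x: "x \<in> nontrivial_part" "x \<noteq> 0"
  shows "\<not> int e dvd v x"
proof
  assume "int e dvd v x"
  note V = submodule_nontrivial_part
  obtain c where c: "c \<in> K" "vge (v x + 1) (x - c)"
    using approximate_same_class[OF res x(2), of 1] \<open>int e dvd v x\<close> v_one by auto
  have "vge (v x + 1) (- (x - c))" unfolding vge_minus by (rule c(2))
  from v_add_eq[OF x(2) this] have c0: "c \<noteq> 0" "v c = v x" by simp_all
  \<comment> \<open>The error after scaling x to be congruent to 1.\<close>
  define z where "z = inverse c * (x - c)"
  have "vge (- v c + (v x + 1)) z"
    unfolding z_def using c(2) c0 by (intro vge_mult) (auto simp: vge_def v_inverse)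
  then have z: "vge 1 z" using c0 by simp
  have "inverse c * x \<in> nontrivial_part"
    by (rule submoduleD(6)[OF V subfieldD(6)[OF K c(1)] x(1)])
  moreover have "inverse c * x = 1 + z" using c0 by (simp add: z_def right_diff_distrib)
  ultimately have base: "1 + z \<in> nontrivial_part" by simp
  have pow: "1 + z ^ p ^ j \<in> nontrivial_part" for j
  proof (induction j)
    case 0
    then show ?case using base by simp
  next
    case (Suc j)
    have "(1 + z ^ p ^ j) ^ p = 1 ^ p + (z ^ p ^ j) ^ p"
      by (rule freshmans_dream) (simp_all add: CHAR_eq p)
    also have "\<dots> = 1 + z ^ p ^ Suc j" by (simp only: power_mult[symmetric] power_Suc2 power_one)
    finally have "(1 + z ^ p ^ j) ^ p = 1 + z ^ p ^ Suc j" .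
    then show ?case using nontrivial_part_power_p[OF Suc.IH] by simp
  qed
  \<comment> \<open>This functional measures the distance from the subspace to 1: f takes the value
    -1 at all the powers of z, although boundedness makes these values arbitrarily small.\<close>
  obtain f where f: "k_linear K f" "range f \<subseteq> K" "\<forall>x\<in>nontrivial_part. f x = 0" "f 1 = 1"
    using separating_functional[OF K submoduleD(1)[OF V] one_notin_nontrivial_part] by blast
  obtain C where C: "\<And>k x. vge k x \<Longrightarrow> vge (k - C) (f x)" using k_functional_bounded[OF f(1,2)] by blast
  \<comment> \<open>Chosen so that p^j > j > C; \<open>C\<close> may be negative, hence
    \<open>nat\<close>.\<close>
  define j where "j = Suc (nat C)"
  have "f (1 + z ^ p ^ j) = 0" using f(3) pow by blast
  then have "f (z ^ p ^ j) = - 1" unfolding k_linearD(1)[OF f(1)] f(4) by (simp add: add_eq_0_iff)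
  moreover have "vge (int (p ^ j) - C) (f (z ^ p ^ j))" by (intro C vge_power z)
  ultimately have "vge (int (p ^ j) - C) 1" by (simp add: vge_minus)
  then have "int (p ^ j) \<le> C" by (simp add: vge_def v_one)
  moreover have "j < p ^ j" using prime_gt_1_nat[OF p(1)] by (intro power_gt_expt) simp
  then have "int j < int (p ^ j)" by (simp only: of_nat_less_iff)
  ultimately have "int j < C" by linarith
  then show False by (simp add: j_def split: if_splits)
qed

text \<open>The set \<open>C\<close> of classes occurring in the submodule omits 0, so one element
  of class k - j for each j in C and for j = 0 gives one more coefficient than there are conditions
  of orthogonality to the representatives \<open>w i\<close>. The valuation of a solution lies in
  one of these classes.\<close>

lemma orthogonal_element_in_critical_class:
  assumes res: residue_trivial
  shows "\<exists>\<rho>. \<rho> \<noteq> 0 \<and> int e dvd v \<rho> - (- different_val v K - 1) \<and> \<rho> \<in> trace_perp nontrivial_part"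
proof -
  note V = submodule_nontrivial_part
  define k where "k = - different_val v K - 1"
  define C where "C = {i. i < e \<and> (\<exists>x\<in>nontrivial_part. x \<noteq> 0 \<and> int e dvd v x - int i)}"
  have C: "finite C" "0 \<notin> C" using nontrivial_part_avoids_base_class[OF res] by (auto simp: C_def)
  have "\<forall>i. \<exists>x. i \<in> C \<longrightarrow> x \<in> nontrivial_part \<and> x \<noteq> 0 \<and> int e dvd v x - int i"
    unfolding C_def by blast
  then obtain w where w: "\<And>i. i \<in> C \<Longrightarrow> w i \<in> nontrivial_part" "\<And>i. i \<in> C \<Longrightarrow> w i \<noteq> 0"
    "\<And>i. i \<in> C \<Longrightarrow> int e dvd v (w i) - int i" by metis
  have "\<forall>j. \<exists>y. y \<noteq> 0 \<and> v y = k - int j" using v_surj by blast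
  then obtain y where y: "\<And>j::nat. y j \<noteq> 0" "\<And>j. v (y j) = k - int j" by metis
  obtain c where c: "\<forall>j\<in>insert 0 C. c j \<in> K" "\<exists>j\<in>insert 0 C. c j \<noteq> 0"
      "\<forall>i\<in>C. (\<Sum>j\<in>insert 0 C. field_trace K (y j * w i) * c j) = 0"
    using homogeneous_system_nontrivial_solution[OF K, of C "insert 0 C" "\<lambda>i j. field_trace K (y j * w i)"]
      C trace_in by auto
  define \<rho> where "\<rho> = (\<Sum>j\<in>insert 0 C. c j * y j)"
  have tr: "field_trace K (\<rho> * w i) = 0" if i: "i \<in> C" for i
  proof -
    have "field_trace K (\<rho> * w i) = (\<Sum>j\<in>insert 0 C. field_trace K (c j * (y j * w i)))"
      unfolding \<rho>_def sum_distrib_right trace_sum by (simp only: mult.assoc)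
    also have "\<dots> = (\<Sum>j\<in>insert 0 C. field_trace K (y j * w i) * c j)"
    proof (intro sum.cong refl)
      fix j assume "j \<in> insert 0 C"
      then have "c j \<in> K" using c(1) by blast
      then show "field_trace K (c j * (y j * w i)) = field_trace K (y j * w i) * c j"
        by (simp add: trace_scale mult.commute)
    qed
    finally show ?thesis using c(3) i by simp
  qed
  have "\<rho> \<noteq> 0 \<and> (\<exists>j\<in>insert 0 C. int e dvd v \<rho> - v (y j))"
    unfolding \<rho>_def
  proof (rule v_base_combination)
    fix i j assume ij: "i \<in> insert 0 C" "j \<in> insert 0 C" "int e dvd v (y i) - v (y j)"
    then have "int e dvd int j - int i" by (simp add: y)
    moreover have "i < e" "j < e" using ij ram_index_pos by (auto simp: C_def)
    ultimately show "i = j" using dvd_diff_less_imp_eq[of j e i] by simp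
  qed (use C c y in auto)
  then obtain j where j: "\<rho> \<noteq> 0" "j \<in> insert 0 C" "int e dvd v \<rho> - (k - int j)"
    unfolding y(2) by blast
  \<comment> \<open>Otherwise \<rho> times the representative \<open>w j\<close> would have the
    critical class k and so nonzero trace, against orthogonality.\<close>
  have "j = 0"
  proof (rule ccontr)
    assume "j \<noteq> 0"
    then have jC: "j \<in> C" using j by simp
    have "int e dvd (v \<rho> - (k - int j)) + (v (w j) - int j)" using j(3) w(3)[OF jC] by (rule dvd_add)
    then have "int e dvd v (\<rho> * w j) - k" using j(1) w(2)[OF jC] by (simp add: v_mult algebra_simps)
    then show False using trace_nonzero_class[OF res, of "\<rho> * w j"] j(1) w(2)[OF jC] tr[OF jC] by (simp add: k_def)
  qed
  have "field_trace K (\<rho> * x) = 0" if x: "x \<in> nontrivial_part" for x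
  proof -
    have "\<exists>d. (\<forall>i\<in>C. d i \<in> K) \<and> x = (\<Sum>i\<in>C. d i * w i)"
    proof (rule spanned_by_class_representatives[OF res submoduleD(1)[OF V] C(1) w(1) _ x])
      fix t assume t: "t \<in> nontrivial_part" "t \<noteq> 0"
      define i where "i = nat (v t mod int e)"
      have i: "i < e" "int e dvd v t - int i" using ram_index_pos by (simp_all add: i_def nat_less_iff)
      then have iC: "i \<in> C" using t by (auto simp: C_def)
      have "int e dvd (v t - int i) - (v (w i) - int i)" using i(2) w(3)[OF iC] by (rule dvd_diff)
      then show "\<exists>i\<in>C. w i \<noteq> 0 \<and> int e dvd v t - v (w i)" using iC w(2) by auto
    qed
    then obtain d where d: "\<forall>i\<in>C. d i \<in> K" "x = (\<Sum>i\<in>C. d i * w i)" by blast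
    have "field_trace K (\<rho> * x) = (\<Sum>i\<in>C. field_trace K (d i * (\<rho> * w i)))"
      unfolding d(2) sum_distrib_left trace_sum by (simp only: mult.left_commute)
    also have "\<dots> = 0" using d(1) tr by (simp add: trace_scale)
    finally show ?thesis .
  qed
  with j \<open>j = 0\<close> show ?thesis by (auto simp: trace_perp_def k_def)
qed

lemma nongenerator_exists:
  assumes "(\<nexists>k. n = p ^ k) \<or> \<not> totally_ramified v K n \<or> \<not> [b = - different_val v K - 1] (mod (int n))"
  shows "\<exists>\<rho>. \<rho> \<noteq> 0 \<and> v \<rho> = b \<and> \<not> normal_basis_gen K m act \<rho>"
proof (cases residue_trivial)
  case False
  then obtain x where "x \<noteq> 0" "v x = 0" "\<And>c. c \<in> K \<Longrightarrow> \<not> vge 1 (x - c)"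
    unfolding residue_trivial_def by blast
  from trace_zero_residue_extension[OF this] show ?thesis using trace_zero_not_generator by blast
next
  case res: True
  note en = ram_index_eq_degree[OF res]
  show ?thesis
  proof (cases "int e dvd b - (- different_val v K - 1)")
    case False
    from trace_zero_other_class[OF this] show ?thesis using trace_zero_not_generator by blast
  next
    case True
    then have "[b = - different_val v K - 1] (mod (int n))" by (simp add: cong_iff_dvd_diff en)
    moreover have "totally_ramified v K n" using en by (simp add: totally_ramified_def)
    \<comment> \<open>Total ramification and the congruence hold here, so only the first alternative
      of the hypothesis is left.\<close>
    ultimately have "\<nexists>k. n = p ^ k" using assms by blast
    then have "\<not> nontrivial_part \<subseteq> {0}" using degree_prime_power by blast
    then obtain x where x: "x \<in> nontrivial_part" "x \<noteq> 0" by blast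
    obtain \<rho> where \<rho>: "\<rho> \<noteq> 0" "int e dvd v \<rho> - (- different_val v K - 1)"
        "\<rho> \<in> trace_perp nontrivial_part"
      using orthogonal_element_in_critical_class[OF res] by blast
    have "int e dvd (b - (- different_val v K - 1)) - (v \<rho> - (- different_val v K - 1))"
      using True \<rho>(2) by (rule dvd_diff)
    \<comment> \<open>A power of the uniformiser of K moves \<rho> to the exact valuation b without
      leaving the submodule.\<close>
    then obtain q where q: "b - v \<rho> = int e * q" by (auto elim: dvdE)
    have W: "submodule (trace_perp nontrivial_part)"
      by (rule submodule_trace_perp[OF submodule_nontrivial_part])
    have "trace_perp nontrivial_part \<noteq> UNIV" using trace_perp_eq_UNIV x by blast
    moreover have "\<pi> powi q * \<rho> \<in> trace_perp nontrivial_part"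
      by (rule submoduleD(6)[OF W \<pi>_powi(1) \<rho>(3)])
    ultimately have "\<not> normal_basis_gen K m act (\<pi> powi q * \<rho>)"
      by (rule not_generator_if_in_proper_submodule[OF W])
    moreover have "v (\<pi> powi q * \<rho>) = b" using \<rho>(1) q by (simp add: v_mult \<pi>_powi(3) mult.commute[of q])
    ultimately show ?thesis using \<rho>(1) \<pi>_powi(2) by (intro exI[of _ "\<pi> powi q * \<rho>"]) simp
  qed
qed

end

theorem theorem2:
  fixes p :: nat and K :: "'a::field set" and v :: "'a \<Rightarrow> int" and n :: nat
    and m :: nat and mu de :: "nat \<Rightarrow> nat \<Rightarrow> nat \<Rightarrow> 'a" and u ep :: "nat \<Rightarrow> 'a"
    and s :: "nat \<Rightarrow> nat \<Rightarrow> 'a" and act :: "nat \<Rightarrow> 'a \<Rightarrow> 'a" and b :: int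
  assumes "prime p" and "of_nat p = (0::'a)"
    and "subfield K"
    and "normalised_discrete_valuation v"
    and "nontrivial_on v K"
    and "finite_over (val_ring v \<inter> K) (val_ring v)"
    and "ext_degree_is K n"
    and "separable_ext K"
    and "hopf_galois K m mu u de ep s act"
    and "(\<nexists>k. n = p ^ k) \<or> \<not> totally_ramified v K n \<or>
         \<not> [b = - different_val v K - 1] (mod (int n))"
  shows "\<exists>\<rho>. \<rho> \<noteq> 0 \<and> v \<rho> = b \<and> \<not> normal_basis_gen K m act \<rho>"
proof -
  interpret hopf_galois_valued K n m mu de u ep s act p v
    using assms(1-9) by unfold_locales
  show ?thesis by (rule nongenerator_exists[OF assms(10)])
qed

end
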